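(* Let $\mathrm{Pe}\in\mathbb{R}$ and $D_e>0$. Let $f_0\in L^2_{\mathrm{per}}(\Upsilon)$ be non-negative with $\rho_0(x)=\int_0^{2\pi}f_0(x,\theta)\,d\theta\in[0,1]$ for a.e. $x\in\Omega$, and let $f$ be the unique (global-in-time) weak solution of $$\partial_t f+\mathrm{Pe}\,\mathrm{div}\big((1-\rho)f\,\mathbf e(\theta)\big)=D_e\Delta f+\partial_\theta^2 f$$ with initial data $f_0$. Assume that $$|\mathrm{Pe}|<\frac{\min\{D_e,1\}}{2\sqrt2\,\pi\,C_P(1+\langle f_0\rangle)},$$ where $C_P$ is the Poincaré constant associated to $\Upsilon$, and define $$\kappa:=\frac12\Big(\frac12C_P^{-2}\min\{D_e,1\}-\frac{(2\pi)^2\mathrm{Pe}^2(1+\langle f_0\rangle)^2}{\min\{D_e,1\}}\Big)>0.$$ Then $$\|f(t,\cdot)-\langle f_0\rangle\|_{L^2(\Upsilon)}\le e^{-\kappa t}\|f_0-\langle f_0\rangle\|_{L^2(\Upsilon)}\qquad\text{for all }t\ge0.$$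
   Context: $\Omega=(0,2\pi)^2$, $\Upsilon=\Omega\times(0,2\pi)=(0,2\pi)^3$, $\Upsilon_T=(0,T)\times\Upsilon$, $\Omega_T=(0,T)\times\Omega$, $\xi=(x,\theta)$ with $x\in\Omega$, $\theta\in(0,2\pi)$; $\mathbf e(\theta)=(\cos\theta,\sin\theta)$; $\mathrm{div},\nabla,\Delta$ act on $x$ only; $\nabla_\xi$ is the full gradient. $\langle g\rangle=\frac1{|\Upsilon|}\int_\Upsilon g\,d\xi$. The Poincaré constant $C_P$ is the constant in $\|v\|_{L^2(\Upsilon)}\le C_P\|\nabla_\xi v\|_{L^2(\Upsilon)}$ for $v\in H^1_{\mathrm{per}}(\Upsilon)$ with $\langle v\rangle=0$. The subscript "per" denotes spaces of functions on $\mathbb{R}^d$ that are $2\pi$-periodic in each coordinate, with norm taken over the periodic cell. Weak solution on $(0,T)$: given non-negative $f_0\in L^2_{\mathrm{per}}(\Upsilon)$ with $\rho_0=\int_0^{2\pi}f_0\,d\theta\in[0,1]$ a.e., a weak solution is a function $f\in C([0,T];L^2_{\mathrm{per}}(\Upsilon))\cap L^2(0,T;H^1_{\mathrm{per}}(\Upsilon))$ with $\partial_t f\in L^2(0,T;(H^1_{\mathrm{per}})'(\Upsilon))$ such that for all $\varphi\in L^2(0,T;H^1_{\mathrm{per}}(\Upsilon))$ $$\langle\partial_t f,\varphi\rangle=\mathrm{Pe}\int_{\Upsilon_T}(1-\rho)f\,\mathbf e(\theta)\cdot\nabla\varphi\,d\xi\,dt-D_e\int_{\Upsilon_T}\nabla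 f\cdot\nabla\varphi\,d\xi\,dt-\int_{\Upsilon_T}\partial_\theta f\,\partial_\theta\varphi\,d\xi\,dt,$$ $\lim_{t\to0^+}f(t)=f_0$ in $L^2_{\mathrm{per}}(\Upsilon)$, and $\rho(t,x)=\int_0^{2\pi}f(t,x,\theta)\,d\theta$ satisfies $0\le\rho\le1$ a.e. in $\Omega_T$. It is known that for such $f_0$ and every $T>0$ there is a unique weak solution; the weak solutions for different $T$ agree and define the global-in-time solution. *)

theory Defs
  imports "HOL-Analysis.Analysis"
begin

text \<open>Points are \<open>\<xi> = (x, \<theta>)\<close> with \<open>x = (x\<^sub>1, x\<^sub>2)\<close>. Elements of Lebesgue and Sobolev spaces are
  represented by functions; all notions below are insensitive to changes on null sets of the cell.\<close>

type_synonym point = "(real \<times> real) \<times> real"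

definition Omega :: "(real \<times> real) set" where
  "Omega = {0<..<2 * pi} \<times> {0<..<2 * pi}"

definition Upsilon :: "point set" where
  "Upsilon = Omega \<times> {0<..<2 * pi}"

definition evec :: "real \<Rightarrow> real \<times> real" where
  "evec \<theta> = (cos \<theta>, sin \<theta>)"

definition mean :: "(point \<Rightarrow> real) \<Rightarrow> real" where
  "mean g = (LINT \<xi>:Upsilon|lborel. g \<xi>) / measure lborel Upsilon"

definition theta_marginal :: "(point \<Rightarrow> real) \<Rightarrow> real \<times> real \<Rightarrow> real" where
  "theta_marginal g x = (LINT \<theta>:{0<..<2 * pi}|lborel. g (x, \<theta>))"


subsection \<open>Smooth functions\<close>

definition partial_deriv :: "'a \<Rightarrow> ('a::euclidean_space \<Rightarrow> real) \<Rightarrow> 'a \<Rightarrow> real" where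
  "partial_deriv b \<phi> x = frechet_derivative \<phi> (at x) b"

text \<open>All iterated partial derivatives exist and are (Frechet) differentiable, i.e. class \<open>C\<^sup>\<infinity>\<close>.\<close>

definition smooth :: "('a::euclidean_space \<Rightarrow> real) \<Rightarrow> bool" where
  "smooth \<phi> \<longleftrightarrow>
     (\<forall>bs. set bs \<subseteq> Basis \<longrightarrow> (\<forall>x. (foldr partial_deriv bs \<phi>) differentiable (at x)))"

definition periodic :: "('a::euclidean_space \<Rightarrow> 'b) \<Rightarrow> bool" where
  "periodic v \<longleftrightarrow> (\<forall>x. \<forall>b\<in>Basis. v (x + (2 * pi) *\<^sub>R b) = v x)"

definition compactly_supported_in :: "real \<Rightarrow> (real \<Rightarrow> real) \<Rightarrow> bool" where
  "compactly_supported_in T \<eta> \<longleftrightarrow> (\<exists>a b. 0 < a \<and> b < T \<and> (\<forall>t. t \<notin> {a..b} \<longrightarrow> \<eta> t = 0))"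


subsection \<open>Periodic Lebesgue and Sobolev spaces\<close>

definition L2_norm :: "(point \<Rightarrow> 'b::euclidean_space) \<Rightarrow> real" where
  "L2_norm v = sqrt (LINT \<xi>:Upsilon|lborel. (norm (v \<xi>))\<^sup>2)"

definition L2_per :: "(point \<Rightarrow> 'b::euclidean_space) set" where
  "L2_per = {v. v \<in> borel_measurable borel \<and> periodic v \<and>
                set_integrable lborel Upsilon (\<lambda>\<xi>. (norm (v \<xi>))\<^sup>2)}"

text \<open>Weak full gradient on the torus. Of its value \<open>G \<xi>\<close>, the part \<open>fst (G \<xi>)\<close> is the
  \<open>x\<close>-gradient and \<open>snd (G \<xi>)\<close> the \<open>\<theta>\<close>-derivative.\<close>

definition weak_gradient :: "(point \<Rightarrow> real) \<Rightarrow> (point \<Rightarrow> point) \<Rightarrow> bool" where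
  "weak_gradient v G \<longleftrightarrow> G \<in> L2_per \<and>
     (\<forall>\<psi>. smooth \<psi> \<longrightarrow> periodic \<psi> \<longrightarrow>
        (\<forall>b\<in>Basis. (LINT \<xi>:Upsilon|lborel. v \<xi> * partial_deriv b \<psi> \<xi>) =
                   - (LINT \<xi>:Upsilon|lborel. (G \<xi> \<bullet> b) * \<psi> \<xi>)))"

definition H1_per :: "(point \<Rightarrow> real) set" where
  "H1_per = {v \<in> L2_per. \<exists>G. weak_gradient v G}"

text \<open>Weak gradients are unique up to null sets, so the choice is immaterial.\<close>

definition wgrad :: "(point \<Rightarrow> real) \<Rightarrow> point \<Rightarrow> point" where
  "wgrad v = (SOME G. weak_gradient v G)"

definition H1_norm :: "(point \<Rightarrow> real) \<Rightarrow> real" where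
  "H1_norm v = sqrt ((L2_norm v)\<^sup>2 + (L2_norm (wgrad v))\<^sup>2)"

definition H1_dual :: "((point \<Rightarrow> real) \<Rightarrow> real) set" where
  "H1_dual = {L. (\<forall>u\<in>H1_per. \<forall>v\<in>H1_per. L (\<lambda>\<xi>. u \<xi> + v \<xi>) = L u + L v) \<and>
                 (\<forall>c. \<forall>v\<in>H1_per. L (\<lambda>\<xi>. c * v \<xi>) = c * L v) \<and>
                 (\<exists>K. \<forall>v\<in>H1_per. \<bar>L v\<bar> \<le> K * H1_norm v)}"

definition H1_dual_norm :: "((point \<Rightarrow> real) \<Rightarrow> real) \<Rightarrow> real" where
  "H1_dual_norm L = (SUP v\<in>{v \<in> H1_per. H1_norm v \<le> 1}. \<bar>L v\<bar>)"

definition poincare_constant :: "real \<Rightarrow> bool" where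
  "poincare_constant C \<longleftrightarrow>
     (\<forall>v\<in>H1_per. mean v = 0 \<longrightarrow> L2_norm v \<le> C * L2_norm (wgrad v))"


subsection \<open>Spaces of time-dependent functions\<close>

definition C_L2 :: "real \<Rightarrow> (real \<Rightarrow> point \<Rightarrow> real) set" where
  "C_L2 T = {u. (\<forall>t\<in>{0..T}. u t \<in> L2_per) \<and>
                (\<forall>t\<in>{0..T}. ((\<lambda>s. L2_norm (u s - u t)) \<longlongrightarrow> 0) (at t within {0..T}))}"

text \<open>The Bochner space \<open>L\<^sup>2(0,T;X)\<close> for a space with carrier \<open>X\<close> and norm \<open>N\<close>: strongly measurable
  (almost everywhere a limit of simple functions) with square-integrable norm. The measure in time
  is \<open>lebesgue\<close> since such functions are only determined almost everywhere.\<close>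

definition bochner_L2 :: "'x set \<Rightarrow> ('x::minus \<Rightarrow> real) \<Rightarrow> real \<Rightarrow> (real \<Rightarrow> 'x) set" where
  "bochner_L2 X N T =
     {u. (AE t in lebesgue. t \<in> {0<..<T} \<longrightarrow> u t \<in> X) \<and>
         (\<exists>s. (\<forall>n::nat. simple_function lebesgue (s n) \<and> range (s n) \<subseteq> X) \<and>
              (AE t in lebesgue. t \<in> {0<..<T} \<longrightarrow> (\<lambda>n. N (s n t - u t)) \<longlonglongrightarrow> 0)) \<and>
         (\<integral>\<^sup>+t\<in>{0<..<T}. ennreal ((N (u t))\<^sup>2) \<partial>lebesgue) < \<infinity>}"

text \<open>Integrals over \<open>(0,T) \<times> \<Upsilon>\<close> need jointly measurable representatives.\<close>

definition jointly_measurable :: "real \<Rightarrow> (real \<Rightarrow> point \<Rightarrow> 'b::euclidean_space) \<Rightarrow> bool" where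
  "jointly_measurable T u \<longleftrightarrow>
     set_borel_measurable borel ({0<..<T} \<times> UNIV) (\<lambda>(t, \<xi>). u t \<xi>)"

definition space_gradient ::
    "real \<Rightarrow> (real \<Rightarrow> point \<Rightarrow> real) \<Rightarrow> (real \<Rightarrow> point \<Rightarrow> point) \<Rightarrow> bool" where
  "space_gradient T u Du \<longleftrightarrow> jointly_measurable T Du \<and>
     (AE t in lebesgue. t \<in> {0<..<T} \<longrightarrow> weak_gradient (u t) (Du t))"

text \<open>\<open>F = \<partial>\<^sub>t u\<close> in the sense of \<open>(H\<^sup>1)'\<close>-valued distributions on \<open>(0,T)\<close>, where \<open>L\<^sup>2\<close> is embedded
  in \<open>(H\<^sup>1)'\<close> by the \<open>L\<^sup>2\<close> inner product; the identity in \<open>(H\<^sup>1)'\<close> is written out on each \<open>\<psi>\<close>.\<close>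

definition weak_time_derivative ::
    "real \<Rightarrow> (real \<Rightarrow> point \<Rightarrow> real) \<Rightarrow> (real \<Rightarrow> (point \<Rightarrow> real) \<Rightarrow> real) \<Rightarrow> bool" where
  "weak_time_derivative T u F \<longleftrightarrow>
     F \<in> bochner_L2 H1_dual H1_dual_norm T \<and>
     (\<forall>\<eta>. smooth \<eta> \<longrightarrow> compactly_supported_in T \<eta> \<longrightarrow>
        (\<forall>\<psi>\<in>H1_per.
           (LINT t:{0<..<T}|lebesgue. deriv \<eta> t * (LINT \<xi>:Upsilon|lborel. u t \<xi> * \<psi> \<xi>)) =
           - (LINT t:{0<..<T}|lebesgue. \<eta> t * F t \<psi>)))"


subsection \<open>Weak solutions\<close>

definition weak_solution ::
    "real \<Rightarrow> real \<Rightarrow> real \<Rightarrow> (point \<Rightarrow> real) \<Rightarrow> (real \<Rightarrow> point \<Rightarrow> real) \<Rightarrow> bool" where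
  "weak_solution Pe De T f0 f \<longleftrightarrow>
     f \<in> C_L2 T \<and> f \<in> bochner_L2 H1_per H1_norm T \<and> jointly_measurable T f \<and>
     (\<exists>Df F. space_gradient T f Df \<and> weak_time_derivative T f F \<and>
        (\<forall>\<phi> D\<phi>. \<phi> \<in> bochner_L2 H1_per H1_norm T \<longrightarrow> space_gradient T \<phi> D\<phi> \<longrightarrow>
           (LINT t:{0<..<T}|lebesgue. F t (\<phi> t)) =
             Pe * (LINT (t, x, \<theta>):{0<..<T} \<times> Upsilon|lborel.
                     (1 - theta_marginal (f t) x) * f t (x, \<theta>) * (evec \<theta> \<bullet> fst (D\<phi> t (x, \<theta>))))
             - De * (LINT (t, \<xi>):{0<..<T} \<times> Upsilon|lborel. fst (Df t \<xi>) \<bullet> fst (D\<phi> t \<xi>))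
             - (LINT (t, \<xi>):{0<..<T} \<times> Upsilon|lborel. snd (Df t \<xi>) * snd (D\<phi> t \<xi>)))) \<and>
     ((\<lambda>t. L2_norm (f t - f0)) \<longlongrightarrow> 0) (at_right 0) \<and>
     (AE (t, x) in lborel. (t, x) \<in> {0<..<T} \<times> Omega \<longrightarrow>
        0 \<le> theta_marginal (f t) x \<and> theta_marginal (f t) x \<le> 1)"

definition global_weak_solution ::
    "real \<Rightarrow> real \<Rightarrow> (point \<Rightarrow> real) \<Rightarrow> (real \<Rightarrow> point \<Rightarrow> real) \<Rightarrow> bool" where
  "global_weak_solution Pe De f0 f \<longleftrightarrow> (\<forall>T>0. weak_solution Pe De T f0 f)"

end

theory Submission imports Defs begin

text \<open>Energy method. Tested with \<open>f - \<langle>f\<^sub>0\<rangle>\<close>, the equation gives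
  \<open>1/2 d/dt \<parallel>f - \<langle>f\<^sub>0\<rangle>\<parallel>\<^sup>2 = \<integral> J \<cdot> \<nabla>\<^sub>\<xi> f\<close> with the flux
  \<open>J = (Pe (1 - \<rho>) f e(\<theta>) - D\<^sub>e \<nabla>f, - \<partial>\<^sub>\<theta> f)\<close>. To justify this without the Lions-Magenes lemma, only the
  test functions \<open>\<eta>(t) E\<^sub>k(\<xi>)\<close> with real Fourier modes \<open>E\<^sub>k\<close> are used: each coefficient \<open>(f(t), E\<^sub>k)\<close> is
  absolutely continuous with derivative \<open>\<integral> J \<cdot> \<nabla>E\<^sub>k\<close>, its square is integrated in time, and Parseval's
  identity sums the results, since differentiation only permutes and rescales the modes. The dual norm of
  \<open>\<partial>\<^sub>t f\<close> never enters.

  With \<open>m = \<langle>f\<^sub>0\<rangle>\<close> and \<open>g = f - m\<close>, write \<open>(1 - \<rho>) f = (1 - \<rho>) g - m (\<rho> - 2\<pi>m) + m (1 - 2\<pi>m)\<close>. The last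
  term contributes nothing because \<open>\<integral> e(\<theta>) \<cdot> \<nabla>f = 0\<close>; the rest has norm at most \<open>(1 + 2\<pi>m) \<parallel>g\<parallel>\<close>, as
  \<open>0 \<le> \<rho> \<le> 1\<close> and \<open>\<rho> - 2\<pi>m\<close> is the \<open>\<theta>\<close>-marginal of \<open>g\<close>. Young's and Poincare's inequalities then bound
  \<open>\<integral> J \<cdot> \<nabla>\<^sub>\<xi> f\<close> by \<open>-\<kappa> \<parallel>g\<parallel>\<^sup>2\<close>.\<close>


subsection \<open>Square-integrable functions\<close>

text \<open>The obstacle: \<open>weak_time_derivative\<close> offers only scalar identities, one for
  each smooth \<eta> and each fixed function of \<xi>. Using the solution itself as test function
  would mean regularising it in time with values in H1 and its dual; with a fixed mode everything is
  about real functions of t. The price is exchanging the sum over the modes with the time integral,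
  which rests on a Parseval bound independent of the number of modes.

  These identities reach only 0 < s < t < T. The initial data therefore enter through limits s -> 0,
  once to identify the conserved mean of f(t) and once in the final estimate.

  Constants, with \<mu> = min De 1: Young's inequality spends half of the dissipation \<mu> on the
  transport term, and Poincare's inequality uses the other half. The resulting rate contains C_P^-2
  where \<kappa> has C_P^-2 / 2, so \<kappa> lies below the rate reached; the smallness condition on
  Pe, squared, says exactly \<kappa> > 0. The factor 2 pi (1 + m) in \<kappa> is a weakening of 1 +
  2 pi m.\<close>

definition square_integrable :: "'a measure \<Rightarrow> ('a \<Rightarrow> real) \<Rightarrow> bool" where
  "square_integrable M f \<longleftrightarrow> f \<in> borel_measurable M \<and> integrable M (\<lambda>x. (f x)\<^sup>2)"

lemma abs_mult_le_power2_add: "\<bar>a * b\<bar> \<le> a\<^sup>2 + b\<^sup>2" for a b :: real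
proof -
  have "2 * (\<bar>a\<bar> * \<bar>b\<bar>) \<le> a\<^sup>2 + b\<^sup>2"
    using zero_le_power2[of "\<bar>a\<bar> - \<bar>b\<bar>"] by (simp add: power2_diff)
  moreover have "0 \<le> \<bar>a\<bar> * \<bar>b\<bar>" by simp
  ultimately have "\<bar>a\<bar> * \<bar>b\<bar> \<le> a\<^sup>2 + b\<^sup>2" by linarith
  then show ?thesis by (simp add: abs_mult)
qed

lemma square_integrable_mult:
  assumes "square_integrable M f" "square_integrable M g"
  shows "integrable M (\<lambda>x. f x * g x)"
proof (rule Bochner_Integration.integrable_bound)
  show "integrable M (\<lambda>x. (f x)\<^sup>2 + (g x)\<^sup>2)"
    using assms by (auto simp: square_integrable_def)
  show "(\<lambda>x. f x * g x) \<in> borel_measurable M"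
    using assms by (auto simp: square_integrable_def)
  show "AE x in M. norm (f x * g x) \<le> norm ((f x)\<^sup>2 + (g x)\<^sup>2)"
    using abs_mult_le_power2_add by (intro AE_I2) (simp add: abs_of_nonneg)
qed

lemma square_integrable_bound:
  assumes "g \<in> borel_measurable M" "integrable M h" "AE x in M. (g x)\<^sup>2 \<le> h x"
  shows "square_integrable M g"
  unfolding square_integrable_def
proof (intro conjI)
  show "integrable M (\<lambda>x. (g x)\<^sup>2)"
    by (rule Bochner_Integration.integrable_bound[OF assms(2)]) (use assms in auto)
qed fact

lemma square_integrable_add:
  assumes "square_integrable M f" "square_integrable M g"
  shows "square_integrable M (\<lambda>x. f x + g x)"
  unfolding square_integrable_def
proof (intro conjI)
  show "(\<lambda>x. f x + g x) \<in> borel_measurable M"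
    using assms by (auto simp: square_integrable_def)
  have "(\<lambda>x. (f x + g x)\<^sup>2) = (\<lambda>x. (f x)\<^sup>2 + (g x)\<^sup>2 + 2 * (f x * g x))"
    by (auto simp: power2_sum)
  then show "integrable M (\<lambda>x. (f x + g x)\<^sup>2)"
    using assms square_integrable_mult[OF assms] by (auto simp: square_integrable_def)
qed

lemma square_integrable_cmult:
  assumes "square_integrable M f"
  shows "square_integrable M (\<lambda>x. c * f x)"
  using assms by (auto simp: square_integrable_def power_mult_distrib)

lemma square_integrable_diff:
  assumes "square_integrable M f" "square_integrable M g"
  shows "square_integrable M (\<lambda>x. f x - g x)"
  using square_integrable_add[OF assms(1) square_integrable_cmult[OF assms(2), of "-1"]] by simp

lemma square_integrable_bounded_mult:
  assumes "square_integrable M f" "h \<in> borel_measurable M" "AE x in M. \<bar>h x\<bar> \<le> B"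
  shows "square_integrable M (\<lambda>x. h x * f x)"
proof (rule square_integrable_bound)
  show "integrable M (\<lambda>x. B\<^sup>2 * (f x)\<^sup>2)" "(\<lambda>x. h x * f x) \<in> borel_measurable M"
    using assms by (auto simp: square_integrable_def)
  show "AE x in M. (h x * f x)\<^sup>2 \<le> B\<^sup>2 * (f x)\<^sup>2"
    using assms(3)
  proof eventually_elim
    case (elim x)
    then have "(h x)\<^sup>2 \<le> B\<^sup>2" by (metis abs_ge_zero order_trans power2_abs power_mono)
    then show ?case by (simp add: power_mult_distrib mult_right_mono)
  qed
qed

lemma (in finite_measure) square_integrable_const: "square_integrable M (\<lambda>_. c)"
  by (simp add: square_integrable_def)

lemma (in finite_measure) square_integrable_bounded:
  assumes "h \<in> borel_measurable M" "AE x in M. \<bar>h x\<bar> \<le> B"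
  shows "square_integrable M h"
  using square_integrable_bounded_mult[OF square_integrable_const[of 1] assms] by simp

lemma (in finite_measure) square_integrable_finite_integrable:
  assumes "square_integrable M f"
  shows "integrable M f"
  using square_integrable_mult[OF assms square_integrable_const[of 1]] by simp

lemma integral_power2_add:
  assumes "square_integrable M f" "square_integrable M g"
  shows "(LINT x|M. (f x + g x)\<^sup>2) = (LINT x|M. (f x)\<^sup>2) + (LINT x|M. (g x)\<^sup>2) + 2 * (LINT x|M. f x * g x)"
proof -
  have "(\<lambda>x. (f x + g x)\<^sup>2) = (\<lambda>x. (f x)\<^sup>2 + (g x)\<^sup>2 + 2 * (f x * g x))"
    by (auto simp: power2_sum)
  then show ?thesis
    using assms square_integrable_mult[OF assms] by (simp add: square_integrable_def)
qed

text \<open>The integral of (f + s g)^2 is a nonnegative polynomial in s. For c > 0 its minimiser s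
  = - b / c gives the claim; for c = 0 it is affine in s, hence constant.\<close>

lemma integral_Cauchy_Schwarz:
  assumes "square_integrable M f" "square_integrable M g"
  shows "(LINT x|M. f x * g x)\<^sup>2 \<le> (LINT x|M. (f x)\<^sup>2) * (LINT x|M. (g x)\<^sup>2)"
proof -
  define a b c where "a = (LINT x|M. (f x)\<^sup>2)" and "b = (LINT x|M. f x * g x)" and "c = (LINT x|M. (g x)\<^sup>2)"
  have q: "0 \<le> a + s\<^sup>2 * c + 2 * (s * b)" for s
  proof -
    have "0 \<le> (LINT x|M. (f x + s * g x)\<^sup>2)" by simp
    also have "\<dots> = a + s\<^sup>2 * c + 2 * (s * b)"
      using integral_power2_add[OF assms(1) square_integrable_cmult[OF assms(2), of s]]
      by (simp add: a_def b_def c_def power_mult_distrib mult.left_commute)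
    finally show ?thesis .
  qed
  have c: "0 \<le> c" and a: "0 \<le> a" by (auto simp: a_def c_def)
  have "b\<^sup>2 \<le> a * c"
  proof (cases "c = 0")
    case True
    have "b = 0"
    proof (rule ccontr)
      assume "b \<noteq> 0"
      \<comment> \<open>This s makes the affine function a + 2 s b equal to -1.\<close>
      have "0 \<le> a + 2 * ((- (a + 1) / (2 * b)) * b)" using q[of "- (a + 1) / (2 * b)"] True by simp
      also have "\<dots> = -1" using \<open>b \<noteq> 0\<close> by (simp add: field_simps)
      finally show False by simp
    qed
    then show ?thesis using True by simp
  next
    case False
    with c have "c > 0" by simp
    have "0 \<le> a + (- b / c)\<^sup>2 * c + 2 * ((- b / c) * b)" by (rule q)
    also have "\<dots> = a - b\<^sup>2 / c" using False by (simp add: field_simps power2_eq_square)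
    finally show ?thesis using \<open>c > 0\<close> by (simp add: field_simps)
  qed
  then show ?thesis by (simp add: a_def b_def c_def)
qed

lemma integral_Minkowski:
  assumes "square_integrable M f" "square_integrable M g"
  shows "sqrt (LINT x|M. (f x + g x)\<^sup>2) \<le> sqrt (LINT x|M. (f x)\<^sup>2) + sqrt (LINT x|M. (g x)\<^sup>2)"
proof (rule real_le_lsqrt)
  have "(LINT x|M. f x * g x) \<le> sqrt ((LINT x|M. (f x)\<^sup>2) * (LINT x|M. (g x)\<^sup>2))"
    by (rule real_le_rsqrt[OF integral_Cauchy_Schwarz[OF assms]])
  then show "(LINT x|M. (f x + g x)\<^sup>2) \<le> (sqrt (LINT x|M. (f x)\<^sup>2) + sqrt (LINT x|M. (g x)\<^sup>2))\<^sup>2"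
    by (simp only: integral_power2_add[OF assms]) (simp add: power2_sum real_sqrt_mult)
qed auto

lemma square_integrable_sum:
  assumes "\<And>i. i \<in> I \<Longrightarrow> square_integrable M (f i)"
  shows "square_integrable M (\<lambda>x. \<Sum>i\<in>I. f i x)"
  using assms
proof (induction I rule: infinite_finite_induct)
  case (insert i I) then show ?case by (simp add: square_integrable_add)
qed (auto simp: square_integrable_def)

text \<open>Turns the cell into a triple product of circles and the space-time cylinder into time x
  cell, so that Fubini and products of Parseval systems apply to the set integrals of the
  definitions.\<close>

lemma pair_restrict_space_lborel:
  fixes A :: "'a::euclidean_space set" and B :: "'b::euclidean_space set"
  assumes A: "A \<in> sets borel" and B: "B \<in> sets borel"
  shows "restrict_space lborel A \<Otimes>\<^sub>M restrict_space lborel B = restrict_space lborel (A \<times> B)"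
proof (rule pair_measure_eqI)
  have sfin: "sigma_finite_measure (restrict_space lborel C)" if "C \<in> sets borel" for C :: "'c::euclidean_space set"
    using that by (intro sigma_finite_measure_restrict_space) (auto simp: lborel.sigma_finite_measure_axioms)
  show "sigma_finite_measure (restrict_space lborel A)" "sigma_finite_measure (restrict_space lborel B)"
    using A B sfin by auto
  have AB: "A \<times> B \<in> sets (borel :: ('a \<times> 'b) measure)"
    using A B by (metis borel_prod pair_measureI)
  show "sets (restrict_space lborel A \<Otimes>\<^sub>M restrict_space lborel B) = sets (restrict_space lborel (A \<times> B))"
  proof
    have "a \<times> b \<in> sets (restrict_space lborel (A \<times> B))"
      if "a \<in> sets (restrict_space lborel A)" "b \<in> sets (restrict_space lborel B)" for a b
    proof -
      from that have "a \<subseteq> A" "b \<subseteq> B" "a \<in> sets borel" "b \<in> sets borel"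
        using A B by (auto simp: sets_restrict_space)
      then have "a \<times> b \<in> sets (borel :: ('a \<times> 'b) measure)" "a \<times> b \<subseteq> A \<times> B"
        by (metis borel_prod pair_measureI) (use \<open>a \<subseteq> A\<close> \<open>b \<subseteq> B\<close> in auto)
      then show ?thesis using AB by (subst sets_restrict_space_iff) auto
    qed
    then show "sets (restrict_space lborel A \<Otimes>\<^sub>M restrict_space lborel B) \<subseteq> sets (restrict_space lborel (A \<times> B))"
      unfolding sets_pair_measure
      by (intro sets.sigma_sets_subset') (auto simp: space_restrict_space AB sets_restrict_space_iff)
    show "sets (restrict_space lborel (A \<times> B)) \<subseteq> sets (restrict_space lborel A \<Otimes>\<^sub>M restrict_space lborel B)"
    proof
      fix X assume "X \<in> sets (restrict_space lborel (A \<times> B))"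
      then obtain Y where Y: "Y \<in> sets (borel :: ('a \<times> 'b) measure)" "X = (A \<times> B) \<inter> Y"
        by (auto simp: sets_restrict_space)
      \<comment> \<open>The identity is measurable from the product to the Borel space because both
        components are; the preimage of Y under it is the trace of Y on A x B.\<close>
      have m: "(\<lambda>z. z) \<in> restrict_space lborel C \<rightarrow>\<^sub>M borel" for C :: "'c::euclidean_space set"
        by (rule measurable_restrict_space1) simp
      have "(\<lambda>z. (fst z, snd z)) \<in> restrict_space lborel A \<Otimes>\<^sub>M restrict_space lborel B \<rightarrow>\<^sub>M borel \<Otimes>\<^sub>M borel"
        by (intro measurable_Pair measurable_compose[OF measurable_fst m] measurable_compose[OF measurable_snd m])
      then have "(\<lambda>z. z) \<in> restrict_space lborel A \<Otimes>\<^sub>M restrict_space lborel B \<rightarrow>\<^sub>M (borel :: ('a \<times> 'b) measure)"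
        by (simp add: borel_prod)
      from measurable_sets[OF this Y(1)]
      have "Y \<inter> (A \<times> B) \<in> sets (restrict_space lborel A \<Otimes>\<^sub>M restrict_space lborel B)"
        by (simp add: space_pair_measure space_restrict_space)
      then show "X \<in> sets (restrict_space lborel A \<Otimes>\<^sub>M restrict_space lborel B)"
        using Y(2) by (simp add: Int_commute)
    qed
  qed
  fix X Y assume X: "X \<in> sets (restrict_space lborel A)" and Y: "Y \<in> sets (restrict_space lborel B)"
  then have "X \<subseteq> A" "X \<in> sets borel" "Y \<subseteq> B" "Y \<in> sets borel"
    using A B by (auto simp: sets_restrict_space)
  with AB show "emeasure (restrict_space lborel A) X * emeasure (restrict_space lborel B) Y =
      emeasure (restrict_space lborel (A \<times> B)) (X \<times> Y)"
    using A B by (subst (1 2 3) emeasure_restrict_space)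
      (auto simp: lborel_prod[symmetric] lborel.emeasure_pair_measure_Times)
qed

subsection \<open>Parseval systems and their products\<close>

text \<open>A Parseval frame. The sum is a nonnegative integral over the counting measure, so that
  Tonelli exchanges it with other integrals without summability conditions.\<close>

definition parseval_system :: "'a measure \<Rightarrow> ('i \<Rightarrow> 'a \<Rightarrow> real) \<Rightarrow> bool" where
  "parseval_system M e \<longleftrightarrow> (\<forall>i. square_integrable M (e i)) \<and>
     (\<forall>g. square_integrable M g \<longrightarrow>
       (\<integral>\<^sup>+ i. ennreal ((LINT x|M. g x * e i x)\<^sup>2) \<partial>count_space UNIV) = ennreal (LINT x|M. (g x)\<^sup>2))"

lemma nn_integral_power2:
  assumes "square_integrable M g"
  shows "(\<integral>\<^sup>+ x. ennreal ((g x)\<^sup>2) \<partial>M) = ennreal (LINT x|M. (g x)\<^sup>2)"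
  using assms by (intro nn_integral_eq_integral) (auto simp: square_integrable_def)

lemma square_integrable_pair_mult:
  assumes "sigma_finite_measure M" "sigma_finite_measure N"
    "square_integrable M f" "square_integrable N g"
  shows "square_integrable (M \<Otimes>\<^sub>M N) (\<lambda>(x, y). f x * g y)"
proof -
  interpret M: sigma_finite_measure M by fact
  interpret N: sigma_finite_measure N by fact
  interpret pair_sigma_finite M N ..
  have [measurable]: "f \<in> borel_measurable M" "g \<in> borel_measurable N"
    and i: "integrable M (\<lambda>x. (f x)\<^sup>2)" "integrable N (\<lambda>x. (g x)\<^sup>2)"
    using assms by (auto simp: square_integrable_def)
  have "integrable (M \<Otimes>\<^sub>M N) (\<lambda>(x, y). (f x)\<^sup>2 * (g y)\<^sup>2)"
    by (rule Fubini_integrable) (use i in \<open>auto simp: abs_mult\<close>)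
  then show ?thesis
    by (auto simp: square_integrable_def split_beta' power_mult_distrib)
qed

lemma square_integrable_fst:
  assumes "sigma_finite_measure M" "sigma_finite_measure N" "square_integrable (M \<Otimes>\<^sub>M N) g"
  shows "AE x in M. square_integrable N (\<lambda>y. g (x, y))"
    and "integrable M (\<lambda>x. LINT y|N. (g (x, y))\<^sup>2)"
    and "(LINT x|M. LINT y|N. (g (x, y))\<^sup>2) = (LINT z|(M \<Otimes>\<^sub>M N). (g z)\<^sup>2)"
proof -
  interpret M: sigma_finite_measure M by fact
  interpret N: sigma_finite_measure N by fact
  interpret pair_sigma_finite M N ..
  have [measurable]: "g \<in> borel_measurable (M \<Otimes>\<^sub>M N)"
    and i: "integrable (M \<Otimes>\<^sub>M N) (\<lambda>z. (g z)\<^sup>2)"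
    using assms by (auto simp: square_integrable_def)
  have i': "integrable (M \<Otimes>\<^sub>M N) (\<lambda>(x, y). (g (x, y))\<^sup>2)" using i by (simp add: split_beta')
  have "AE x in M. x \<in> space M" by simp
  with AE_integrable_fst[OF i'] show "AE x in M. square_integrable N (\<lambda>y. g (x, y))"
    by eventually_elim (auto simp: square_integrable_def)
  show "integrable M (\<lambda>x. LINT y|N. (g (x, y))\<^sup>2)" using integrable_fst[OF i'] by simp
  show "(LINT x|M. LINT y|N. (g (x, y))\<^sup>2) = (LINT z|(M \<Otimes>\<^sub>M N). (g z)\<^sup>2)"
    using integral_fst[OF i'] by (simp add: split_beta')
qed

text \<open>Expand almost every slice g(x, .) in the system \<open>d\<close>; by Cauchy-Schwarz its
  coefficients \<open>G j\<close> are square-integrable in x and can be expanded in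
  \<open>e\<close>. Countable indices allow the sum over j to pass the integral over x.\<close>

lemma parseval_system_pair:
  fixes e :: "'i::countable \<Rightarrow> 'a \<Rightarrow> real" and d :: "'j::countable \<Rightarrow> 'b \<Rightarrow> real"
  assumes M: "sigma_finite_measure M" and N: "sigma_finite_measure N"
    and e: "parseval_system M e" and d: "parseval_system N d"
  shows "parseval_system (M \<Otimes>\<^sub>M N) (\<lambda>(i, j) (x, y). e i x * d j y)"
proof -
  interpret M: sigma_finite_measure M by fact
  interpret N: sigma_finite_measure N by fact
  interpret pair_sigma_finite M N ..
  have sqe: "square_integrable M (e i)" and sqd: "square_integrable N (d j)" for i j
    using e d by (auto simp: parseval_system_def)
  then have [measurable]: "e i \<in> borel_measurable M" "d j \<in> borel_measurable N" for i j
    by (auto simp: square_integrable_def)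
  have sqed: "square_integrable (M \<Otimes>\<^sub>M N) (\<lambda>(x, y). e i x * d j y)" for i j
    by (rule square_integrable_pair_mult[OF M N sqe sqd])
  have "(\<integral>\<^sup>+ p. ennreal ((LINT z|(M \<Otimes>\<^sub>M N). g z * (case p of (i, j) \<Rightarrow> \<lambda>(x, y). e i x * d j y) z)\<^sup>2)
          \<partial>count_space UNIV) = ennreal (LINT z|(M \<Otimes>\<^sub>M N). (g z)\<^sup>2)"
    if g: "square_integrable (M \<Otimes>\<^sub>M N) g" for g
  proof -
    have [measurable]: "g \<in> borel_measurable (M \<Otimes>\<^sub>M N)" using g by (auto simp: square_integrable_def)
    note fst = square_integrable_fst[OF M N g]
    define G where "G j x = (LINT y|N. g (x, y) * d j y)" for j x
    have [measurable]: "G j \<in> borel_measurable M" for j unfolding G_def by measurable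
    have Gsq: "square_integrable M (G j)" for j
    proof (rule square_integrable_bound)
      show "integrable M (\<lambda>x. (LINT y|N. (g (x, y))\<^sup>2) * (LINT y|N. (d j y)\<^sup>2))"
        using fst(2) by simp
      show "AE x in M. (G j x)\<^sup>2 \<le> (LINT y|N. (g (x, y))\<^sup>2) * (LINT y|N. (d j y)\<^sup>2)"
        using fst(1) by eventually_elim (simp add: G_def integral_Cauchy_Schwarz sqd)
    qed simp
    have coef: "(LINT z|(M \<Otimes>\<^sub>M N). g z * (case z of (x, y) \<Rightarrow> e i x * d j y)) = (LINT x|M. G j x * e i x)" for i j
    proof -
      have "integrable (M \<Otimes>\<^sub>M N) (\<lambda>(x, y). g (x, y) * (e i x * d j y))"
        using square_integrable_mult[OF g sqed[of i j]] by (simp add: split_beta')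
      from integral_fst[OF this]
      have "(LINT z|(M \<Otimes>\<^sub>M N). g z * (case z of (x, y) \<Rightarrow> e i x * d j y))
          = (LINT x|M. LINT y|N. g (x, y) * (e i x * d j y))"
        by (simp add: split_beta')
      also have "\<dots> = (LINT x|M. G j x * e i x)"
      proof (rule Bochner_Integration.integral_cong[OF refl])
        fix x
        have "(LINT y|N. g (x, y) * (e i x * d j y)) = (LINT y|N. (g (x, y) * d j y) * e i x)"
          by (simp add: mult_ac)
        then show "(LINT y|N. g (x, y) * (e i x * d j y)) = G j x * e i x" by (simp add: G_def)
      qed
      finally show ?thesis .
    qed
    have "(\<integral>\<^sup>+ p. ennreal ((LINT z|(M \<Otimes>\<^sub>M N). g z * (case p of (i, j) \<Rightarrow> \<lambda>(x, y). e i x * d j y) z)\<^sup>2) \<partial>count_space UNIV)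
        = (\<integral>\<^sup>+ j. \<integral>\<^sup>+ i. ennreal ((LINT x|M. G j x * e i x)\<^sup>2) \<partial>count_space UNIV \<partial>count_space UNIV)"
      by (subst nn_integral_snd_count_space[symmetric]) (simp add: coef)
    also have "\<dots> = (\<integral>\<^sup>+ j. ennreal (LINT x|M. (G j x)\<^sup>2) \<partial>count_space UNIV)"
      using e Gsq by (simp add: parseval_system_def)
    also have "\<dots> = (\<integral>\<^sup>+ j. \<integral>\<^sup>+ x. ennreal ((G j x)\<^sup>2) \<partial>M \<partial>count_space UNIV)"
      by (simp add: nn_integral_power2 Gsq)
    also have "\<dots> = (\<integral>\<^sup>+ x. \<integral>\<^sup>+ j. ennreal ((G j x)\<^sup>2) \<partial>count_space UNIV \<partial>M)"
      by (rule nn_integral_count_space_nn_integral[symmetric]) auto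
    also have "\<dots> = (\<integral>\<^sup>+ x. ennreal (LINT y|N. (g (x, y))\<^sup>2) \<partial>M)"
      using fst(1) d
      by (intro nn_integral_cong_AE) (auto simp: parseval_system_def G_def elim!: eventually_mono)
    also have "\<dots> = ennreal (LINT x|M. LINT y|N. (g (x, y))\<^sup>2)"
      by (rule nn_integral_eq_integral[OF fst(2)]) simp
    finally show ?thesis using fst(3) by simp
  qed
  then show ?thesis
    using sqed unfolding parseval_system_def by (auto simp: split_beta')
qed

lemma parseval_has_sum_power2:
  assumes "parseval_system M e" "square_integrable M g"
  shows "((\<lambda>i. (LINT x|M. g x * e i x)\<^sup>2) has_sum (LINT x|M. (g x)\<^sup>2)) UNIV"
proof -
  have *: "(\<integral>\<^sup>+ i. ennreal ((LINT x|M. g x * e i x)\<^sup>2) \<partial>count_space UNIV) = ennreal (LINT x|M. (g x)\<^sup>2)"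
    using assms by (auto simp: parseval_system_def)
  have i: "integrable (count_space UNIV) (\<lambda>i. (LINT x|M. g x * e i x)\<^sup>2)"
    by (rule integrableI_nonneg) (auto simp: *)
  then have a: "Infinite_Set_Sum.abs_summable_on (\<lambda>i. (LINT x|M. g x * e i x)\<^sup>2) UNIV"
    by (simp add: abs_summable_on_def set_integrable_def)
  have "(LINT i|count_space UNIV. (LINT x|M. g x * e i x)\<^sup>2) = (LINT x|M. (g x)\<^sup>2)"
    by (rule integral_eq_nn_integral[THEN trans]) (auto simp: *)
  then have "infsetsum (\<lambda>i. (LINT x|M. g x * e i x)\<^sup>2) UNIV = (LINT x|M. (g x)\<^sup>2)"
    by (simp add: infsetsum_def set_lebesgue_integral_def)
  with a show ?thesis
    by (metis abs_summable_equivalent abs_summable_summable has_sum_infsum infsetsum_infsum)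
qed

text \<open>Polarisation: a b = ((a + b)^2 - (a - b)^2) / 4, applied to the coefficients and to the
  functions.\<close>

lemma parseval_has_sum:
  assumes e: "parseval_system M e" and g: "square_integrable M g" and h: "square_integrable M h"
  shows "((\<lambda>i. (LINT x|M. g x * e i x) * (LINT x|M. h x * e i x)) has_sum (LINT x|M. g x * h x)) UNIV"
proof -
  have e': "square_integrable M (e i)" for i using e by (simp add: parseval_system_def)
  define a b where "a i = (LINT x|M. g x * e i x)" and "b i = (LINT x|M. h x * e i x)" for i
  have ab: "(LINT x|M. (g x + h x) * e i x) = a i + b i" "(LINT x|M. (g x - h x) * e i x) = a i - b i" for i
    using square_integrable_mult[OF g e'] square_integrable_mult[OF h e']
    by (simp_all add: a_def b_def algebra_simps)
  have "((\<lambda>i. (a i + b i)\<^sup>2) has_sum (LINT x|M. (g x + h x)\<^sup>2)) UNIV"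
    using parseval_has_sum_power2[OF e square_integrable_add[OF g h]] by (simp add: ab)
  moreover have "((\<lambda>i. (a i - b i)\<^sup>2) has_sum (LINT x|M. (g x - h x)\<^sup>2)) UNIV"
    using parseval_has_sum_power2[OF e square_integrable_diff[OF g h]] by (simp add: ab)
  then have "((\<lambda>i. - (a i - b i)\<^sup>2) has_sum - (LINT x|M. (g x - h x)\<^sup>2)) UNIV"
    by (simp add: has_sum_uminus)
  ultimately have "((\<lambda>i. (a i + b i)\<^sup>2 + - (a i - b i)\<^sup>2) has_sum
      ((LINT x|M. (g x + h x)\<^sup>2) + - (LINT x|M. (g x - h x)\<^sup>2))) UNIV"
    by (rule has_sum_add)
  then have "((\<lambda>i. (1/4) * ((a i + b i)\<^sup>2 + - (a i - b i)\<^sup>2)) has_sum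
      (1/4) * ((LINT x|M. (g x + h x)\<^sup>2) + - (LINT x|M. (g x - h x)\<^sup>2))) UNIV"
    by (rule has_sum_cmult_right)
  moreover have "(1/4) * ((a i + b i)\<^sup>2 + - (a i - b i)\<^sup>2) = a i * b i" for i
    by (simp add: power2_sum power2_diff)
  moreover have "(LINT x|M. (g x + h x)\<^sup>2) + - (LINT x|M. (g x - h x)\<^sup>2) = 4 * (LINT x|M. g x * h x)"
    using integral_power2_add[OF g h] integral_power2_add[OF g square_integrable_cmult[OF h, of "-1"]]
    by simp
  ultimately show ?thesis by (simp add: a_def b_def)
qed

text \<open>The right-hand side does not depend on K: it will dominate the truncated sums when the
  number of modes tends to infinity under the time integral.\<close>

lemma parseval_finite_sum_bound:
  assumes e: "parseval_system M e" and g: "square_integrable M g" and h: "square_integrable M h"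
    and K: "finite K"
  shows "\<bar>\<Sum>i\<in>K. (LINT x|M. g x * e i x) * (LINT x|M. h x * e i x)\<bar> \<le> (LINT x|M. (g x)\<^sup>2) + (LINT x|M. (h x)\<^sup>2)"
proof -
  define a b where "a i = (LINT x|M. g x * e i x)" and "b i = (LINT x|M. h x * e i x)" for i
  have 1: "(\<Sum>i\<in>K. (a i)\<^sup>2) \<le> (LINT x|M. (g x)\<^sup>2)" "(\<Sum>i\<in>K. (b i)\<^sup>2) \<le> (LINT x|M. (h x)\<^sup>2)"
    unfolding a_def b_def
    by (rule has_sum_mono_neutral[OF has_sum_finite[OF K] parseval_has_sum_power2[OF e]]; use g h in simp)+
  have "\<bar>\<Sum>i\<in>K. a i * b i\<bar> \<le> (\<Sum>i\<in>K. \<bar>a i * b i\<bar>)" by (rule sum_abs)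
  also have "\<dots> \<le> (\<Sum>i\<in>K. (a i)\<^sup>2 + (b i)\<^sup>2)"
    by (intro sum_mono abs_mult_le_power2_add)
  also have "\<dots> \<le> (LINT x|M. (g x)\<^sup>2) + (LINT x|M. (h x)\<^sup>2)"
    using 1 by (simp add: sum.distrib)
  finally show ?thesis by (simp add: a_def b_def)
qed

subsection \<open>Trigonometric polynomials\<close>

definition circ :: "real measure" where
  "circ = restrict_space lborel {0<..<2 * pi}"

text \<open>One signed index for cosines (n > 0), sines (n < 0) and the constant, all L2-normalised.
  Differentiation then has the single form n -> -n with factor -n, signs included.\<close>

definition trig_basis :: "int \<Rightarrow> real \<Rightarrow> real" where
  "trig_basis n x = (if n = 0 then 1 / sqrt (2 * pi)
     else if n > 0 then cos (of_int n * x) / sqrt pi else sin (of_int (- n) * x) / sqrt pi)"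

lemma space_circ: "space circ = {0<..<2 * pi}"
  by (simp add: circ_def space_restrict_space)

lemma finite_measure_circ: "finite_measure circ"
  by (rule finite_measureI) (simp add: circ_def space_restrict_space emeasure_restrict_space)

interpretation circ: finite_measure circ
  by (rule finite_measure_circ)

lemma measurable_circ: "f \<in> borel_measurable borel \<Longrightarrow> f \<in> borel_measurable circ"
  unfolding circ_def by (rule measurable_restrict_space1) simp

lemma integral_circ: "(LINT x|circ. f x) = (LINT x:{0<..<2 * pi}|lborel. f x)" for f :: "real \<Rightarrow> real"
  unfolding circ_def set_lebesgue_integral_def by (subst integral_restrict_space) auto

lemma integral_circ_FTC:
  assumes "\<And>x. (F has_real_derivative f x) (at x)" "continuous_on UNIV f"
  shows "(LINT x|circ. f x) = F (2 * pi) - F 0"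
proof -
  have "(LINT x:{0..2 * pi}|lborel. f x) = F (2 * pi) - F 0"
    using integral_FTC_Icc[of 0 "2 * pi" F f] assms
    by (auto simp: set_lebesgue_integral_def has_real_derivative_iff_has_vector_derivative
        intro: has_vector_derivative_at_within continuous_on_subset)
  moreover have "(LINT x:{0..2 * pi}|lborel. f x) = (LINT x:{0<..<2 * pi}|lborel. f x)"
  proof (unfold set_lebesgue_integral_def, rule integral_cong_AE)
    have [measurable]: "f \<in> borel_measurable borel" by (rule borel_measurable_continuous_onI[OF assms(2)])
    show "(\<lambda>x. indicat_real {0..2 * pi} x *\<^sub>R f x) \<in> borel_measurable lborel"
      "(\<lambda>x. indicat_real {0<..<2 * pi} x *\<^sub>R f x) \<in> borel_measurable lborel" by measurable
    have "AE x in lborel. x \<noteq> 0 \<and> x \<noteq> 2 * pi"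
      using AE_lborel_singleton[of 0] AE_lborel_singleton[of "2 * pi"] by eventually_elim auto
    then show "AE x in lborel. indicat_real {0..2 * pi} x *\<^sub>R f x = indicat_real {0<..<2 * pi} x *\<^sub>R f x"
      by eventually_elim (auto simp: indicator_def)
  qed
  ultimately show ?thesis by (simp add: integral_circ)
qed

lemma integral_circ_cos:
  fixes n :: int
  shows "(LINT x|circ. cos (of_int n * x)) = (if n = 0 then 2 * pi else 0)"
proof (cases "n = 0")
  case True
  then show ?thesis using integral_circ_FTC[of "\<lambda>x. x" "\<lambda>_. 1"] by (auto intro!: derivative_eq_intros)
next
  case False
  have "(LINT x|circ. cos (of_int n * x)) = sin (of_int n * (2 * pi)) / n - sin (of_int n * 0) / n"
    using False by (intro integral_circ_FTC) (auto intro!: derivative_eq_intros continuous_intros)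
  also have "sin (of_int n * (2 * pi)) = 0"
    using sin_int_2pin[of n] by (simp add: mult_ac)
  finally show ?thesis using False by simp
qed

lemma integral_circ_sin:
  fixes n :: int
  shows "(LINT x|circ. sin (of_int n * x)) = 0"
proof (cases "n = 0")
  case False
  have "(LINT x|circ. sin (of_int n * x)) = - cos (of_int n * (2 * pi)) / n - - cos (of_int n * 0) / n"
    using False by (intro integral_circ_FTC) (auto intro!: derivative_eq_intros continuous_intros)
  also have "cos (of_int n * (2 * pi)) = 1"
    using cos_int_2pin[of n] by (simp add: mult_ac)
  finally show ?thesis using False by simp
qed auto

lemma integrable_circ_bounded:
  fixes f :: "real \<Rightarrow> real"
  assumes "f \<in> borel_measurable borel" "\<And>x. \<bar>f x\<bar> \<le> B"
  shows "integrable circ f"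
  using assms by (intro circ.integrable_const_bound[where B = B] measurable_circ) auto

text \<open>Product-to-sum formulas. As m and n are positive, m + n never vanishes and only the
  difference frequency can contribute.\<close>

lemma integral_circ_products:
  fixes m n :: int
  assumes "m > 0" "n > 0"
  shows "(LINT x|circ. cos (of_int m * x) * cos (of_int n * x)) = (if m = n then pi else 0)"
    and "(LINT x|circ. sin (of_int m * x) * sin (of_int n * x)) = (if m = n then pi else 0)"
    and "(LINT x|circ. cos (of_int m * x) * sin (of_int n * x)) = 0"
proof -
  have i: "integrable circ (\<lambda>x. cos (of_int k * x))" "integrable circ (\<lambda>x. sin (of_int k * x))" for k :: int
    by (rule integrable_circ_bounded[where B = 1]; simp)+
  have e: "cos (of_int m * x) * cos (of_int n * x) =
        (cos (of_int (m - n) * x) + cos (of_int (m + n) * x)) / 2"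
      "sin (of_int m * x) * sin (of_int n * x) =
        (cos (of_int (m - n) * x) - cos (of_int (m + n) * x)) / 2"
      "cos (of_int m * x) * sin (of_int n * x) =
        (sin (of_int (m + n) * x) - sin (of_int (m - n) * x)) / 2" for x :: real
    by (simp_all add: cos_times_cos sin_times_sin cos_times_sin left_diff_distrib distrib_right)
  show "(LINT x|circ. cos (of_int m * x) * cos (of_int n * x)) = (if m = n then pi else 0)"
    "(LINT x|circ. sin (of_int m * x) * sin (of_int n * x)) = (if m = n then pi else 0)"
    "(LINT x|circ. cos (of_int m * x) * sin (of_int n * x)) = 0"
    unfolding e using assms i[of "m + n"] i[of "m - n"]
    by (simp_all add: integral_circ_cos integral_circ_sin del: of_int_add of_int_diff)
qed

lemma trig_basis_abs_le_1: "\<bar>trig_basis n x\<bar> \<le> 1"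
proof -
  have s: "1 \<le> sqrt pi" "1 \<le> sqrt (2 * pi)" using pi_gt3 by auto
  have "\<bar>cos y\<bar> \<le> sqrt pi" "\<bar>sin y\<bar> \<le> sqrt pi" for y :: real
    by (rule order_trans[OF _ s(1)], simp)+
  then have "\<bar>cos y\<bar> / sqrt pi \<le> 1" "\<bar>sin y\<bar> / sqrt pi \<le> 1" for y :: real
    by (simp_all add: divide_le_eq)
  then show ?thesis using s by (auto simp: trig_basis_def abs_divide)
qed

lemma trig_basis_measurable [measurable]: "trig_basis n \<in> borel_measurable borel"
  unfolding trig_basis_def by measurable

lemma trig_basis_square_integrable: "square_integrable circ (trig_basis n)"
  by (rule circ.square_integrable_bounded[where B = 1])
    (auto simp: measurable_circ trig_basis_abs_le_1)

lemma trig_basis_orthonormal: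
  "(LINT x|circ. trig_basis m x * trig_basis n x) = (if m = n then 1 else 0)"
proof -
  have i0: "(LINT x|circ. 1) = 2 * pi" using integral_circ_cos[of 0] by simp
  have c: "(LINT x|circ. cos (of_int k * x)) = 0" "(LINT x|circ. sin (of_int l * x)) = 0"
    if "k \<noteq> 0" for k l :: int using that integral_circ_cos[of k] integral_circ_sin[of l] by auto
  have sp: "sqrt pi * sqrt pi = pi" "sqrt (2 * pi) * sqrt (2 * pi) = 2 * pi" by auto
  consider "m = 0" | "m > 0" | "m < 0" by linarith
  then show ?thesis
  proof cases
    case 1
    consider "n = 0" | "n > 0" | "n < 0" by linarith
    then show ?thesis
    proof cases
      case 2 with 1 show ?thesis using c[of n] by (simp add: trig_basis_def)
    next
      case 3 with 1 show ?thesis using c(2)[of 1 "-n"] by (simp add: trig_basis_def)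
    qed (use 1 i0 sp in \<open>simp add: trig_basis_def\<close>)
  next
    case 2
    consider "n = 0" | "n > 0" | "n < 0" by linarith
    then show ?thesis
    proof cases
      case 1 with 2 show ?thesis using c[of m] by (simp add: trig_basis_def)
    next
      case 3 with 2 show ?thesis using integral_circ_products(3)[of m "-n"] by (simp add: trig_basis_def)
    next
      case 22: 2 with 2 show ?thesis using integral_circ_products(1)[of m "n"] sp by (simp add: trig_basis_def)
    qed
  next
    case 3
    consider "n = 0" | "n > 0" | "n < 0" by linarith
    then show ?thesis
    proof cases
      case 1 with 3 show ?thesis using c(2)[of 1 "-m"] by (simp add: trig_basis_def)
    next
      case 2 with 3 show ?thesis using integral_circ_products(3)[of n "-m"]
        by (simp add: trig_basis_def mult.commute[of "cos _"])
    next
      case 33: 3 with 3 show ?thesis using integral_circ_products(2)[of "-m" "-n"] sp by (simp add: trig_basis_def)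
    qed
  qed
qed

definition trig_poly :: "(real \<Rightarrow> real) \<Rightarrow> bool" where
  "trig_poly p \<longleftrightarrow> (\<exists>K a. finite K \<and> p = (\<lambda>x. \<Sum>n\<in>K. a n * trig_basis n x))"

lemma trig_poly_add:
  assumes "trig_poly p" "trig_poly q"
  shows "trig_poly (\<lambda>x. p x + q x)"
proof -
  from assms obtain K a L b where K: "finite K" "p = (\<lambda>x. \<Sum>n\<in>K. a n * trig_basis n x)"
    and L: "finite L" "q = (\<lambda>x. \<Sum>n\<in>L. b n * trig_basis n x)" unfolding trig_poly_def by blast
  define c where "c n = (if n \<in> K then a n else 0) + (if n \<in> L then b n else 0)" for n
  have "(\<Sum>n\<in>K \<union> L. c n * trig_basis n x) = p x + q x" for x
  proof -
    have "(\<Sum>n\<in>K \<union> L. c n * trig_basis n x) =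
       (\<Sum>n\<in>K \<union> L. if n \<in> K then a n * trig_basis n x else 0) + (\<Sum>n\<in>K \<union> L. if n \<in> L then b n * trig_basis n x else 0)"
      unfolding sum.distrib[symmetric] by (intro sum.cong) (auto simp: c_def distrib_right)
    also have "(\<Sum>n\<in>K \<union> L. if n \<in> K then a n * trig_basis n x else 0) = p x"
      using K L by (subst sum.inter_restrict[symmetric]) (auto simp: Int_absorb1)
    also have "(\<Sum>n\<in>K \<union> L. if n \<in> L then b n * trig_basis n x else 0) = q x"
      using K L by (subst sum.inter_restrict[symmetric]) (auto simp: Int_absorb1)
    finally show ?thesis .
  qed
  then show ?thesis unfolding trig_poly_def using K(1) L(1)
    by (intro exI[of _ "K \<union> L"] exI[of _ c]) auto
qed

lemma trig_poly_cmult: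
  assumes "trig_poly p" shows "trig_poly (\<lambda>x. c * p x)"
proof -
  from assms obtain K a where K: "finite K" "p = (\<lambda>x. \<Sum>n\<in>K. a n * trig_basis n x)" unfolding trig_poly_def by blast
  then show ?thesis unfolding trig_poly_def
    by (intro exI[of _ K] exI[of _ "\<lambda>n. c * a n"]) (auto simp: sum_distrib_left mult.assoc)
qed

lemma trig_poly_basis: "trig_poly (trig_basis n)"
  unfolding trig_poly_def by (intro exI[of _ "{n}"] exI[of _ "\<lambda>_. 1"]) auto

lemma trig_poly_cos: "trig_poly (\<lambda>x. cos (of_int n * x))"
proof -
  consider "n = 0" | "n > 0" | "n < 0" by linarith
  then show ?thesis
  proof cases
    case 1 then show ?thesis using trig_poly_cmult[OF trig_poly_basis[of 0], of "sqrt (2 * pi)"] by (simp add: trig_basis_def)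
  next
    case 2 then show ?thesis using trig_poly_cmult[OF trig_poly_basis[of n], of "sqrt pi"] by (simp add: trig_basis_def)
  next
    case 3 then show ?thesis using trig_poly_cmult[OF trig_poly_basis[of "-n"], of "sqrt pi"] by (simp add: trig_basis_def)
  qed
qed

lemma trig_poly_const: "trig_poly (\<lambda>x. c)"
  using trig_poly_cmult[OF trig_poly_cos[of 0], of c] by simp

lemma trig_poly_sin: "trig_poly (\<lambda>x. sin (of_int n * x))"
proof -
  consider "n = 0" | "n < 0" | "n > 0" by linarith
  then show ?thesis
  proof cases
    case 1 then show ?thesis using trig_poly_const[of 0] by simp
  next
    case 2 then show ?thesis using trig_poly_cmult[OF trig_poly_basis[of n], of "- sqrt pi"] by (simp add: trig_basis_def)
  next
    case 3 then show ?thesis using trig_poly_cmult[OF trig_poly_basis[of "-n"], of "sqrt pi"] by (simp add: trig_basis_def)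
  qed
qed

lemma trig_poly_sum:
  assumes "\<And>i. i \<in> I \<Longrightarrow> trig_poly (p i)"
  shows "trig_poly (\<lambda>x. \<Sum>i\<in>I. p i x)"
  using assms by (induction I rule: infinite_finite_induct) (auto simp: trig_poly_const trig_poly_add)

text \<open>Closure under products is what makes the polynomials delivered by Stone-Weierstrass
  trigonometric polynomials.\<close>

lemma trig_poly_basis_mult: "trig_poly (\<lambda>x. trig_basis m x * trig_basis n x)"
proof -
  have e: "cos (of_int m * x) * cos (of_int n * x) =
        (1/2) * (cos (of_int (m - n) * x) + cos (of_int (m + n) * x))"
      "sin (of_int m * x) * sin (of_int n * x) =
        (1/2) * (cos (of_int (m - n) * x) + (-1) * cos (of_int (m + n) * x))"
      "cos (of_int m * x) * sin (of_int n * x) =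
        (1/2) * (sin (of_int (m + n) * x) + (-1) * sin (of_int (m - n) * x))" for x :: real and m n :: int
    by (simp_all add: cos_times_cos sin_times_sin cos_times_sin left_diff_distrib distrib_right)
  have p: "trig_poly (\<lambda>x. cos (of_int m * x) * cos (of_int n * x))"
    "trig_poly (\<lambda>x. sin (of_int m * x) * sin (of_int n * x))"
    "trig_poly (\<lambda>x. cos (of_int m * x) * sin (of_int n * x))" for m n :: int
    unfolding e by (intro trig_poly_cmult trig_poly_add trig_poly_cos trig_poly_sin)+
  have p': "trig_poly (\<lambda>x. sin (of_int m * x) * cos (of_int n * x))" for m n :: int
    using p(3)[of n m] by (simp add: mult.commute)
  \<comment> \<open>Each basis function is a multiple of one cosine (the constant with frequency 0)
    or of one sine, which leaves four kinds of product.\<close>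
  have c: "\<exists>c l. trig_basis k = (\<lambda>x. c * cos (of_int l * x)) \<or> trig_basis k = (\<lambda>x. c * sin (of_int l * x))" for k
  proof -
    consider "k = 0" | "k > 0" | "k < 0" by linarith
    then show ?thesis
    proof cases
      case 1 then show ?thesis
        by (intro exI[of _ "1 / sqrt (2 * pi) :: real"] exI[of _ "0::int"]) (auto simp: trig_basis_def)
    next
      case 2 then show ?thesis
        by (intro exI[of _ "1 / sqrt pi :: real"] exI[of _ k]) (auto simp: trig_basis_def)
    next
      case 3 then show ?thesis
        by (intro exI[of _ "1 / sqrt pi :: real"] exI[of _ "-k"]) (auto simp: trig_basis_def)
    qed
  qed
  obtain c l where 1: "trig_basis m = (\<lambda>x. c * cos (of_int l * x)) \<or> trig_basis m = (\<lambda>x. c * sin (of_int l * x))"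
    using c by blast
  obtain c' l' where 2: "trig_basis n = (\<lambda>x. c' * cos (of_int l' * x)) \<or> trig_basis n = (\<lambda>x. c' * sin (of_int l' * x))"
    using c by blast
  have r: "c * u * (c' * v) = (c * c') * (u * v)" for u v by simp
  from 1 2 show ?thesis
    by (elim disjE; simp only: r; intro trig_poly_cmult p p')
qed

lemma trig_poly_mult:
  assumes "trig_poly p" "trig_poly q"
  shows "trig_poly (\<lambda>x. p x * q x)"
proof -
  from assms obtain K a L b where K: "finite K" "p = (\<lambda>x. \<Sum>n\<in>K. a n * trig_basis n x)"
    and L: "finite L" "q = (\<lambda>x. \<Sum>n\<in>L. b n * trig_basis n x)" unfolding trig_poly_def by blast
  have "p x * q x = (\<Sum>m\<in>K. \<Sum>n\<in>L. (a m * b n) * (trig_basis m x * trig_basis n x))" for x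
    unfolding K L sum_product by (simp add: mult_ac)
  then show ?thesis
    by (simp only:) (intro trig_poly_sum trig_poly_cmult trig_poly_basis_mult)
qed

text \<open>Real polynomial functions on the complex plane are generated by real-linear maps, and
  such a map takes \<open>cis x\<close> to f(1) cos x + f(i) sin x.\<close>

lemma trig_poly_real_polynomial_cis:
  assumes "real_polynomial_function P"
  shows "trig_poly (\<lambda>x. P (cis x))"
  using assms
proof induction
  case (linear f)
  then interpret bounded_linear f .
  have "f (cis x) = f 1 * cos (of_int 1 * x) + f \<i> * sin (of_int 1 * x)" for x
  proof -
    have "cis x = cos x *\<^sub>R 1 + sin x *\<^sub>R \<i>" by (simp add: complex_eq_iff)
    then have "f (cis x) = f (cos x *\<^sub>R 1 + sin x *\<^sub>R \<i>)" by simp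
    then show ?thesis by (simp only: add scaleR) simp
  qed
  then show ?case
    by (simp only:) (intro trig_poly_add trig_poly_cmult trig_poly_cos trig_poly_sin)
qed (simp_all add: trig_poly_const trig_poly_add trig_poly_mult)

subsection \<open>Completeness of the trigonometric system\<close>

text \<open>Membership in the L2-closure of the trigonometric polynomials, as a predicate stable
  under limits. Completeness is reached by enlarging its known members: continuous functions on the
  circle, indicators of intervals, of Borel sets, then all of L2.\<close>

definition trig_approximable :: "(real \<Rightarrow> real) \<Rightarrow> bool" where
  "trig_approximable g \<longleftrightarrow> square_integrable circ g \<and>
     (\<forall>\<epsilon>>0. \<exists>p. trig_poly p \<and> (LINT x|circ. (g x - p x)\<^sup>2) < \<epsilon>)"

lemma trig_poly_square_integrable: "trig_poly p \<Longrightarrow> square_integrable circ p"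
  unfolding trig_poly_def
  by (auto intro!: square_integrable_sum square_integrable_cmult trig_basis_square_integrable)

lemma integral_power2_add_le:
  assumes "square_integrable M f" "square_integrable M g"
  shows "(LINT x|M. (f x + g x)\<^sup>2) \<le> 2 * (LINT x|M. (f x)\<^sup>2) + 2 * (LINT x|M. (g x)\<^sup>2)"
proof -
  have "(LINT x|M. (f x + g x)\<^sup>2) \<le> (LINT x|M. 2 * (f x)\<^sup>2 + 2 * (g x)\<^sup>2)"
  proof (rule integral_mono)
    show "integrable M (\<lambda>x. (f x + g x)\<^sup>2)"
      using square_integrable_add[OF assms] by (simp add: square_integrable_def)
    show "integrable M (\<lambda>x. 2 * (f x)\<^sup>2 + 2 * (g x)\<^sup>2)"
      using assms by (simp add: square_integrable_def)
    show "(f x + g x)\<^sup>2 \<le> 2 * (f x)\<^sup>2 + 2 * (g x)\<^sup>2" for x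
      using zero_le_power2[of "f x - g x"] by (simp add: power2_sum power2_diff)
  qed
  also have "\<dots> = 2 * (LINT x|M. (f x)\<^sup>2) + 2 * (LINT x|M. (g x)\<^sup>2)"
    using assms by (simp add: square_integrable_def)
  finally show ?thesis .
qed

lemma trig_approximable_closed:
  assumes "square_integrable circ g"
    and "\<And>\<epsilon>. \<epsilon> > 0 \<Longrightarrow> \<exists>h. trig_approximable h \<and> (LINT x|circ. (g x - h x)\<^sup>2) < \<epsilon>"
  shows "trig_approximable g"
  unfolding trig_approximable_def
proof (intro conjI allI impI)
  fix \<epsilon> :: real assume "\<epsilon> > 0"
  \<comment> \<open>The quarters compensate the factor 2 in (u + v)^2 \<le> 2 u^2 + 2 v^2.\<close>
  then obtain h where h: "trig_approximable h" "(LINT x|circ. (g x - h x)\<^sup>2) < \<epsilon> / 4"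
    using assms(2)[of "\<epsilon> / 4"] by auto
  obtain p where p: "trig_poly p" "(LINT x|circ. (h x - p x)\<^sup>2) < \<epsilon> / 4"
    using h(1) \<open>\<epsilon> > 0\<close> unfolding trig_approximable_def by (metis zero_less_divide_iff zero_less_numeral)
  have "(LINT x|circ. ((g x - h x) + (h x - p x))\<^sup>2) \<le> 2 * (LINT x|circ. (g x - h x)\<^sup>2) + 2 * (LINT x|circ. (h x - p x)\<^sup>2)"
    using assms(1) h(1) p(1)
    by (intro integral_power2_add_le square_integrable_diff) (auto simp: trig_approximable_def trig_poly_square_integrable)
  also have "\<dots> < \<epsilon>" using h(2) p(2) by linarith
  finally show "\<exists>p. trig_poly p \<and> (LINT x|circ. (g x - p x)\<^sup>2) < \<epsilon>" using p(1) by (auto intro!: exI[of _ p])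
qed fact

lemma trig_poly_approximable: "trig_poly p \<Longrightarrow> trig_approximable p"
  by (auto simp: trig_approximable_def trig_poly_square_integrable intro!: exI[of _ p])

lemma trig_approximable_cmult:
  assumes "trig_approximable g" shows "trig_approximable (\<lambda>x. c * g x)"
  unfolding trig_approximable_def
proof (intro conjI allI impI)
  show "square_integrable circ (\<lambda>x. c * g x)" using assms by (simp add: trig_approximable_def square_integrable_cmult)
  fix \<epsilon> :: real assume "\<epsilon> > 0"
  \<comment> \<open>Dividing by c^2 + 1 instead of c^2 covers c = 0.\<close>
  then have "\<epsilon> / (c\<^sup>2 + 1) > 0" by (simp add: add_nonneg_pos)
  then obtain p where p: "trig_poly p" "(LINT x|circ. (g x - p x)\<^sup>2) < \<epsilon> / (c\<^sup>2 + 1)"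
    using assms unfolding trig_approximable_def by metis
  have "(LINT x|circ. (c * g x - c * p x)\<^sup>2) = c\<^sup>2 * (LINT x|circ. (g x - p x)\<^sup>2)"
    by (simp add: power_mult_distrib flip: right_diff_distrib)
  also have "\<dots> \<le> (c\<^sup>2 + 1) * (LINT x|circ. (g x - p x)\<^sup>2)" by (intro mult_right_mono) auto
  also have "\<dots> < \<epsilon>" using p(2) by (simp add: pos_less_divide_eq add_nonneg_pos mult.commute)
  finally show "\<exists>p. trig_poly p \<and> (LINT x|circ. (c * g x - p x)\<^sup>2) < \<epsilon>"
    using trig_poly_cmult[OF p(1)] by blast
qed

lemma trig_approximable_add:
  assumes "trig_approximable f" "trig_approximable g"
  shows "trig_approximable (\<lambda>x. f x + g x)"
  unfolding trig_approximable_def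
proof (intro conjI allI impI)
  show "square_integrable circ (\<lambda>x. f x + g x)" using assms by (simp add: trig_approximable_def square_integrable_add)
  fix \<epsilon> :: real assume "\<epsilon> > 0"
  then have e: "\<epsilon> / 4 > 0" by simp
  obtain p where p: "trig_poly p" "(LINT x|circ. (f x - p x)\<^sup>2) < \<epsilon> / 4"
    using assms(1) e unfolding trig_approximable_def by metis
  obtain q where q: "trig_poly q" "(LINT x|circ. (g x - q x)\<^sup>2) < \<epsilon> / 4"
    using assms(2) e unfolding trig_approximable_def by metis
  have "(LINT x|circ. ((f x - p x) + (g x - q x))\<^sup>2) \<le> 2 * (LINT x|circ. (f x - p x)\<^sup>2) + 2 * (LINT x|circ. (g x - q x)\<^sup>2)"
    using assms p(1) q(1)
    by (intro integral_power2_add_le square_integrable_diff) (auto simp: trig_approximable_def trig_poly_square_integrable)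
  also have "\<dots> < \<epsilon>" using p(2) q(2) by linarith
  finally show "\<exists>p. trig_poly p \<and> (LINT x|circ. (f x + g x - p x)\<^sup>2) < \<epsilon>"
    by (intro exI[of _ "\<lambda>x. p x + q x"]) (simp add: trig_poly_add p(1) q(1) algebra_simps)
qed

lemma trig_approximable_sum:
  assumes "\<And>i. i \<in> I \<Longrightarrow> trig_approximable (p i)"
  shows "trig_approximable (\<lambda>x. \<Sum>i\<in>I. p i x)"
  using assms
  by (induction I rule: infinite_finite_induct)
    (auto simp: trig_poly_approximable trig_poly_const trig_approximable_add)

lemma trig_approximable_cong:
  assumes "trig_approximable f" "\<And>x. x \<in> {0<..<2 * pi} \<Longrightarrow> f x = g x"
  shows "trig_approximable g"
proof -
  have m: "f \<in> borel_measurable circ \<longleftrightarrow> g \<in> borel_measurable circ"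
    using assms(2) by (intro measurable_cong) (auto simp: space_circ)
  have "integrable circ (\<lambda>x. (f x)\<^sup>2) = integrable circ (\<lambda>x. (g x)\<^sup>2)"
    using assms(2) by (intro Bochner_Integration.integrable_cong) (auto simp: space_circ)
  moreover have "(LINT x|circ. (f x - p x)\<^sup>2) = (LINT x|circ. (g x - p x)\<^sup>2)" for p
    using assms(2) by (intro Bochner_Integration.integral_cong) (auto simp: space_circ)
  ultimately show ?thesis
    using assms(1) m unfolding trig_approximable_def square_integrable_def by simp
qed

text \<open>Dominated convergence turns pointwise limits into L2 limits: since s n and g are both
  bounded by h, the squared difference is at most 4 h^2.\<close>

lemma trig_approximable_dominated_limit:
  assumes s: "\<And>n. trig_approximable (s n)" and g: "g \<in> borel_measurable circ"
    and lim: "\<And>x. x \<in> {0<..<2 * pi} \<Longrightarrow> (\<lambda>n. s n x) \<longlonglongrightarrow> g x"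
    and h: "square_integrable circ h" and bd: "\<And>n x. x \<in> {0<..<2 * pi} \<Longrightarrow> \<bar>s n x\<bar> \<le> h x"
  shows "trig_approximable g"
proof (rule trig_approximable_closed)
  have [measurable]: "s n \<in> borel_measurable circ" "h \<in> borel_measurable circ" "g \<in> borel_measurable circ" for n
    using s[of n] h g by (auto simp: trig_approximable_def square_integrable_def)
  have gh: "\<bar>g x\<bar> \<le> h x" if "x \<in> {0<..<2 * pi}" for x
    by (rule LIMSEQ_le_const2[OF tendsto_rabs[OF lim[OF that]]]) (use bd[OF that] in auto)
  have sq: "(u::real)\<^sup>2 \<le> v\<^sup>2" if "\<bar>u\<bar> \<le> v" for u v using that by (metis abs_ge_zero order_trans power2_abs power_mono)
  show "square_integrable circ g"
    by (rule square_integrable_bound[where h = "\<lambda>x. (h x)\<^sup>2"])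
      (use h g gh sq in \<open>auto simp: square_integrable_def space_circ\<close>)
  fix \<epsilon> :: real assume "\<epsilon> > 0"
  have "(\<lambda>n. LINT x|circ. (g x - s n x)\<^sup>2) \<longlonglongrightarrow> (LINT x|circ. 0)"
  proof (rule integral_dominated_convergence[where w = "\<lambda>x. 4 * (h x)\<^sup>2"])
    show "integrable circ (\<lambda>x. 4 * (h x)\<^sup>2)" using h by (simp add: square_integrable_def)
    show "AE x in circ. (\<lambda>n. (g x - s n x)\<^sup>2) \<longlonglongrightarrow> 0"
    proof (rule AE_I2)
      fix x assume "x \<in> space circ"
      then have "(\<lambda>n. (g x - s n x)\<^sup>2) \<longlonglongrightarrow> (g x - g x)\<^sup>2" by (intro tendsto_intros lim) (simp add: space_circ)
      then show "(\<lambda>n. (g x - s n x)\<^sup>2) \<longlonglongrightarrow> 0" by simp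
    qed
    show "AE x in circ. norm ((g x - s n x)\<^sup>2) \<le> 4 * (h x)\<^sup>2" for n
    proof (rule AE_I2)
      fix x assume "x \<in> space circ"
      then have "\<bar>g x - s n x\<bar> \<le> 2 * h x" using gh[of x] bd[of x n] by (auto simp: space_circ)
      from sq[OF this] show "norm ((g x - s n x)\<^sup>2) \<le> 4 * (h x)\<^sup>2" by (simp add: power_mult_distrib)
    qed
  qed auto
  then have "(\<lambda>n. LINT x|circ. (g x - s n x)\<^sup>2) \<longlonglongrightarrow> 0" by simp
  from order_tendstoD(2)[OF this \<open>\<epsilon> > 0\<close>] obtain n where "(LINT x|circ. (g x - s n x)\<^sup>2) < \<epsilon>"
    by (auto simp: eventually_sequentially)
  then show "\<exists>h. trig_approximable h \<and> (LINT x|circ. (g x - h x)\<^sup>2) < \<epsilon>" using s by blast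
qed

text \<open>Composing with \<open>cis\<close> builds in the periodicity, so Stone-Weierstrass can be
  applied on the unit circle, which is compact.\<close>

lemma trig_approximable_continuous_cis:
  fixes h :: "complex \<Rightarrow> real"
  assumes h: "continuous_on UNIV h"
  shows "trig_approximable (\<lambda>x. h (cis x))"
proof -
  have ch: "continuous_on UNIV (\<lambda>x. h (cis x))"
    by (rule continuous_on_compose2[OF h]) (auto intro!: continuous_intros)
  then have [measurable]: "(\<lambda>x. h (cis x)) \<in> borel_measurable circ"
    by (intro measurable_circ borel_measurable_continuous_onI)
  have cmp: "compact (sphere 0 1 :: complex set)" by simp
  have "\<exists>P. real_polynomial_function P \<and> (\<forall>z\<in>sphere 0 1. \<bar>h z - P z\<bar> < inverse (Suc n))" for n
    by (rule Stone_Weierstrass_real_polynomial_function[OF cmp continuous_on_subset[OF h subset_UNIV], of "inverse (Suc n)"]) auto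
  then obtain P where P: "\<And>n. real_polynomial_function (P n)"
    "\<And>n z. z \<in> sphere 0 1 \<Longrightarrow> \<bar>h z - P n z\<bar> < inverse (Suc n)" by metis
  have "compact (h ` sphere 0 1)" by (rule compact_continuous_image[OF continuous_on_subset[OF h subset_UNIV] cmp])
  from compact_imp_bounded[OF this] obtain B where "\<forall>y\<in>h ` sphere 0 1. norm y \<le> B"
    unfolding bounded_iff ..
  then have B: "\<bar>h z\<bar> \<le> B" if "z \<in> sphere 0 1" for z using that by simp
  show ?thesis
  proof (rule trig_approximable_dominated_limit[where s = "\<lambda>n x. P n (cis x)" and h = "\<lambda>_. B + 1"])
    show "trig_approximable (\<lambda>x. P n (cis x))" for n
      by (intro trig_poly_approximable trig_poly_real_polynomial_cis P)
    show "square_integrable circ (\<lambda>_. B + 1)" by (rule circ.square_integrable_const)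
    fix x
    have "(\<lambda>n. h (cis x) - P n (cis x)) \<longlonglongrightarrow> 0"
      by (rule Lim_null_comparison[OF _ LIMSEQ_inverse_real_of_nat])
        (use P(2)[of "cis x"] in \<open>auto intro!: always_eventually less_imp_le\<close>)
    from tendsto_diff[OF tendsto_const[of "h (cis x)"] this]
    show "(\<lambda>n. P n (cis x)) \<longlonglongrightarrow> h (cis x)" by simp
    fix n
    have "inverse (real (Suc n)) \<le> 1" by (simp add: inverse_eq_divide)
    then show "\<bar>P n (cis x)\<bar> \<le> B + 1" using P(2)[of "cis x" n] B[of "cis x"] by (auto simp: abs_less_iff abs_le_iff)
  qed simp
qed

lemma Arg2pi_cis_interval: "x \<in> {0<..<2 * pi} \<Longrightarrow> Arg2pi (cis x) = x"
  by (simp add: cis_conv_exp Arg2pi_exp)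

text \<open>On the circle the interval becomes a set of arguments. \<open>Arg2pi\<close> is
  discontinuous only on the nonnegative real axis, which \<open>cis\<close> does not meet over the
  open interval from 0 to 2 pi; the set V of unwanted arguments off this slit is thus open.\<close>

lemma trig_approximable_indicator_Icc:
  "trig_approximable (indicator {a..b})"
proof -
  have "continuous_on (- \<real>\<^sub>\<ge>\<^sub>0) Arg2pi"
    by (rule continuous_at_imp_continuous_on) (auto intro!: continuous_at_Arg2pi)
  then have "open (Arg2pi -` ({..<a} \<union> {b<..}) \<inter> - \<real>\<^sub>\<ge>\<^sub>0)"
    by (subst Int_commute, intro continuous_open_preimage)
      (auto intro!: closed_nonneg_Reals_complex open_Compl)
  moreover define V where "V = Arg2pi -` ({..<a} \<union> {b<..}) \<inter> - \<real>\<^sub>\<ge>\<^sub>0"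
  ultimately have V: "open V" by simp
  have cisV: "cis x \<in> V \<longleftrightarrow> x \<notin> {a..b}" if "x \<in> {0<..<2 * pi}" for x
  proof -
    have "cis x \<notin> \<real>\<^sub>\<ge>\<^sub>0"
    proof
      assume "cis x \<in> \<real>\<^sub>\<ge>\<^sub>0"
      then have "Arg2pi (cis x) = 0" by (simp add: Arg2pi_eq_0 complex_nonneg_Reals_iff complex_is_Real_iff)
      then show False using Arg2pi_cis_interval[OF that] that by simp
    qed
    then show ?thesis using Arg2pi_cis_interval[OF that] that by (auto simp: V_def)
  qed
  \<comment> \<open>\<open>infdist\<close> to the empty set is 0 by definition, so the complement of
    V must be seen to be nonempty.\<close>
  have "0 \<in> - V" by (simp add: V_def)
  then have ne: "- V \<noteq> {}" by blast
  \<comment> \<open>Continuous tents equal to 1 on the complement of V; at a point of V, which has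
    positive distance to the complement, they are eventually 0.\<close>
  define h where "h n z = max 0 (1 - real n * infdist z (- V))" for n :: nat and z
  show ?thesis
  proof (rule trig_approximable_dominated_limit[where s = "\<lambda>n x. h n (cis x)" and h = "\<lambda>_. 1"])
    show "trig_approximable (\<lambda>x. h n (cis x))" for n
      unfolding h_def by (intro trig_approximable_continuous_cis continuous_intros)
    show "square_integrable circ (\<lambda>_. 1)" by (rule circ.square_integrable_const)
    show "indicat_real {a..b} \<in> borel_measurable circ" by (intro measurable_circ) simp
    fix x :: real assume x: "x \<in> {0<..<2 * pi}"
    show "\<bar>h n (cis x)\<bar> \<le> 1" for n by (auto simp: h_def infdist_nonneg)
    show "(\<lambda>n. h n (cis x)) \<longlonglongrightarrow> indicat_real {a..b} x"
    proof (cases "x \<in> {a..b}")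
      case True
      with cisV[OF x] have "infdist (cis x) (- V) = 0" by (simp)
      then show ?thesis using True by (simp add: h_def)
    next
      case False
      with cisV[OF x] have "cis x \<notin> - V" by simp
      then have pos: "infdist (cis x) (- V) > 0"
        using V ne by (metis closed_Compl in_closed_iff_infdist_zero infdist_nonneg less_le)
      obtain N where N: "real N * infdist (cis x) (- V) > 1"
        using reals_Archimedean3[OF pos] by auto
      have "h n (cis x) = 0" if "n \<ge> N" for n
      proof -
        have "real N * infdist (cis x) (- V) \<le> real n * infdist (cis x) (- V)"
          using that pos by (intro mult_right_mono) auto
        then show ?thesis using N by (simp add: h_def)
      qed
      then have "(\<lambda>n. h n (cis x)) \<longlonglongrightarrow> 0"
        by (intro tendsto_eventually) (auto simp: eventually_sequentially)
      then show ?thesis using False by simp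
    qed
  qed
qed

text \<open>The unions in this induction are disjoint, so partial sums of indicators are again
  indicators and 1 dominates them.\<close>

lemma trig_approximable_indicator:
  assumes "A \<in> sets borel"
  shows "trig_approximable (indicator A)"
  using assms
proof (induction rule: borel_set_induct)
  case empty
  then show ?case using trig_poly_approximable[OF trig_poly_const[of 0]] by (simp add: indicator_def)
next
  case (interval a b)
  show ?case by (rule trig_approximable_indicator_Icc)
next
  case (compl A)
  have "trig_approximable (\<lambda>x. 1 + (-1) * indicator A x)"
    by (intro trig_approximable_add trig_approximable_cmult compl trig_poly_approximable trig_poly_const)
  then show ?case by (rule trig_approximable_cong) (auto simp: indicator_def)
next
  case (union F)
  show ?case
  proof (rule trig_approximable_dominated_limit[where s = "\<lambda>n x. \<Sum>i<n. indicator (F i) x" and h = "\<lambda>_. 1"])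
    show "trig_approximable (\<lambda>x. \<Sum>i<n. indicator (F i) x)" for n
      by (intro trig_approximable_sum union)
    show "square_integrable circ (\<lambda>_. 1)" by (rule circ.square_integrable_const)
    show "indicat_real (\<Union> (range F)) \<in> borel_measurable circ"
      by (intro measurable_circ borel_measurable_indicator) (use union in auto)
    fix x :: real
    have e: "(\<Sum>i<n. indicat_real (F i) x) = indicat_real (\<Union>i<n. F i) x" for n
      by (rule indicator_UN_disjoint[symmetric]) (use union(1) in \<open>auto simp: disjoint_family_on_def\<close>)
    show "\<bar>\<Sum>i<n. indicat_real (F i) x\<bar> \<le> 1" for n unfolding e by simp
    show "(\<lambda>n. \<Sum>i<n. indicat_real (F i) x) \<longlonglongrightarrow> indicat_real (\<Union> (range F)) x"
      unfolding e by (rule LIMSEQ_indicator_UN)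
  qed
qed

lemma square_integrable_trig_approximable:
  assumes g: "square_integrable circ g"
  shows "trig_approximable g"
proof -
  have gm: "g \<in> borel_measurable circ" using g by (simp add: square_integrable_def)
  from borel_measurable_implies_sequence_metric[OF gm, of 0] obtain s where
    *: "(\<forall>i. simple_function circ (s i)) \<and> (\<forall>x\<in>space circ. (\<lambda>i. s i x) \<longlonglongrightarrow> g x) \<and>
      (\<forall>i. \<forall>x\<in>space circ. dist (s i x) 0 \<le> 2 * dist (g x) 0)" ..
  have s: "simple_function circ (s i)" for i using * by blast
  have s_lim: "(\<lambda>i. s i x) \<longlonglongrightarrow> g x" if "x \<in> {0<..<2 * pi}" for x
    using * that by (simp add: space_circ)
  have s_le: "\<bar>s i x\<bar> \<le> 2 * \<bar>g x\<bar>" if "x \<in> {0<..<2 * pi}" for i x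
  proof -
    have "dist (s i x) 0 \<le> 2 * dist (g x) 0" using * that by (auto simp: space_circ simp del: dist_0_norm)
    then show ?thesis by simp
  qed
  show ?thesis
  proof (rule trig_approximable_dominated_limit[where s = s and h = "\<lambda>x. 2 * \<bar>g x\<bar>"])
    show "square_integrable circ (\<lambda>x. 2 * \<bar>g x\<bar>)"
      using g borel_measurable_abs[OF gm] by (intro square_integrable_cmult) (simp add: square_integrable_def)
    fix n
    \<comment> \<open>Level sets of a simple function on \<open>circ\<close> are only traces of
      Borel sets. The chosen extensions may overlap outside the interval, where values do not
      matter.\<close>
    have *: "\<exists>B\<in>sets borel. s n -` {y} \<inter> space circ = B \<inter> {0<..<2 * pi}" for y
    proof -
      have "s n -` {y} \<inter> space circ \<in> sets circ" by (rule simple_functionD(2)[OF s])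
      then show ?thesis unfolding circ_def sets_restrict_space by (auto simp: image_iff)
    qed
    then obtain B where B: "\<And>y. B y \<in> sets borel" "\<And>y. s n -` {y} \<inter> space circ = B y \<inter> {0<..<2 * pi}" by metis
    have "trig_approximable (\<lambda>x. \<Sum>y\<in>s n ` space circ. y * indicator (B y) x)"
      by (intro trig_approximable_sum trig_approximable_cmult trig_approximable_indicator B)
    then show "trig_approximable (s n)"
    proof (rule trig_approximable_cong)
      fix x assume x: "x \<in> {0<..<2 * pi}"
      have iff: "x \<in> B y \<longleftrightarrow> s n x = y" for y
      proof -
        have "x \<in> s n -` {y} \<inter> space circ \<longleftrightarrow> x \<in> B y \<inter> {0<..<2 * pi}" by (simp only: B(2))
        then show ?thesis using x by (simp only: space_circ Int_iff vimage_eq singleton_iff simp_thms)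
      qed
      have "(\<Sum>y\<in>s n ` space circ. y * indicator (B y) x) = (\<Sum>y\<in>s n ` space circ. if y = s n x then y else 0)"
        by (intro sum.cong refl) (simp add: indicator_def iff)
      also have "\<dots> = s n x" using x simple_functionD(1)[OF s] by (simp add: space_circ)
      finally show "(\<Sum>y\<in>s n ` space circ. y * indicator (B y) x) = s n x" .
    qed
  qed (use s_lim s_le gm in simp_all)
qed

text \<open>Completing the square in the coefficients. With a equal to the Fourier coefficients it
  gives Bessel's inequality; with a from any approximating polynomial it shows that the Fourier
  coefficients do at least as well.\<close>

lemma best_approximation:
  assumes g: "square_integrable circ g" and K: "finite K"
  shows "(LINT x|circ. (g x - (\<Sum>n\<in>K. a n * trig_basis n x))\<^sup>2)
    = (LINT x|circ. (g x)\<^sup>2) - (\<Sum>n\<in>K. (LINT x|circ. g x * trig_basis n x)\<^sup>2)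
      + (\<Sum>n\<in>K. (a n - (LINT x|circ. g x * trig_basis n x))\<^sup>2)"
proof -
  define p where "p x = (\<Sum>n\<in>K. a n * trig_basis n x)" for x
  define c where "c n = (LINT x|circ. g x * trig_basis n x)" for n
  note tb = trig_basis_square_integrable
  have p: "square_integrable circ p" unfolding p_def by (intro square_integrable_sum square_integrable_cmult tb)
  have gp: "(LINT x|circ. g x * p x) = (\<Sum>n\<in>K. a n * c n)"
  proof -
    have "(LINT x|circ. g x * p x) = (LINT x|circ. (\<Sum>n\<in>K. a n * (g x * trig_basis n x)))"
      by (simp add: p_def sum_distrib_left mult.left_commute)
    then show ?thesis using square_integrable_mult[OF g tb] by (simp add: c_def)
  qed
  have pp: "(LINT x|circ. (p x)\<^sup>2) = (\<Sum>n\<in>K. (a n)\<^sup>2)"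
  proof -
    have "(LINT x|circ. (p x)\<^sup>2) = (LINT x|circ. (\<Sum>m\<in>K. \<Sum>n\<in>K. (a m * a n) * (trig_basis m x * trig_basis n x)))"
      by (simp add: p_def power2_eq_square sum_product mult_ac)
    also have "\<dots> = (\<Sum>m\<in>K. \<Sum>n\<in>K. (a m * a n) * (if m = n then 1 else 0))"
      using square_integrable_mult[OF tb tb] by (simp add: trig_basis_orthonormal)
    also have "\<dots> = (\<Sum>n\<in>K. (a n)\<^sup>2)"
      using K by (intro sum.cong refl) (simp add: power2_eq_square if_distrib cong: if_cong)
    finally show ?thesis .
  qed
  have "(LINT x|circ. (g x - p x)\<^sup>2) = (LINT x|circ. (g x)\<^sup>2) - 2 * (\<Sum>n\<in>K. a n * c n) + (\<Sum>n\<in>K. (a n)\<^sup>2)"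
    using integral_power2_add[OF g square_integrable_cmult[OF p, of "-1"]] by (simp add: gp pp)
  also have "\<dots> = (LINT x|circ. (g x)\<^sup>2) - (\<Sum>n\<in>K. (c n)\<^sup>2) + (\<Sum>n\<in>K. (a n - c n)\<^sup>2)"
    by (simp add: power2_diff sum.distrib sum_subtractf sum_distrib_left mult.assoc)
  finally show ?thesis by (simp add: p_def c_def)
qed

text \<open>Bessel bounds all finite sums by E, and density brings some finite sum within any
  distance of E. The terms being nonnegative, the unordered sum is E.\<close>

lemma parseval_system_trig_basis: "parseval_system circ trig_basis"
  unfolding parseval_system_def
proof (intro conjI allI impI)
  show "square_integrable circ (trig_basis i)" for i by (rule trig_basis_square_integrable)
  fix g assume g: "square_integrable circ g"
  define c where "c n = (LINT x|circ. g x * trig_basis n x)" for n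
  define E where "E = (LINT x|circ. (g x)\<^sup>2)"
  have bessel: "(\<Sum>n\<in>K. (c n)\<^sup>2) \<le> E" if "finite K" for K
  proof -
    have "0 \<le> (LINT x|circ. (g x - (\<Sum>n\<in>K. c n * trig_basis n x))\<^sup>2)" by simp
    also have "\<dots> = E - (\<Sum>n\<in>K. (c n)\<^sup>2)"
      by (simp only: best_approximation[OF g that]) (simp add: c_def E_def)
    finally show ?thesis by simp
  qed
  have appr: "\<exists>K. finite K \<and> (\<Sum>n\<in>K. (c n)\<^sup>2) > E - \<epsilon>" if "\<epsilon> > 0" for \<epsilon>
  proof -
    have "\<forall>\<epsilon>>0. \<exists>p. trig_poly p \<and> (LINT x|circ. (g x - p x)\<^sup>2) < \<epsilon>"
      using square_integrable_trig_approximable[OF g] unfolding trig_approximable_def by (rule conjunct2)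
    with that obtain p where p: "trig_poly p" "(LINT x|circ. (g x - p x)\<^sup>2) < \<epsilon>" by blast
    from p(1) obtain K a where K: "finite K" "p = (\<lambda>x. \<Sum>n\<in>K. a n * trig_basis n x)" unfolding trig_poly_def by blast
    have "(\<Sum>n\<in>K. (a n - c n)\<^sup>2) \<ge> 0" by (rule sum_nonneg) simp
    with best_approximation[OF g K(1), of a] p(2) K show ?thesis
      by (intro exI[of _ K]) (simp add: c_def E_def)
  qed
  have hs: "((\<lambda>n. (c n)\<^sup>2) has_sum E) UNIV"
    unfolding has_sum_def
  proof (rule order_tendstoI)
    fix a assume "a < E"
    then obtain K where K: "finite K" "(\<Sum>n\<in>K. (c n)\<^sup>2) > a" using appr[of "E - a"] by auto
    have "(\<Sum>n\<in>K'. (c n)\<^sup>2) > a" if "finite K'" "K \<subseteq> K'" for K'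
      using K(2) sum_mono2[OF that, of "\<lambda>n. (c n)\<^sup>2"] by simp
    with K(1) show "\<forall>\<^sub>F K in finite_subsets_at_top UNIV. a < (\<Sum>n\<in>K. (c n)\<^sup>2)"
      unfolding eventually_finite_subsets_at_top by (intro exI[of _ K]) auto
  next
    fix a assume "a > E"
    then show "\<forall>\<^sub>F K in finite_subsets_at_top UNIV. (\<Sum>n\<in>K. (c n)\<^sup>2) < a"
      unfolding eventually_finite_subsets_at_top using bessel by (intro exI[of _ "{}"]) (auto intro: le_less_trans)
  qed
  then have "(\<lambda>n. (c n)\<^sup>2) summable_on UNIV" by (rule has_sum_imp_summable)
  then have a: "Infinite_Set_Sum.abs_summable_on (\<lambda>n. (c n)\<^sup>2) UNIV"
    by (simp add: abs_summable_equivalent[symmetric])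
  then have i: "integrable (count_space UNIV) (\<lambda>n. (c n)\<^sup>2)"
    by (simp add: abs_summable_on_def set_integrable_def)
  have "(LINT n|count_space UNIV. (c n)\<^sup>2) = infsetsum (\<lambda>n. (c n)\<^sup>2) UNIV"
    by (simp add: infsetsum_def set_lebesgue_integral_def)
  also have "\<dots> = E" using infsetsum_infsum[OF a] infsumI[OF hs] by simp
  finally have "(\<integral>\<^sup>+ i. ennreal ((c i)\<^sup>2) \<partial>count_space UNIV) = ennreal E"
    using nn_integral_eq_integral[OF i] by simp
  then show "(\<integral>\<^sup>+ i. ennreal ((LINT x|circ. g x * trig_basis i x)\<^sup>2) \<partial>count_space UNIV) = ennreal (LINT x|circ. (g x)\<^sup>2)"
    by (simp add: c_def E_def)
qed

subsection \<open>Fourier modes on the periodic cell\<close>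

definition cell :: "point measure" where
  "cell = restrict_space lborel Upsilon"

type_synonym index = "(int \<times> int) \<times> int"

definition mode :: "index \<Rightarrow> point \<Rightarrow> real" where
  "mode k \<xi> = trig_basis (fst (fst k)) (fst (fst \<xi>)) * trig_basis (snd (fst k)) (snd (fst \<xi>)) *
     trig_basis (snd k) (snd \<xi>)"

lemma Omega_borel [measurable]: "Omega \<in> sets borel"
  unfolding Omega_def by (intro borel_open open_Times) auto

lemma Upsilon_borel [measurable]: "Upsilon \<in> sets borel"
  unfolding Upsilon_def Omega_def by (intro borel_open open_Times) auto

lemma circ_pair_eq: "circ \<Otimes>\<^sub>M circ = restrict_space lborel Omega"
  unfolding circ_def Omega_def by (rule pair_restrict_space_lborel) auto

lemma cell_eq: "cell = (circ \<Otimes>\<^sub>M circ) \<Otimes>\<^sub>M circ"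
  unfolding circ_pair_eq unfolding cell_def circ_def Upsilon_def
  by (rule pair_restrict_space_lborel[symmetric]) auto

lemma space_cell: "space cell = Upsilon"
  by (simp add: cell_def space_restrict_space)

lemma circ_pair_finite: "finite_measure (circ \<Otimes>\<^sub>M circ)"
  by (intro finite_measure_pair_measure finite_measure_circ)

interpretation plane: finite_measure "circ \<Otimes>\<^sub>M circ"
  by (rule circ_pair_finite)

lemma finite_measure_cell: "finite_measure cell"
  unfolding cell_eq by (intro finite_measure_pair_measure finite_measure_circ circ_pair_finite)

interpretation cell: finite_measure cell
  by (rule finite_measure_cell)

lemma point_Basis: "(Basis :: point set) = {((1, 0), 0), ((0, 1), 0), ((0, 0), 1)}"
  by (auto simp: Basis_prod_def zero_prod_def)

lemma measure_Upsilon: "measure lborel Upsilon = (2 * pi) ^ 3"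
proof -
  have "Upsilon = box ((0, 0), 0) ((2 * pi, 2 * pi), 2 * pi)"
    by (auto simp: Upsilon_def Omega_def mem_box point_Basis)
  then have "measure lborel Upsilon = measure lborel (box ((0, 0), 0) ((2 * pi, 2 * pi), 2 * pi) :: point set)"
    by (rule arg_cong)
  also have "\<dots> = (2 * pi) ^ 3"
    by (subst measure_lborel_box_eq) (simp add: point_Basis power3_eq_cube)
  finally show ?thesis .
qed

lemma integral_cell: "(LINT \<xi>:Upsilon|lborel. f \<xi>) = (LINT \<xi>|cell. f \<xi>)" for f :: "point \<Rightarrow> 'b::{banach, second_countable_topology}"
  unfolding cell_def set_lebesgue_integral_def by (subst integral_restrict_space) auto

lemma integrable_cell: "set_integrable lborel Upsilon f \<longleftrightarrow> integrable cell f" for f :: "point \<Rightarrow> 'b::{banach, second_countable_topology}"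
  unfolding cell_def set_integrable_def by (subst integrable_restrict_space) auto

lemma measurable_cell: "f \<in> borel_measurable borel \<Longrightarrow> f \<in> borel_measurable cell"
  unfolding cell_def by (rule measurable_restrict_space1) simp

lemma AE_cell: "(AE \<xi> in cell. P \<xi>) \<longleftrightarrow> (AE \<xi> in lborel. \<xi> \<in> Upsilon \<longrightarrow> P \<xi>)"
  unfolding cell_def by (subst AE_restrict_space_iff) auto

lemma mode_def': "mode = (\<lambda>(i, j) (x, y). (case i of (i1, i2) \<Rightarrow> \<lambda>(x1, x2). trig_basis i1 x1 * trig_basis i2 x2) x * trig_basis j y)"
  by (auto simp: fun_eq_iff mode_def)

lemma parseval_system_mode: "parseval_system cell mode"
  unfolding cell_eq mode_def'
  by (intro parseval_system_pair parseval_system_trig_basis finite_measure.axioms(1) circ_pair_finite finite_measure_circ)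

section \<open>Differentiation of the modes\<close>

lemma trig_basis_has_derivative:
  "(trig_basis n has_real_derivative - of_int n * trig_basis (- n) x) (at x)"
proof -
  consider "n = 0" | "n > 0" | "n < 0" by linarith
  then show ?thesis
  proof cases
    case 1 then show ?thesis by (simp add: trig_basis_def[abs_def])
  next
    case 2
    have "((\<lambda>x. cos (of_int n * x)) has_real_derivative - of_int n * sin (of_int n * x)) (at x)"
      by (auto intro!: derivative_eq_intros)
    from DERIV_cdivide[OF this, of "sqrt pi"] show ?thesis
      using 2 by (simp add: trig_basis_def[abs_def])
  next
    case 3
    have "((\<lambda>x. sin (of_int (- n) * x)) has_real_derivative - of_int n * cos (of_int (- n) * x)) (at x)"
      by (auto intro!: derivative_eq_intros)
    from DERIV_cdivide[OF this, of "sqrt pi"] show ?thesis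
      using 3 by (simp add: trig_basis_def[abs_def])
  qed
qed

lemma trig_basis_periodic: "trig_basis n (x + 2 * pi) = trig_basis n x"
proof -
  have c: "cos (of_int n * x + of_int n * (2 * pi)) = cos (of_int n * x)" "sin (of_int n * x + of_int n * (2 * pi)) = sin (of_int n * x)" for n
    using cos_int_2pin[of n] sin_int_2pin[of n] by (simp_all add: cos_add sin_add mult_ac)
  show ?thesis using c[of n] c[of "-n"]
    by (auto simp: trig_basis_def distrib_left simp del: mult_minus_left of_int_minus)
qed

text \<open>Components of \<open>b\<close> serve as coordinate flags: \<open>flip b k\<close> negates the frequency in direction \<open>b\<close>, so that
  differentiating a mode in direction \<open>b\<close> exchanges sines and cosines in that variable.\<close>

definition freq :: "point \<Rightarrow> index \<Rightarrow> real" where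
  "freq b k = of_int (fst (fst k)) * fst (fst b) + of_int (snd (fst k)) * snd (fst b) + of_int (snd k) * snd b"

definition flip :: "point \<Rightarrow> index \<Rightarrow> index" where
  "flip b k = ((if fst (fst b) = 0 then fst (fst k) else - fst (fst k),
     if snd (fst b) = 0 then snd (fst k) else - snd (fst k)), if snd b = 0 then snd k else - snd k)"

lemma flip_flip: "flip b (flip b k) = k"
  by (auto simp: flip_def)

lemma freq_flip: "b \<in> Basis \<Longrightarrow> freq b (flip b k) = - freq b k"
  by (auto simp: flip_def freq_def point_Basis)

definition mode_grad :: "index \<Rightarrow> point \<Rightarrow> point" where
  "mode_grad k \<xi> = (\<Sum>b\<in>Basis. (- freq b k * mode (flip b k) \<xi>) *\<^sub>R b)"

lemma mode_grad_inner: "b \<in> Basis \<Longrightarrow> mode_grad k \<xi> \<bullet> b = - freq b k * mode (flip b k) \<xi>"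
  unfolding mode_grad_def by (subst inner_sum_left_Basis) auto

lemma mode_has_derivative: "(mode k has_derivative (\<lambda>h. mode_grad k \<xi> \<bullet> h)) (at \<xi>)"
proof -
  note d = has_derivative_compose[OF _ trig_basis_has_derivative[unfolded has_field_derivative_def]]
  have 1: "((\<lambda>\<xi>::point. trig_basis n (fst (fst \<xi>))) has_derivative
      (\<lambda>h. - of_int n * trig_basis (- n) (fst (fst \<xi>)) * fst (fst h))) (at \<xi>)" for n
    by (rule d) (auto intro!: derivative_eq_intros)
  have 2: "((\<lambda>\<xi>::point. trig_basis n (snd (fst \<xi>))) has_derivative
      (\<lambda>h. - of_int n * trig_basis (- n) (snd (fst \<xi>)) * snd (fst h))) (at \<xi>)" for n
    by (rule d) (auto intro!: derivative_eq_intros)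
  have 3: "((\<lambda>\<xi>::point. trig_basis n (snd \<xi>)) has_derivative
      (\<lambda>h. - of_int n * trig_basis (- n) (snd \<xi>) * snd h)) (at \<xi>)" for n
    by (rule d) (auto intro!: derivative_eq_intros)
  show ?thesis
    unfolding mode_def[abs_def]
    by (rule has_derivative_eq_rhs[OF has_derivative_mult[OF has_derivative_mult[OF 1 2] 3]])
      (auto simp: fun_eq_iff mode_grad_def point_Basis mode_def freq_def flip_def zero_prod_def algebra_simps)
qed

lemma cmult_mode_has_derivative:
  "((\<lambda>\<xi>. c * mode k \<xi>) has_derivative (\<lambda>h. c * (mode_grad k \<xi> \<bullet> h))) (at \<xi>)"
  by (rule has_derivative_mult_right[OF mode_has_derivative])

lemma partial_deriv_cmult_mode:
  assumes "b \<in> Basis"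
  shows "partial_deriv b (\<lambda>\<xi>. c * mode k \<xi>) = (\<lambda>\<xi>. (c * - freq b k) * mode (flip b k) \<xi>)"
proof
  fix \<xi>
  show "partial_deriv b (\<lambda>\<xi>. c * mode k \<xi>) \<xi> = (c * - freq b k) * mode (flip b k) \<xi>"
    unfolding partial_deriv_def frechet_derivative_at[OF cmult_mode_has_derivative, symmetric]
    by (simp only: mode_grad_inner[OF assms] mult.assoc)
qed

lemma partial_deriv_mode:
  assumes "b \<in> Basis"
  shows "partial_deriv b (mode k) = (\<lambda>\<xi>. - freq b k * mode (flip b k) \<xi>)"
  using partial_deriv_cmult_mode[OF assms, of 1 k] by simp

text \<open>Every iterated partial derivative of a mode is a multiple of a single mode, and
  multiples of modes are differentiable.\<close>

lemma smooth_mode: "smooth (mode k)"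
  unfolding smooth_def
proof (intro allI impI)
  fix bs :: "point list" and \<xi> assume "set bs \<subseteq> Basis"
  then have "\<exists>c l. foldr partial_deriv bs (mode k) = (\<lambda>\<xi>. c * mode l \<xi>)"
  proof (induction bs)
    case Nil show ?case by (intro exI[of _ 1] exI[of _ k]) simp
  next
    case (Cons b bs)
    then obtain c l where "foldr partial_deriv bs (mode k) = (\<lambda>\<xi>. c * mode l \<xi>)" by auto
    with Cons.prems have "foldr partial_deriv (b # bs) (mode k) = (\<lambda>\<xi>. (c * - freq b l) * mode (flip b l) \<xi>)"
      using partial_deriv_cmult_mode[of b c l] by simp
    then show ?case by blast
  qed
  then show "foldr partial_deriv bs (mode k) differentiable at \<xi>"
    using cmult_mode_has_derivative unfolding differentiable_def by metis
qed

lemma periodic_mode: "periodic (mode k)"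
  unfolding periodic_def by (auto simp: point_Basis mode_def trig_basis_periodic)

lemma periodic_mode_grad: "periodic (mode_grad k)"
  using periodic_mode unfolding periodic_def mode_grad_def by simp

lemma continuous_mode: "continuous_on A (mode k)"
  using mode_has_derivative has_derivative_continuous by (blast intro: continuous_at_imp_continuous_on)

lemma mode_measurable [measurable]: "mode k \<in> borel_measurable borel"
  by (rule borel_measurable_continuous_onI[OF continuous_mode])

lemma mode_abs_le_1: "\<bar>mode k \<xi>\<bar> \<le> 1"
  unfolding mode_def abs_mult by (intro mult_le_one mult_nonneg_nonneg trig_basis_abs_le_1) auto

lemma mode_square_integrable: "square_integrable cell (mode k)"
  using parseval_system_mode unfolding parseval_system_def by blast

text \<open>A function that is not integrable has Bochner integral 0 by convention, so Fubini is
  called only in the integrable case.\<close>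

lemma integral_pair_eq_0_fst:
  fixes w :: "'a \<times> 'b \<Rightarrow> real"
  assumes "sigma_finite_measure M" "sigma_finite_measure N" "\<And>x. x \<in> space M \<Longrightarrow> (LINT y|N. w (x, y)) = 0"
  shows "(LINT z|(M \<Otimes>\<^sub>M N). w z) = 0"
proof (cases "integrable (M \<Otimes>\<^sub>M N) w")
  case True
  interpret M: sigma_finite_measure M by fact
  interpret N: sigma_finite_measure N by fact
  interpret pair_sigma_finite M N ..
  have "(LINT z|(M \<Otimes>\<^sub>M N). w z) = (LINT x|M. LINT y|N. w (x, y))" using integral_fst'[OF True] by simp
  also have "\<dots> = (LINT x|M. 0)" using assms(3) by (intro Bochner_Integration.integral_cong) auto
  finally show ?thesis by simp
qed (rule not_integrable_integral_eq)

lemma integral_pair_eq_0_snd: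
  fixes w :: "'a \<times> 'b \<Rightarrow> real"
  assumes "sigma_finite_measure M" "sigma_finite_measure N" "\<And>y. y \<in> space N \<Longrightarrow> (LINT x|M. w (x, y)) = 0"
  shows "(LINT z|(M \<Otimes>\<^sub>M N). w z) = 0"
proof (cases "integrable (M \<Otimes>\<^sub>M N) w")
  case True
  interpret M: sigma_finite_measure M by fact
  interpret N: sigma_finite_measure N by fact
  interpret pair_sigma_finite M N ..
  have "(LINT z|(M \<Otimes>\<^sub>M N). w z) = (LINT y|N. LINT x|M. w (x, y))"
    using integral_snd[of "\<lambda>x y. w (x, y)"] True by (simp add: split_beta')
  also have "\<dots> = (LINT y|N. 0)" using assms(3) by (intro Bochner_Integration.integral_cong) auto
  finally show ?thesis by simp
qed (rule not_integrable_integral_eq)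

text \<open>Along each line parallel to b the derivative integrates over one period to a difference
  of equal values. The three cases reflect where the variable of b sits in the nested product of
  circles.\<close>

lemma integral_partial_deriv_periodic:
  fixes u :: "point \<Rightarrow> real"
  assumes u: "\<And>\<xi>. (u has_derivative (\<lambda>h. D \<xi> \<bullet> h)) (at \<xi>)" and per: "periodic u"
    and cont: "continuous_on UNIV (\<lambda>\<xi>. D \<xi> \<bullet> b)" and b: "b \<in> Basis"
  shows "(LINT \<xi>|cell. D \<xi> \<bullet> b) = 0"
proof -
  note sf = finite_measure.axioms(1)[OF finite_measure_circ] finite_measure.axioms(1)[OF circ_pair_finite]
  have line: "(LINT t|circ. D (\<xi> + t *\<^sub>R b) \<bullet> b) = 0" for \<xi>
  proof -
    have "(LINT t|circ. D (\<xi> + t *\<^sub>R b) \<bullet> b) = u (\<xi> + (2 * pi) *\<^sub>R b) - u (\<xi> + 0 *\<^sub>R b)"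
    proof (rule integral_circ_FTC)
      show "((\<lambda>t. u (\<xi> + t *\<^sub>R b)) has_real_derivative D (\<xi> + t *\<^sub>R b) \<bullet> b) (at t)" for t
        unfolding has_field_derivative_def
        by (rule has_derivative_eq_rhs[OF has_derivative_compose[OF _ u]])
          (auto intro!: derivative_eq_intros simp: fun_eq_iff)
      show "continuous_on UNIV (\<lambda>t. D (\<xi> + t *\<^sub>R b) \<bullet> b)"
        by (rule continuous_on_compose2[OF cont]) (auto intro!: continuous_intros)
    qed
    also have "\<dots> = 0" using per[unfolded periodic_def, rule_format, OF b, of \<xi>] by simp
    finally show ?thesis .
  qed
  consider "b = ((1, 0), 0)" | "b = ((0, 1), 0)" | "b = ((0, 0), 1)" using b by (auto simp: point_Basis)
  then show ?thesis
  proof cases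
    case 1
    show ?thesis unfolding cell_eq
    proof (rule integral_pair_eq_0_snd[OF sf(2,1)], rule integral_pair_eq_0_snd[OF sf(1,1)])
      fix y \<theta> show "(LINT x|circ. D ((x, y), \<theta>) \<bullet> b) = 0" using line[of "((0, y), \<theta>)"] 1 by simp
    qed
  next
    case 2
    show ?thesis unfolding cell_eq
    proof (rule integral_pair_eq_0_snd[OF sf(2,1)], rule integral_pair_eq_0_fst[OF sf(1,1)])
      fix x \<theta> show "(LINT y|circ. D ((x, y), \<theta>) \<bullet> b) = 0" using line[of "((x, 0), \<theta>)"] 2 by simp
    qed
  next
    case 3
    show ?thesis unfolding cell_eq
    proof (rule integral_pair_eq_0_fst[OF sf(2,1)])
      fix x show "(LINT \<theta>|circ. D (x, \<theta>) \<bullet> b) = 0" using line[of "(x, 0)"] 3 by (cases x) simp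
    qed
  qed
qed

lemma integrable_cell_continuous:
  fixes w :: "point \<Rightarrow> real"
  assumes "continuous_on UNIV w"
  shows "integrable cell w"
proof -
  let ?K = "cbox ((0, 0), 0) ((2 * pi, 2 * pi), 2 * pi) :: point set"
  have "compact (w ` ?K)" by (rule compact_continuous_image[OF continuous_on_subset[OF assms subset_UNIV]]) simp
  from compact_imp_bounded[OF this] obtain B where "\<forall>y\<in>w ` ?K. norm y \<le> B" unfolding bounded_iff ..
  then have B: "norm (w \<xi>) \<le> B" if "\<xi> \<in> ?K" for \<xi> using that by simp
  have sub: "Upsilon \<subseteq> ?K" by (auto simp: Upsilon_def Omega_def cbox_Pair_eq)
  have "norm (w \<xi>) \<le> B" if "\<xi> \<in> space cell" for \<xi>
    using that sub by (intro B) (auto simp: space_cell simp del: split_paired_All)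
  then show ?thesis
    by (intro cell.integrable_const_bound[where B = B] AE_I2 measurable_cell borel_measurable_continuous_onI assms)
qed

lemma smooth_differentiable:
  fixes \<psi> :: "'a::euclidean_space \<Rightarrow> real"
  assumes "smooth \<psi>"
  shows "\<psi> differentiable at x" "b \<in> Basis \<Longrightarrow> partial_deriv b \<psi> differentiable at x"
proof -
  show "\<psi> differentiable at x" using assms unfolding smooth_def by (metis empty_subsetI foldr.simps(1) id_apply list.set(1))
  assume "b \<in> Basis"
  then show "partial_deriv b \<psi> differentiable at x"
    using assms[unfolded smooth_def, rule_format, of "[b]" x] by simp
qed

lemma frechet_derivative_inner_partial_deriv:
  fixes \<psi> :: "'a::euclidean_space \<Rightarrow> real"
  assumes "\<psi> differentiable at x"
  shows "(\<psi> has_derivative (\<lambda>h. (\<Sum>b\<in>Basis. partial_deriv b \<psi> x *\<^sub>R b) \<bullet> h)) (at x)"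
proof -
  have d: "(\<psi> has_derivative frechet_derivative \<psi> (at x)) (at x)" using assms by (simp add: frechet_derivative_works)
  then interpret bounded_linear "frechet_derivative \<psi> (at x)" by (rule has_derivative_bounded_linear)
  have "frechet_derivative \<psi> (at x) h = (\<Sum>b\<in>Basis. partial_deriv b \<psi> x *\<^sub>R b) \<bullet> h" for h
  proof -
    have "frechet_derivative \<psi> (at x) h = frechet_derivative \<psi> (at x) (\<Sum>b\<in>Basis. (h \<bullet> b) *\<^sub>R b)"
      by (simp only: euclidean_representation)
    also have "\<dots> = (\<Sum>b\<in>Basis. (h \<bullet> b) * partial_deriv b \<psi> x)" by (simp only: sum scaleR partial_deriv_def) simp
    finally show ?thesis by (simp add: inner_sum_left mult.commute inner_commute[of h])
  qed
  then have "frechet_derivative \<psi> (at x) = (\<lambda>h. (\<Sum>b\<in>Basis. partial_deriv b \<psi> x *\<^sub>R b) \<bullet> h)" by (rule ext)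
  with d show ?thesis by simp
qed

text \<open>The product of mode and \<psi> is periodic, so its derivative integrates to 0. This
  makes the classical gradient of a mode its weak gradient, and modes admissible test
  functions.\<close>

lemma integral_by_parts_mode:
  assumes \<psi>: "smooth \<psi>" "periodic \<psi>" and b: "b \<in> Basis"
  shows "(LINT \<xi>|cell. mode k \<xi> * partial_deriv b \<psi> \<xi>) = - (LINT \<xi>|cell. (mode_grad k \<xi> \<bullet> b) * \<psi> \<xi>)"
proof -
  define D where "D \<xi> = mode k \<xi> *\<^sub>R (\<Sum>b\<in>Basis. partial_deriv b \<psi> \<xi> *\<^sub>R b) + \<psi> \<xi> *\<^sub>R mode_grad k \<xi>" for \<xi>
  note d\<psi> = smooth_differentiable[OF \<psi>(1)]
  have c: "continuous_on UNIV \<psi>" "continuous_on UNIV (partial_deriv b \<psi>)"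
    using d\<psi> b differentiable_imp_continuous_within by (blast intro: continuous_at_imp_continuous_on)+
  have cg: "continuous_on UNIV (\<lambda>\<xi>. mode_grad k \<xi> \<bullet> b)"
    unfolding mode_grad_inner[OF b] by (intro continuous_intros continuous_mode)
  have Db: "D \<xi> \<bullet> b = mode k \<xi> * partial_deriv b \<psi> \<xi> + (mode_grad k \<xi> \<bullet> b) * \<psi> \<xi>" for \<xi>
    unfolding D_def inner_add_left inner_scaleR_left using b
    by (simp add: inner_sum_left_Basis)
  have "(LINT \<xi>|cell. D \<xi> \<bullet> b) = 0"
  proof (rule integral_partial_deriv_periodic[OF _ _ _ b])
    show "((\<lambda>\<xi>. mode k \<xi> * \<psi> \<xi>) has_derivative (\<lambda>h. D \<xi> \<bullet> h)) (at \<xi>)" for \<xi>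
      by (rule has_derivative_eq_rhs[OF has_derivative_mult[OF mode_has_derivative
            frechet_derivative_inner_partial_deriv[OF d\<psi>(1)]]])
        (simp add: D_def fun_eq_iff inner_add_left mult.commute)
    show "periodic (\<lambda>\<xi>. mode k \<xi> * \<psi> \<xi>)" using periodic_mode \<psi>(2) by (simp add: periodic_def)
    show "continuous_on UNIV (\<lambda>\<xi>. D \<xi> \<bullet> b)" unfolding Db by (intro continuous_intros c cg continuous_mode)
  qed
  moreover have "integrable cell (\<lambda>\<xi>. mode k \<xi> * partial_deriv b \<psi> \<xi>)"
    "integrable cell (\<lambda>\<xi>. (mode_grad k \<xi> \<bullet> b) * \<psi> \<xi>)"
    by (intro integrable_cell_continuous continuous_intros c cg continuous_mode)+
  ultimately show ?thesis unfolding Db by simp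
qed

subsection \<open>Weak gradients and test functions\<close>

lemma L2_norm_cell: "L2_norm v = sqrt (LINT \<xi>|cell. (norm (v \<xi>))\<^sup>2)"
  by (simp add: L2_norm_def integral_cell)

lemma L2_norm_power2: "(L2_norm v)\<^sup>2 = (LINT \<xi>|cell. (norm (v \<xi>))\<^sup>2)"
  by (simp add: L2_norm_cell)

lemma L2_norm_nonneg: "0 \<le> L2_norm v"
  by (simp add: L2_norm_cell)

lemma L2_per_square_integrable:
  fixes v :: "point \<Rightarrow> real"
  assumes "v \<in> L2_per" shows "square_integrable cell v"
  using assms by (auto simp: L2_per_def square_integrable_def integrable_cell intro: measurable_cell)

lemma L2_per_integrable_norm:
  assumes "v \<in> L2_per" shows "integrable cell (\<lambda>\<xi>. (norm (v \<xi>))\<^sup>2)"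
  using assms by (auto simp: L2_per_def integrable_cell)

lemma inner_power2_le_norm_power2: "norm b = 1 \<Longrightarrow> (x \<bullet> b)\<^sup>2 \<le> (norm x)\<^sup>2"
  using Cauchy_Schwarz_ineq2[of x b] by (metis abs_ge_zero mult.right_neutral power2_abs power_mono)

lemma L2_per_inner_square_integrable:
  assumes "G \<in> L2_per" "b \<in> Basis" shows "square_integrable cell (\<lambda>\<xi>. G \<xi> \<bullet> b)"
proof (rule square_integrable_bound)
  show "integrable cell (\<lambda>\<xi>. (norm (G \<xi>))\<^sup>2)" by (rule L2_per_integrable_norm[OF assms(1)])
  have "G \<in> borel_measurable borel" using assms by (simp add: L2_per_def)
  then show "(\<lambda>\<xi>. G \<xi> \<bullet> b) \<in> borel_measurable cell" by (intro measurable_cell borel_measurable_inner) auto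
  show "AE \<xi> in cell. (G \<xi> \<bullet> b)\<^sup>2 \<le> (norm (G \<xi>))\<^sup>2"
    using assms(2) by (intro AE_I2 inner_power2_le_norm_power2) simp
qed

text \<open>On the Fourier side a weak derivative multiplies by a frequency and flips the index; it
  suffices to test with a mode.\<close>

lemma weak_gradient_mode:
  assumes "weak_gradient v G" "b \<in> Basis"
  shows "(LINT \<xi>|cell. (G \<xi> \<bullet> b) * mode k \<xi>) = freq b k * (LINT \<xi>|cell. v \<xi> * mode (flip b k) \<xi>)"
proof -
  have "(LINT \<xi>|cell. v \<xi> * partial_deriv b (mode k) \<xi>) = - (LINT \<xi>|cell. (G \<xi> \<bullet> b) * mode k \<xi>)"
    using assms smooth_mode periodic_mode by (simp add: weak_gradient_def integral_cell)
  then show ?thesis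
    unfolding partial_deriv_mode[OF assms(2)] mult.left_commute[of "v _" "- freq b k"] by simp
qed

text \<open>Componentwise, both gradients have the Fourier coefficients dictated by v, and
  Parseval's identity annihilates the difference.\<close>

lemma weak_gradient_unique:
  assumes G: "weak_gradient v G" and G': "weak_gradient v G'"
  shows "AE \<xi> in cell. G \<xi> = G' \<xi>"
proof -
  have "AE \<xi> in cell. G \<xi> \<bullet> b = G' \<xi> \<bullet> b" if b: "b \<in> Basis" for b
  proof -
    have sq: "square_integrable cell (\<lambda>\<xi>. G \<xi> \<bullet> b)" "square_integrable cell (\<lambda>\<xi>. G' \<xi> \<bullet> b)"
      using G G' b by (auto simp: weak_gradient_def intro!: L2_per_inner_square_integrable)
    note d = square_integrable_diff[OF this]
    have "(LINT \<xi>|cell. (G \<xi> \<bullet> b - G' \<xi> \<bullet> b) * mode k \<xi>) = 0" for k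
      using weak_gradient_mode[OF G b, of k] weak_gradient_mode[OF G' b, of k]
        square_integrable_mult[OF sq(1) mode_square_integrable] square_integrable_mult[OF sq(2) mode_square_integrable]
      by (simp add: left_diff_distrib)
    then have "((\<lambda>_::index. 0) has_sum (LINT \<xi>|cell. (G \<xi> \<bullet> b - G' \<xi> \<bullet> b)\<^sup>2)) UNIV"
      using parseval_has_sum_power2[OF parseval_system_mode d] by simp
    from infsumI[OF this] have "(LINT \<xi>|cell. (G \<xi> \<bullet> b - G' \<xi> \<bullet> b)\<^sup>2) = 0"
      by simp
    then have "AE \<xi> in cell. (G \<xi> \<bullet> b - G' \<xi> \<bullet> b)\<^sup>2 = 0"
      using d by (subst (asm) integral_nonneg_eq_0_iff_AE) (auto simp: square_integrable_def)
    then show ?thesis by eventually_elim simp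
  qed
  then have "AE \<xi> in cell. \<forall>b\<in>Basis. G \<xi> \<bullet> b = G' \<xi> \<bullet> b"
    by (rule AE_finite_allI[OF finite_Basis])
  then show ?thesis by eventually_elim (rule euclidean_eqI, blast)
qed

text \<open>\<open>H1_norm\<close> and \<open>poincare_constant\<close> refer to a gradient picked
  by Hilbert choice; this transfers them to whichever gradient is at hand.\<close>

lemma L2_norm_wgrad:
  assumes "weak_gradient v G"
  shows "L2_norm (wgrad v) = L2_norm G"
proof -
  have w: "weak_gradient v (wgrad v)" unfolding wgrad_def by (rule someI[of _ G]) fact
  have m: "wgrad v \<in> borel_measurable cell" "G \<in> borel_measurable cell"
    using w assms by (auto simp: weak_gradient_def L2_per_def intro: measurable_cell)
  show ?thesis unfolding L2_norm_cell
    by (intro arg_cong[of _ _ sqrt] integral_cong_AE)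
      (use m weak_gradient_unique[OF w assms] in auto)
qed

lemma cmult_mode_L2_per: "(\<lambda>\<xi>. c * mode k \<xi>) \<in> L2_per"
proof -
  have "square_integrable cell (\<lambda>\<xi>. c * mode k \<xi>)" by (intro square_integrable_cmult mode_square_integrable)
  then show ?thesis
    using periodic_mode by (auto simp: L2_per_def integrable_cell square_integrable_def periodic_def)
qed

lemma continuous_mode_grad: "continuous_on A (mode_grad k)"
  unfolding mode_grad_def by (intro continuous_intros continuous_mode)

lemma scaleR_mode_grad_L2_per: "(\<lambda>\<xi>. c *\<^sub>R mode_grad k \<xi>) \<in> L2_per"
proof -
  have "integrable cell (\<lambda>\<xi>. (norm (c *\<^sub>R mode_grad k \<xi>))\<^sup>2)"
    by (intro integrable_cell_continuous continuous_intros continuous_mode_grad)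
  moreover have "(\<lambda>\<xi>. c *\<^sub>R mode_grad k \<xi>) \<in> borel_measurable borel"
    by (intro borel_measurable_continuous_onI continuous_intros continuous_mode_grad)
  moreover have "periodic (\<lambda>\<xi>. c *\<^sub>R mode_grad k \<xi>)"
    using periodic_mode_grad[of k] by (simp add: periodic_def)
  ultimately show ?thesis by (simp only: L2_per_def integrable_cell mem_Collect_eq)
qed

lemma weak_gradient_cmult_mode: "weak_gradient (\<lambda>\<xi>. c * mode k \<xi>) (\<lambda>\<xi>. c *\<^sub>R mode_grad k \<xi>)"
  unfolding weak_gradient_def
  by (auto simp: scaleR_mode_grad_L2_per integral_cell integral_by_parts_mode mult.assoc)

lemma cmult_mode_H1_per: "(\<lambda>\<xi>. c * mode k \<xi>) \<in> H1_per"
  unfolding H1_per_def using cmult_mode_L2_per weak_gradient_cmult_mode by blast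

lemma mode_H1_per: "mode k \<in> H1_per"
  using cmult_mode_H1_per[of 1] by simp

lemma H1_norm_cmult_mode: "H1_norm (\<lambda>\<xi>. c * mode k \<xi>) = \<bar>c\<bar> * H1_norm (mode k)"
proof -
  have 1: "(L2_norm (\<lambda>\<xi>. c * mode k \<xi>))\<^sup>2 = c\<^sup>2 * (L2_norm (mode k))\<^sup>2"
    unfolding L2_norm_power2 by (simp add: power_mult_distrib norm_mult)
  have 2: "(L2_norm (wgrad (\<lambda>\<xi>. c * mode k \<xi>)))\<^sup>2 = c\<^sup>2 * (L2_norm (mode_grad k))\<^sup>2" for c
    unfolding L2_norm_wgrad[OF weak_gradient_cmult_mode] L2_norm_power2
    by (simp add: power_mult_distrib)
  have 3: "(L2_norm (wgrad (mode k)))\<^sup>2 = (L2_norm (mode_grad k))\<^sup>2" using 2[of 1] by simp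
  show ?thesis unfolding H1_norm_def 1 2 3
    by (simp add: real_sqrt_mult flip: distrib_left)
qed

text \<open>All values lie on the line spanned by one mode, where \<open>H1_norm\<close> is
  homogeneous. Simple approximations of the scalar \<eta> therefore yield simple functions with
  values in \<open>H1_per\<close>.\<close>

lemma mode_test_bochner_L2:
  assumes \<eta>: "continuous_on UNIV \<eta>" and bd: "\<And>t. \<bar>\<eta> t\<bar> \<le> B"
  shows "(\<lambda>t \<xi>. \<eta> t * mode k \<xi>) \<in> bochner_L2 H1_per H1_norm T"
proof -
  have m: "\<eta> \<in> borel_measurable lebesgue"
    using borel_measurable_continuous_onI[OF \<eta>] by (auto intro: measurable_completion)
  from borel_measurable_implies_sequence_metric[OF m, of 0] obtain i where
    i: "(\<forall>n. simple_function lebesgue (i n)) \<and> (\<forall>x\<in>space lebesgue. (\<lambda>n. i n x) \<longlonglongrightarrow> \<eta> x) \<and>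
     (\<forall>n. \<forall>x\<in>space lebesgue. dist (i n x) 0 \<le> 2 * dist (\<eta> x) 0)" ..
  have s: "\<exists>s. (\<forall>n::nat. simple_function lebesgue (s n) \<and> range (s n) \<subseteq> H1_per) \<and>
     (AE t in lebesgue. t \<in> {0<..<T} \<longrightarrow> (\<lambda>n. H1_norm (s n t - (\<lambda>\<xi>. \<eta> t * mode k \<xi>))) \<longlonglongrightarrow> 0)"
  proof (intro exI[of _ "\<lambda>n t \<xi>. i n t * mode k \<xi>"] conjI allI AE_I2 impI)
    fix n
    show "simple_function lebesgue (\<lambda>t \<xi>. i n t * mode k \<xi>)"
      by (rule simple_function_compose1[where g = "\<lambda>c \<xi>. c * mode k \<xi>"]) (use i in blast)
    show "range (\<lambda>t \<xi>. i n t * mode k \<xi>) \<subseteq> H1_per" using cmult_mode_H1_per by blast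
  next
    fix t
    have e: "(\<lambda>\<xi>. i n t * mode k \<xi>) - (\<lambda>\<xi>. \<eta> t * mode k \<xi>) = (\<lambda>\<xi>. (i n t - \<eta> t) * mode k \<xi>)" for n
      by (auto simp: fun_eq_iff left_diff_distrib)
    have "(\<lambda>n. i n t) \<longlonglongrightarrow> \<eta> t" using i by simp
    then have "(\<lambda>n. \<bar>i n t - \<eta> t\<bar> * H1_norm (mode k)) \<longlonglongrightarrow> \<bar>\<eta> t - \<eta> t\<bar> * H1_norm (mode k)"
      by (intro tendsto_intros)
    then show "(\<lambda>n. H1_norm ((\<lambda>\<xi>. i n t * mode k \<xi>) - (\<lambda>\<xi>. \<eta> t * mode k \<xi>))) \<longlonglongrightarrow> 0"
      unfolding e H1_norm_cmult_mode by simp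
  qed
  have "(\<integral>\<^sup>+t\<in>{0<..<T}. ennreal ((H1_norm (\<lambda>\<xi>. \<eta> t * mode k \<xi>))\<^sup>2) \<partial>lebesgue)
      \<le> (\<integral>\<^sup>+t. ennreal ((B * H1_norm (mode k))\<^sup>2) * indicator {0<..<T} t \<partial>lebesgue)"
  proof (intro nn_integral_mono mult_right_mono ennreal_leI power_mono)
    fix t
    show "H1_norm (\<lambda>\<xi>. \<eta> t * mode k \<xi>) \<le> B * H1_norm (mode k)"
      unfolding H1_norm_cmult_mode by (intro mult_right_mono bd) (simp add: H1_norm_def)
  qed (simp_all add: H1_norm_def)
  also have "\<dots> < \<infinity>"
    by (subst nn_integral_cmult_indicator) (cases "0 \<le> T"; simp add: ennreal_mult_less_top)+
  finally show ?thesis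
    unfolding bochner_L2_def using s cmult_mode_H1_per by auto
qed

lemma mode_test_space_gradient:
  assumes \<eta>: "continuous_on UNIV \<eta>"
  shows "space_gradient T (\<lambda>t \<xi>. \<eta> t * mode k \<xi>) (\<lambda>t \<xi>. \<eta> t *\<^sub>R mode_grad k \<xi>)"
  unfolding space_gradient_def
proof (intro conjI AE_I2 impI weak_gradient_cmult_mode)
  have "continuous_on UNIV (\<lambda>z. \<eta> (fst z) *\<^sub>R mode_grad k (snd z))"
    by (intro continuous_intros continuous_on_compose2[OF \<eta>] continuous_on_compose2[OF continuous_mode_grad]) auto
  then have [measurable]: "(\<lambda>z. \<eta> (fst z) *\<^sub>R mode_grad k (snd z)) \<in> borel_measurable borel"
    by (rule borel_measurable_continuous_onI)
  have [measurable]: "{0<..<T} \<times> (UNIV :: point set) \<in> sets borel"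
    by (intro borel_open open_Times) auto
  show "jointly_measurable T (\<lambda>t \<xi>. \<eta> t *\<^sub>R mode_grad k \<xi>)"
    unfolding jointly_measurable_def set_borel_measurable_def split_beta' by measurable
qed

subsection \<open>Smooth cut-off functions in time\<close>

text \<open>The powers of 1 / x are those produced by differentiating exp (- 1 / x): the derivative
  of member n combines members n + 1 and n + 2.\<close>

definition flat_exp :: "nat \<Rightarrow> real \<Rightarrow> real" where
  "flat_exp n x = (if x > 0 then (1 / x) ^ n * exp (- (1 / x)) else 0)"

lemma flat_exp_tendsto_0: "(flat_exp n \<longlongrightarrow> 0) (at_right 0)"
proof -
  have "((\<lambda>x::real. (inverse x) ^ n / exp (inverse x)) \<longlongrightarrow> 0) (at_right 0)"
    by (rule filterlim_compose[OF tendsto_power_div_exp_0 filterlim_inverse_at_top_right])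
  then show ?thesis
    by (rule Lim_transform_eventually)
      (auto simp: flat_exp_def eventually_at_filter exp_minus inverse_eq_divide)
qed

lemma flat_exp_has_derivative:
  "(flat_exp n has_real_derivative - real n * flat_exp (Suc n) x + flat_exp (Suc (Suc n)) x) (at x)"
proof -
  consider "x > 0" | "x < 0" | "x = 0" by linarith
  then show ?thesis
  proof cases
    case 1
    have "((\<lambda>x. (1 / x) ^ n * exp (- (1 / x))) has_real_derivative
        - real n * (1 / x) ^ Suc n * exp (- (1 / x)) + (1 / x) ^ Suc (Suc n) * exp (- (1 / x))) (at x)"
    proof -
      have d: "((\<lambda>x. 1 / x) has_real_derivative - ((1 / x)\<^sup>2)) (at x)"
        using 1 by (auto intro!: derivative_eq_intros simp: power2_eq_square)
      show ?thesis
        by (rule DERIV_cong[OF DERIV_mult[OF DERIV_power[OF d] DERIV_chain2[OF DERIV_exp DERIV_minus[OF d]]]])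
          (cases n; simp add: power2_eq_square algebra_simps flip: add_divide_distrib)
    qed
    then show ?thesis
    proof (rule has_field_derivative_transform_within_open[where S = "{0<..}", THEN DERIV_cong])
      show "x \<in> {0<..}" using 1 by simp
    qed (use 1 in \<open>auto simp: flat_exp_def\<close>)
  next
    case 2
    have "((\<lambda>x. 0) has_real_derivative 0) (at x)" by simp
    then show ?thesis
    proof (rule has_field_derivative_transform_within_open[where S = "{..<0}", THEN DERIV_cong])
      show "x \<in> {..<0}" using 2 by simp
    qed (use 2 in \<open>auto simp: flat_exp_def\<close>)
  next
    case 3
    \<comment> \<open>To the right of 0 the difference quotient is the next member of the family,
      which tends to 0; to the left it is 0.\<close>
    have "((\<lambda>y. (flat_exp n y - flat_exp n 0) / (y - 0)) \<longlongrightarrow> 0) (at_right 0)"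
      by (rule Lim_transform_eventually[OF flat_exp_tendsto_0[of "Suc n"]])
        (auto simp: flat_exp_def eventually_at_filter)
    moreover have "((\<lambda>y. (flat_exp n y - flat_exp n 0) / (y - 0)) \<longlongrightarrow> 0) (at_left 0)"
      by (rule tendsto_eventually) (auto simp: flat_exp_def eventually_at_filter)
    ultimately have "((\<lambda>y. (flat_exp n y - flat_exp n 0) / (y - 0)) \<longlongrightarrow> 0) (at 0)"
      by (simp add: filterlim_at_split)
    then show ?thesis using 3 by (simp add: has_field_derivative_iff flat_exp_def)
  qed
qed

text \<open>A class of functions closed under differentiation, which is all that
  \<open>smooth\<close> asks for through its iterated partial derivatives.\<close>

inductive flat_algebra :: "(real \<Rightarrow> real) \<Rightarrow> bool" where
  flat: "flat_algebra (\<lambda>x. flat_exp n (a * x + b))"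
| const: "flat_algebra (\<lambda>x. c)"
| add: "flat_algebra f \<Longrightarrow> flat_algebra g \<Longrightarrow> flat_algebra (\<lambda>x. f x + g x)"
| mult: "flat_algebra f \<Longrightarrow> flat_algebra g \<Longrightarrow> flat_algebra (\<lambda>x. f x * g x)"

lemma flat_algebra_derivative:
  assumes "flat_algebra f"
  shows "\<exists>f'. flat_algebra f' \<and> (\<forall>x. (f has_real_derivative f' x) (at x))"
  using assms
proof induction
  case (flat n a b)
  have "((\<lambda>x. flat_exp n (a * x + b)) has_real_derivative
      a * ((- real n) * flat_exp (Suc n) (a * x + b) + flat_exp (Suc (Suc n)) (a * x + b))) (at x)" for x
    by (rule DERIV_cong[OF DERIV_chain2[OF flat_exp_has_derivative]])
      (auto intro!: derivative_eq_intros)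
  moreover have "flat_algebra (\<lambda>x. a * ((- real n) * flat_exp (Suc n) (a * x + b) + flat_exp (Suc (Suc n)) (a * x + b)))"
    by (intro flat_algebra.mult flat_algebra.add flat_algebra.const flat_algebra.flat)
  ultimately show ?case by blast
next
  case (const c)
  show ?case by (intro exI[of _ "\<lambda>_. 0"]) (auto intro: flat_algebra.const)
next
  case (add f g)
  then obtain f' g' where "flat_algebra f'" "\<And>x. (f has_real_derivative f' x) (at x)"
    "flat_algebra g'" "\<And>x. (g has_real_derivative g' x) (at x)" by blast
  then show ?case by (intro exI[of _ "\<lambda>x. f' x + g' x"]) (auto intro!: flat_algebra.add derivative_eq_intros)
next
  case (mult f g)
  then obtain f' g' where "flat_algebra f'" "\<And>x. (f has_real_derivative f' x) (at x)"
    "flat_algebra g'" "\<And>x. (g has_real_derivative g' x) (at x)" by blast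
  with mult.hyps show ?case
    by (intro exI[of _ "\<lambda>x. f' x * g x + g' x * f x"])
      (auto intro!: flat_algebra.add flat_algebra.mult DERIV_mult)
qed

lemma partial_deriv_real:
  assumes "\<And>x. (f has_real_derivative f' x) (at x)"
  shows "partial_deriv 1 f = f'"
proof
  fix x
  have "frechet_derivative f (at x) = (*) (f' x)"
    using assms[of x] by (simp add: has_field_derivative_def frechet_derivative_at[symmetric])
  then show "partial_deriv 1 f x = f' x" by (simp add: partial_deriv_def)
qed

lemma smooth_if_derivatives_closed:
  assumes closed: "\<And>g. g \<in> C \<Longrightarrow> \<exists>g'\<in>C. \<forall>x. (g has_real_derivative g' x) (at x)" and f: "f \<in> C"
  shows "smooth f"
  unfolding smooth_def
proof (intro allI impI)
  fix bs :: "real list" and x assume "set bs \<subseteq> Basis"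
  then have "foldr partial_deriv bs f \<in> C"
  proof (induction bs)
    case (Cons b bs)
    then have "foldr partial_deriv bs f \<in> C" "b = 1" by auto
    from closed[OF this(1)] obtain g' where g': "g' \<in> C" "\<And>x. (foldr partial_deriv bs f has_real_derivative g' x) (at x)"
      by blast
    from partial_deriv_real[OF g'(2)] show ?case using \<open>b = 1\<close> g'(1) by simp
  qed (simp add: f)
  from closed[OF this] obtain g' where "(foldr partial_deriv bs f has_real_derivative g' x) (at x)" by blast
  then show "foldr partial_deriv bs f differentiable at x"
    unfolding has_field_derivative_def by (rule differentiableI)
qed

text \<open>The cut-offs are antiderivatives of bumps and need not belong to the algebra; adjoining
  this one function keeps the class closed under differentiation.\<close>

lemma smooth_if_derivative_flat_algebra:
  assumes "\<And>x. (f has_real_derivative f' x) (at x)" "flat_algebra f'"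
  shows "smooth f"
proof (rule smooth_if_derivatives_closed[of "insert f (Collect flat_algebra)"])
  fix g assume "g \<in> insert f (Collect flat_algebra)"
  then show "\<exists>g'\<in>insert f (Collect flat_algebra). \<forall>x. (g has_real_derivative g' x) (at x)"
    using assms flat_algebra_derivative by auto
qed simp

definition bump :: "real \<Rightarrow> real" where
  "bump x = flat_exp 0 (x + 1) * flat_exp 0 (1 - x)"

lemma bump_pos: "\<bar>x\<bar> < 1 \<Longrightarrow> bump x > 0"
  by (auto simp: bump_def flat_exp_def)

lemma bump_zero: "\<bar>x\<bar> \<ge> 1 \<Longrightarrow> bump x = 0"
  by (auto simp: bump_def flat_exp_def)

lemma bump_nonneg: "bump x \<ge> 0"
  by (auto simp: bump_def flat_exp_def)

lemma flat_algebra_bump_affine: "flat_algebra (\<lambda>x. bump (a * x + b))"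
proof -
  have "flat_algebra (\<lambda>x. flat_exp 0 (a * x + (b + 1)) * flat_exp 0 ((- a) * x + (1 - b)))"
    by (intro flat_algebra.intros)
  then show ?thesis by (simp add: bump_def algebra_simps)
qed

lemma flat_algebra_continuous: "flat_algebra f \<Longrightarrow> isCont f x"
  using flat_algebra_derivative DERIV_isCont by blast

text \<open>S is an antiderivative of the bump, shifted to vanish at -1 and divided by the total
  mass Z. It is constant outside [-1, 1] because the bump vanishes there.\<close>

lemma smooth_step_exists:
  "\<exists>S Z. Z > 0 \<and> (\<forall>x. (S has_real_derivative bump x / Z) (at x)) \<and>
    (\<forall>x\<le>-1. S x = (0::real)) \<and> (\<forall>x\<ge>1. S x = 1) \<and> (\<forall>x. 0 \<le> S x \<and> S x \<le> 1)"
proof -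
  have "isCont bump x" for x using flat_algebra_continuous[OF flat_algebra_bump_affine[of 1 0]] by simp
  then obtain F where "\<forall>x::real. -\<infinity> < ereal x \<longrightarrow> ereal x < \<infinity> \<longrightarrow> (F has_vector_derivative bump x) (at x)"
    using einterval_antiderivative[of "-\<infinity>" "\<infinity>" bump] by auto
  then have F: "(F has_real_derivative bump x) (at x)" for x
    by (simp add: has_real_derivative_iff_has_vector_derivative)
  have mvt: "\<exists>z. a < z \<and> z < b \<and> F b - F a = (b - a) * bump z" if "a < b" for a b
    using MVT2[OF that, of F bump] F by blast
  define Z where "Z = F 1 - F (-1)"
  have Z: "Z > 0"
  proof -
    obtain z where "-1 < z" "z < 1" "F 1 - F (-1) = 2 * bump z" using mvt[of "-1" 1] by auto
    then show ?thesis using bump_pos[of z] by (simp add: Z_def abs_less_iff)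
  qed
  have mono: "F a \<le> F b" if "a \<le> b" for a b
    using DERIV_nonneg_imp_nondecreasing[OF that, of F] F bump_nonneg by blast
  have lo: "F x = F (-1)" if "x \<le> -1" for x
    using mvt[of x "-1"] bump_zero that by (cases "x = -1") auto
  have hi: "F x = F 1" if "x \<ge> 1" for x
    using mvt[of 1 x] bump_zero that by (cases "x = 1") auto
  have bd: "F (-1) \<le> F x" "F x \<le> F 1" for x
    using mono[of x "-1"] mono[of "-1" x] mono[of x 1] mono[of 1 x] lo[of x] hi[of x] by linarith+
  show ?thesis
  proof (intro exI[of _ "\<lambda>x. (F x - F (-1)) / Z"] exI[of _ Z] conjI allI impI)
    fix x
    show "((\<lambda>x. (F x - F (-1)) / Z) has_real_derivative bump x / Z) (at x)"
      using F[of x] Z by (auto intro!: derivative_eq_intros)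
    show "(F x - F (-1)) / Z = 1" if "x \<ge> 1" using hi[OF that] Z by (simp add: Z_def)
    show "(F x - F (-1)) / Z \<le> 1" using bd[of x] Z by (simp add: Z_def)
    show "(F x - F (-1)) / Z = 0" if "x \<le> -1" using lo[OF that] by simp
    show "0 \<le> (F x - F (-1)) / Z" using bd(1)[of x] Z by simp
  qed fact
qed

text \<open>Based on \<open>lborel\<close>, so that its products with \<open>cell\<close> are
  restricted Lebesgue-Borel measures again; \<open>AE_time\<close> and
  \<open>integral_lebesgue_time\<close> translate from the \<open>lebesgue\<close> of the
  definitions.\<close>

definition time_measure :: "real \<Rightarrow> real measure" where
  "time_measure T = restrict_space lborel {0<..<T}"

lemma space_time_measure: "space (time_measure T) = {0<..<T}"
  by (simp add: time_measure_def space_restrict_space)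

lemma finite_measure_time_measure: "finite_measure (time_measure T)"
  by (rule finite_measureI)
    (cases "0 \<le> T"; simp add: time_measure_def space_restrict_space emeasure_restrict_space)

interpretation time: finite_measure "time_measure T" for T
  by (rule finite_measure_time_measure)

lemma measurable_time: "f \<in> borel_measurable borel \<Longrightarrow> f \<in> borel_measurable (time_measure T)"
  unfolding time_measure_def by (rule measurable_restrict_space1) simp

lemma integral_time: "(LINT t|time_measure T. f t) = (LINT t:{0<..<T}|lborel. f t)" for f :: "real \<Rightarrow> real"
  unfolding time_measure_def set_lebesgue_integral_def by (subst integral_restrict_space) auto

text \<open>The rescaled \<sigma> is an approximate identity at s, of mass S 1 - S (-1) = 1. As c is
  only known to be continuous on the open interval, integrability is part of the conclusion.\<close>

lemma mollifier_limit:
  fixes c :: "real \<Rightarrow> real"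
  assumes S: "\<And>x. (S has_real_derivative \<sigma> x) (at x)" "\<And>x. \<sigma> x \<ge> 0" "\<And>x. \<bar>x\<bar> \<ge> 1 \<Longrightarrow> \<sigma> x = 0"
      "S (-1) = 0" "S 1 = 1" "continuous_on UNIV \<sigma>"
    and c: "continuous_on {0<..<T} c" and s: "s \<in> {0<..<T}" and \<delta>: "\<delta> > 0"
  shows "\<exists>\<epsilon>0>0. \<forall>\<epsilon>. 0 < \<epsilon> \<longrightarrow> \<epsilon> < \<epsilon>0 \<longrightarrow>
    integrable (time_measure T) (\<lambda>x. \<sigma> ((x - s) / \<epsilon>) / \<epsilon> * c x) \<and>
    \<bar>(LINT x|time_measure T. \<sigma> ((x - s) / \<epsilon>) / \<epsilon> * c x) - c s\<bar> \<le> \<delta>"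
proof -
  let ?M = "time_measure T"
  have "isCont c s" using c s by (simp add: continuous_on_eq_continuous_at)
  then obtain d where d: "d > 0" "\<And>x. \<bar>x - s\<bar> < d \<Longrightarrow> \<bar>c x - c s\<bar> < \<delta>"
    using \<delta> by (auto simp: continuous_at_eps_delta dist_real_def)
  have cm: "c \<in> borel_measurable ?M"
    using borel_measurable_continuous_on_restrict[OF c]
    by (simp add: time_measure_def cong: measurable_cong_sets)
  \<comment> \<open>Below d the oscillation of c on the support is less than \<delta>; below s and T
    - s the support stays inside (0, T), so no mass is lost.\<close>
  show ?thesis
  proof (intro exI[of _ "min d (min s (T - s))"] conjI allI impI)
    show "0 < min d (min s (T - s))" using d s by auto
    fix \<epsilon> :: real assume e: "0 < \<epsilon>" "\<epsilon> < min d (min s (T - s))"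
    define g where "g x = \<sigma> ((x - s) / \<epsilon>) / \<epsilon>" for x
    have gc: "continuous_on UNIV g" unfolding g_def
      by (intro continuous_intros continuous_on_compose2[OF S(6)]) (use e in auto)
    then have gm: "g \<in> borel_measurable ?M" by (intro measurable_time borel_measurable_continuous_onI)
    have g0: "g x = 0" if "\<bar>x - s\<bar> \<ge> \<epsilon>" for x using S(3)[of "(x - s) / \<epsilon>"] that e by (simp add: g_def abs_divide)
    have gn: "g x \<ge> 0" for x using S(2) e by (simp add: g_def)
    have dS: "((\<lambda>x. S ((x - s) / \<epsilon>)) has_real_derivative g x) (at x)" for x
    proof -
      have "((\<lambda>x. (x - s) / \<epsilon>) has_real_derivative 1 / \<epsilon>) (at x)"
        using e by (auto intro!: derivative_eq_intros)
      from DERIV_chain2[OF S(1) this] show ?thesis by (simp add: g_def)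
    qed
    have "has_bochner_integral lborel (\<lambda>x. g x * indicator {s - \<epsilon>..s + \<epsilon>} x)
        (S ((s + \<epsilon> - s) / \<epsilon>) - S ((s - \<epsilon> - s) / \<epsilon>))"
      by (rule has_bochner_integral_FTC_Icc_real) (use e dS gc in \<open>auto simp: continuous_on_eq_continuous_at\<close>)
    also have "(\<lambda>x. g x * indicator {s - \<epsilon>..s + \<epsilon>} x) = (\<lambda>x. indicator {0<..<T} x *\<^sub>R g x)"
    proof
      fix x show "g x * indicator {s - \<epsilon>..s + \<epsilon>} x = indicator {0<..<T} x *\<^sub>R g x"
      proof (cases "\<bar>x - s\<bar> \<ge> \<epsilon>")
        case False
        then have "x \<in> {s - \<epsilon>..s + \<epsilon>}" "x \<in> {0<..<T}" using e by auto
        then show ?thesis by simp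
      qed (simp add: g0)
    qed
    also have "S ((s + \<epsilon> - s) / \<epsilon>) - S ((s - \<epsilon> - s) / \<epsilon>) = 1" using S(4,5) e by simp
    finally have "has_bochner_integral ?M g 1"
      unfolding time_measure_def by (subst has_bochner_integral_restrict_space) auto
    then have gi: "integrable ?M g" and g1: "(LINT x|?M. g x) = 1"
      by (auto simp: has_bochner_integral_iff)
    have near: "\<bar>g x * (c x - c s)\<bar> \<le> \<delta> * g x" for x
    proof (cases "\<bar>x - s\<bar> < \<epsilon>")
      case True
      then have "\<bar>c x - c s\<bar> \<le> \<delta>" using d(2)[of x] e by linarith
      from mult_left_mono[OF this gn[of x]] show ?thesis
        using gn[of x] by (simp only: abs_mult abs_of_nonneg mult.commute[of \<delta>])
    next
      case False
      then have "g x = 0" by (intro g0) linarith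
      then show ?thesis by (simp only: mult_zero_left mult_zero_right abs_zero order_refl)
    qed
    have di: "integrable ?M (\<lambda>x. g x * (c x - c s))"
    proof (rule Bochner_Integration.integrable_bound)
      show "integrable ?M (\<lambda>x. \<delta> * g x)" using gi by simp
      show "(\<lambda>x. g x * (c x - c s)) \<in> borel_measurable ?M"
        by (intro borel_measurable_times borel_measurable_diff gm cm borel_measurable_const)
      show "AE x in ?M. norm (g x * (c x - c s)) \<le> norm (\<delta> * g x)"
      proof (rule AE_I2)
        fix x show "norm (g x * (c x - c s)) \<le> norm (\<delta> * g x)"
          unfolding real_norm_def by (rule order_trans[OF near abs_ge_self])
      qed
    qed
    have "integrable ?M (\<lambda>x. g x * (c x - c s) + c s * g x)" using di gi by simp
    then have i: "integrable ?M (\<lambda>x. g x * c x)"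
      by (simp add: algebra_simps)
    then show "integrable ?M (\<lambda>x. \<sigma> ((x - s) / \<epsilon>) / \<epsilon> * c x)"
      by (simp only: g_def)
    have eq: "(LINT x|?M. g x * c x) - c s = (LINT x|?M. g x * (c x - c s))"
      using i gi g1 by (simp add: right_diff_distrib)
    have "\<bar>LINT x|?M. g x * (c x - c s)\<bar> \<le> (LINT x|?M. \<bar>g x * (c x - c s)\<bar>)"
      by (rule integral_abs_bound)
    also have "\<dots> \<le> (LINT x|?M. \<delta> * g x)"
      by (rule integral_mono) (use di gi near in simp_all)
    also have "\<dots> = \<delta>" using g1 by simp
    finally have "\<bar>(LINT x|?M. g x * c x) - c s\<bar> \<le> \<delta>" by (simp only: eq)
    then show "\<bar>(LINT x|?M. \<sigma> ((x - s) / \<epsilon>) / \<epsilon> * c x) - c s\<bar> \<le> \<delta>"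
      by (simp only: g_def)
  qed
qed

subsection \<open>Weak time derivatives of scalar functions\<close>

text \<open>Test with smooth plateaus approximating the indicator of (s, t). Their derivatives are
  differences of approximate identities at s and t, which recover the exact values of the continuous
  c; the other side converges by domination with |A|.\<close>

lemma weak_derivative_increment:
  fixes c A :: "real \<Rightarrow> real"
  assumes c: "continuous_on {0<..<T} c" and A: "integrable (time_measure T) A"
    and weak: "\<And>\<eta>. smooth \<eta> \<Longrightarrow> compactly_supported_in T \<eta> \<Longrightarrow>
      (LINT r|time_measure T. deriv \<eta> r * c r) = - (LINT r|time_measure T. \<eta> r * A r)"
    and s: "0 < s" and st: "s < t" and t: "t < T"
  shows "c t - c s = (LINT r|time_measure T. indicator {s<..<t} r * A r)"
proof -
  let ?M = "time_measure T"
  from smooth_step_exists obtain S Z where *: "Z > 0 \<and> (\<forall>x. (S has_real_derivative bump x / Z) (at x)) \<and>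
    (\<forall>x\<le>-1. S x = 0) \<and> (\<forall>x\<ge>1. S x = 1) \<and> (\<forall>x. 0 \<le> S x \<and> S x \<le> 1)"
    by (elim exE)
  have Z: "Z > 0" and S: "\<And>x. (S has_real_derivative bump x / Z) (at x)" "\<And>x. x \<le> -1 \<Longrightarrow> S x = 0"
    "\<And>x. x \<ge> 1 \<Longrightarrow> S x = 1" "\<And>x. 0 \<le> S x" "\<And>x. S x \<le> 1"
    by (simp_all add: *)
  define d where "d = min s (T - t)"
  have d0: "0 < d" using s t by (simp add: d_def)
  \<comment> \<open>The second \<open>Suc\<close> gives e n < d already for n = 0, so all plateaus
    are supported in (0, T).\<close>
  define e where "e n = d * inverse (real (Suc (Suc n)))" for n
  have e0: "0 < e n" for n using d0 by (simp add: e_def)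
  have elt: "e n < s" "e n < T - t" for n
  proof -
    have "e n < d * 1" unfolding e_def using d0 by (intro mult_strict_left_mono) (auto simp: inverse_less_1_iff)
    then show "e n < s" "e n < T - t" by (simp_all add: d_def)
  qed
  have elim: "e \<longlonglongrightarrow> 0"
    unfolding e_def by (rule tendsto_mult_right_zero[OF LIMSEQ_Suc[OF LIMSEQ_inverse_real_of_nat]])
  define m where "m a n x = bump ((x - a) / e n) / Z / e n" for a n x
  define \<eta> where "\<eta> n x = S ((x - s) / e n) - S ((x - t) / e n)" for n x
  have dS: "((\<lambda>x. S ((x - a) / e n)) has_real_derivative m a n x) (at x)" for a n x
  proof -
    have "((\<lambda>x. (x - a) / e n) has_real_derivative 1 / e n) (at x)"
      using e0[of n] by (auto intro!: derivative_eq_intros)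
    from DERIV_chain2[OF S(1) this] show ?thesis by (simp add: m_def)
  qed
  have d\<eta>: "(\<eta> n has_real_derivative m s n x - m t n x) (at x)" for n x
    unfolding \<eta>_def by (intro DERIV_diff dS)
  have sm: "smooth (\<eta> n)" for n
  proof (rule smooth_if_derivative_flat_algebra[OF d\<eta>])
    have "flat_algebra (\<lambda>x. (1 / (Z * e n)) * bump ((1 / e n) * x + (- (s / e n)))
       + (- 1 / (Z * e n)) * bump ((1 / e n) * x + (- (t / e n))))"
      by (intro flat_algebra.add flat_algebra.mult flat_algebra.const flat_algebra_bump_affine)
    then show "flat_algebra (\<lambda>x. m s n x - m t n x)"
      by (simp add: m_def diff_divide_distrib)
  qed
  have cs: "compactly_supported_in T (\<eta> n)" for n
    unfolding compactly_supported_in_def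
  proof (rule exI[of _ "s - e n"], rule exI[of _ "t + e n"], intro conjI allI impI)
    fix x assume "x \<notin> {s - e n..t + e n}"
    then consider "x \<le> s - e n" "x \<le> t - e n" | "x \<ge> t + e n" "x \<ge> s + e n" using st by fastforce
    then show "\<eta> n x = 0"
    proof cases
      case 1
      then have "(x - s) / e n \<le> -1" "(x - t) / e n \<le> -1" using e0[of n] by (simp_all add: pos_divide_le_eq)
      then show ?thesis using S(2) by (simp add: \<eta>_def)
    next
      case 2
      then have "(x - s) / e n \<ge> 1" "(x - t) / e n \<ge> 1" using e0[of n] by (simp_all add: pos_le_divide_eq)
      then show ?thesis using S(3) by (simp add: \<eta>_def)
    qed
  qed (use elt[of n] in auto)
  have mc: "eventually (\<lambda>n. integrable ?M (\<lambda>x. m a n x * c x)) sequentially"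
    "(\<lambda>n. LINT x|?M. m a n x * c x) \<longlonglongrightarrow> c a" if a: "a \<in> {0<..<T}" for a
  proof -
    have ml: "\<exists>\<epsilon>0>0. \<forall>\<epsilon>. 0 < \<epsilon> \<longrightarrow> \<epsilon> < \<epsilon>0 \<longrightarrow>
      integrable ?M (\<lambda>x. bump ((x - a) / \<epsilon>) / Z / \<epsilon> * c x) \<and>
      \<bar>(LINT x|?M. bump ((x - a) / \<epsilon>) / Z / \<epsilon> * c x) - c a\<bar> \<le> \<delta>" if "\<delta> > 0" for \<delta>
    proof (rule mollifier_limit[OF S(1) _ _ _ _ _ c a that])
      show "continuous_on UNIV (\<lambda>x. bump x / Z)"
        using flat_algebra_continuous[OF flat_algebra_bump_affine[of 1 0]] Z
        by (intro continuous_intros continuous_at_imp_continuous_on) auto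
    qed (use S Z bump_nonneg bump_zero in auto)
    have ev: "\<forall>\<^sub>F n in sequentially. integrable ?M (\<lambda>x. m a n x * c x) \<and>
      \<bar>(LINT x|?M. m a n x * c x) - c a\<bar> \<le> \<delta>" if "\<delta> > 0" for \<delta>
    proof -
      from ml[OF that] obtain \<epsilon>0 where \<epsilon>0: "\<epsilon>0 > 0" "\<And>\<epsilon>. 0 < \<epsilon> \<Longrightarrow> \<epsilon> < \<epsilon>0 \<Longrightarrow>
        integrable ?M (\<lambda>x. bump ((x - a) / \<epsilon>) / Z / \<epsilon> * c x) \<and>
        \<bar>(LINT x|?M. bump ((x - a) / \<epsilon>) / Z / \<epsilon> * c x) - c a\<bar> \<le> \<delta>" by blast
      from order_tendstoD(2)[OF elim this(1)] show ?thesis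
      proof eventually_elim
        case (elim n)
        from \<epsilon>0(2)[OF e0 elim] show ?case by (simp only: m_def)
      qed
    qed
    show "eventually (\<lambda>n. integrable ?M (\<lambda>x. m a n x * c x)) sequentially"
      using ev[of 1] by (auto elim: eventually_mono)
    show "(\<lambda>n. LINT x|?M. m a n x * c x) \<longlonglongrightarrow> c a"
    proof (rule tendstoI)
      fix r :: real assume "r > 0"
      then have "\<forall>\<^sub>F n in sequentially. integrable ?M (\<lambda>x. m a n x * c x) \<and>
        \<bar>(LINT x|?M. m a n x * c x) - c a\<bar> \<le> r / 2" by (intro ev) simp
      then show "\<forall>\<^sub>F n in sequentially. dist (LINT x|?M. m a n x * c x) (c a) < r"
        by eventually_elim (use \<open>r > 0\<close> in \<open>simp add: dist_real_def\<close>)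
    qed
  qed
  have sT: "s \<in> {0<..<T}" "t \<in> {0<..<T}" using s st t by auto
  have "(\<lambda>n. (LINT x|?M. m s n x * c x) - (LINT x|?M. m t n x * c x)) \<longlonglongrightarrow> c s - c t"
    by (intro tendsto_diff mc(2) sT)
  moreover have "\<forall>\<^sub>F n in sequentially. (LINT x|?M. m s n x * c x) - (LINT x|?M. m t n x * c x)
      = - (LINT r|?M. \<eta> n r * A r)"
    using mc(1)[OF sT(1)] mc(1)[OF sT(2)]
  proof eventually_elim
    case (elim n)
    have "(LINT r|?M. deriv (\<eta> n) r * c r) = (LINT x|?M. m s n x * c x) - (LINT x|?M. m t n x * c x)"
      using elim by (simp add: DERIV_imp_deriv[OF d\<eta>] left_diff_distrib)
    with weak[OF sm cs, of n] show ?case by simp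
  qed
  ultimately have "(\<lambda>n. - (LINT r|?M. \<eta> n r * A r)) \<longlonglongrightarrow> c s - c t"
    by (rule Lim_transform_eventually)
  moreover have "(\<lambda>n. LINT r|?M. \<eta> n r * A r) \<longlonglongrightarrow> (LINT r|?M. indicator {s<..<t} r * A r)"
  proof (rule integral_dominated_convergence[where w = "\<lambda>r. \<bar>A r\<bar>"])
    have [measurable]: "A \<in> borel_measurable ?M" using A by auto
    have "continuous_on UNIV (\<eta> n)" for n
      using d\<eta> by (intro continuous_at_imp_continuous_on) (auto intro: DERIV_isCont)
    then have "\<eta> n \<in> borel_measurable ?M" for n
      by (intro measurable_time borel_measurable_continuous_onI)
    then show "(\<lambda>r. \<eta> n r * A r) \<in> borel_measurable ?M" for n by measurable
    have "(indicator {s<..<t} :: real \<Rightarrow> real) \<in> borel_measurable ?M"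
      by (intro measurable_time) measurable
    then show "(\<lambda>r. indicator {s<..<t} r * A r) \<in> borel_measurable ?M" by measurable
    show "integrable ?M (\<lambda>r. \<bar>A r\<bar>)" using A by simp
    have \<eta>1: "\<bar>\<eta> n r\<bar> \<le> 1" for n r
      using S(4,5)[of "(r - s) / e n"] S(4,5)[of "(r - t) / e n"] unfolding \<eta>_def by linarith
    show "AE r in ?M. norm (\<eta> n r * A r) \<le> \<bar>A r\<bar>" for n
      using \<eta>1 by (intro AE_I2) (simp add: abs_mult mult_left_le_one_le)
    have lims: "(\<lambda>n. S ((r - a) / e n)) \<longlonglongrightarrow> (if r > a then 1 else 0)" if "r \<noteq> a" for r a
    proof -
      have "\<forall>\<^sub>F n in sequentially. e n < \<bar>r - a\<bar>" using that by (intro order_tendstoD(2)[OF elim]) simp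
      then have "\<forall>\<^sub>F n in sequentially. S ((r - a) / e n) = (if r > a then 1 else 0)"
      proof eventually_elim
        case (elim n)
        show ?case
        proof (cases "r > a")
          case True
          then have "(r - a) / e n \<ge> 1" using elim e0[of n] by (simp add: pos_le_divide_eq)
          then show ?thesis using True S(3) by simp
        next
          case False
          then have "(r - a) / e n \<le> -1" using elim e0[of n] that by (simp add: pos_divide_le_eq)
          then show ?thesis using False S(2) by simp
        qed
      qed
      then show ?thesis by (rule tendsto_eventually)
    qed
    \<comment> \<open>At r = s and r = t the plateaus involve S 0, whose value is not
      prescribed.\<close>
    have "AE r in lborel. r \<noteq> s \<and> r \<noteq> t"
      using AE_lborel_singleton[of s] AE_lborel_singleton[of t] by eventually_elim auto
    then have "AE r in ?M. r \<noteq> s \<and> r \<noteq> t"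
      unfolding time_measure_def by (subst AE_restrict_space_iff) auto
    then show "AE r in ?M. (\<lambda>n. \<eta> n r * A r) \<longlonglongrightarrow> indicator {s<..<t} r * A r"
    proof eventually_elim
      case (elim r)
      have "(\<lambda>n. \<eta> n r * A r) \<longlonglongrightarrow> ((if r > s then 1 else 0) - (if r > t then 1 else 0)) * A r"
        unfolding \<eta>_def by (intro tendsto_intros lims) (use elim in auto)
      also have "((if r > s then 1 else 0) - (if r > t then 1 else 0)) * A r = indicator {s<..<t} r * A r"
        using elim st by (auto simp: indicator_def)
      finally show ?case .
    qed
  qed
  ultimately show ?thesis
    using LIMSEQ_unique[OF tendsto_minus] by fastforce
qed

text \<open>The chain rule for the square of an integral function, by Fubini: the square of the
  integral of a over (s, t) is twice the integral of a(r) a(u) over u < r, whose inner integral is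
  a(r) (c(r) - c(s)).\<close>

lemma increment_power2:
  fixes c A :: "real \<Rightarrow> real"
  assumes A: "integrable (time_measure T) A"
    and inc: "\<And>s t. 0 < s \<Longrightarrow> s < t \<Longrightarrow> t < T \<Longrightarrow> c t - c s = (LINT r|time_measure T. indicator {s<..<t} r * A r)"
    and s: "0 < s" and st: "s < t" and t: "t < T"
  shows "(c t)\<^sup>2 - (c s)\<^sup>2 = 2 * (LINT r|time_measure T. indicator {s<..<t} r * (c r * A r))"
    and "integrable (time_measure T) (\<lambda>r. indicator {s<..<t} r * (c r * A r))"
proof -
  let ?M = "time_measure T"
  interpret pair_sigma_finite ?M ?M
    by (intro pair_sigma_finite.intro time.sigma_finite_measure_axioms)
  define a where "a r = indicator {s<..<t} r * A r" for r
  have ind: "(indicator B :: real \<Rightarrow> real) \<in> borel_measurable ?M" if "B \<in> sets borel" for B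
    using that by (intro measurable_time) simp
  have Am[measurable]: "A \<in> borel_measurable ?M" using A by auto
  have am[measurable]: "a \<in> borel_measurable ?M"
    unfolding a_def by (intro borel_measurable_times ind Am) auto
  have ai: "integrable ?M a"
    by (rule Bochner_Integration.integrable_bound[OF A am]) (auto simp: a_def indicator_def)
  \<comment> \<open>The product a(r) a(u) restricted to the triangle u < r.\<close>
  define q where "q z = (if snd z < fst z then a (fst z) * a (snd z) else 0)" for z :: "real \<times> real"
  have idm[measurable]: "(\<lambda>x. x) \<in> borel_measurable ?M" by (rule measurable_time) simp
  have fsm: "(\<lambda>z. fst z) \<in> borel_measurable (?M \<Otimes>\<^sub>M ?M)" "(\<lambda>z. snd z) \<in> borel_measurable (?M \<Otimes>\<^sub>M ?M)"
    by (rule measurable_compose[OF measurable_fst idm], rule measurable_compose[OF measurable_snd idm])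
  note fsm[measurable]
  have qm: "q \<in> borel_measurable (?M \<Otimes>\<^sub>M ?M)"
    unfolding q_def by (intro measurable_If borel_measurable_times borel_measurable_const
        measurable_compose[OF measurable_fst am] measurable_compose[OF measurable_snd am]
        borel_measurable_less fsm)
  have qi: "integrable (?M \<Otimes>\<^sub>M ?M) q"
  proof (rule Bochner_Integration.integrable_bound[OF _ qm])
    show "integrable (?M \<Otimes>\<^sub>M ?M) (\<lambda>(x, y). a x * a y)"
      by (rule Fubini_integrable) (use ai in \<open>auto simp: abs_mult\<close>)
  qed (auto simp: q_def)
  have inner: "(LINT u|?M. q (r, u)) = a r * (c r - c s)" for r
  proof (cases "r \<in> {s<..<t}")
    case True
    have "(LINT u|?M. q (r, u)) = (LINT u|?M. a r * (indicator {s<..<r} u * A u))"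
      using True by (intro Bochner_Integration.integral_cong) (auto simp: q_def a_def indicator_def)
    also have "\<dots> = a r * (c r - c s)"
      using inc[of s r] True s t by simp
    finally show ?thesis .
  next
    case False
    then have "a r = 0" by (simp add: a_def)
    then have "q (r, u) = 0" for u by (simp add: q_def)
    with \<open>a r = 0\<close> show ?thesis by simp
  qed
  have swap: "(LINT r|?M. LINT u|?M. q (u, r)) = (LINT r|?M. LINT u|?M. q (r, u))"
    using Fubini_integral[of "\<lambda>x y. q (x, y)"] qi by simp
  have i1: "integrable ?M (\<lambda>r. LINT u|?M. q (r, u))" using integrable_fst'[OF qi] .
  have i2: "integrable ?M (\<lambda>r. LINT u|?M. q (u, r))" using integrable_snd[of "\<lambda>x y. q (x, y)"] qi by simp
  have "(LINT r|?M. a r)\<^sup>2 = (LINT r|?M. a r * (LINT u|?M. a u))" by (simp add: power2_eq_square)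
  also have "\<dots> = (LINT r|?M. (LINT u|?M. q (r, u)) + (LINT u|?M. q (u, r)))"
  proof (rule integral_cong_AE)
    show "(\<lambda>r. a r * (LINT u|?M. a u)) \<in> borel_measurable ?M" by (intro borel_measurable_times am borel_measurable_const)
    show "(\<lambda>r. (LINT u|?M. q (r, u)) + (LINT u|?M. q (u, r))) \<in> borel_measurable ?M"
      by (rule borel_measurable_integrable) (intro Bochner_Integration.integrable_add i1 i2)
    have "AE r in ?M. integrable ?M (\<lambda>u. q (r, u)) \<and> integrable ?M (\<lambda>u. q (u, r))"
    proof (rule AE_conjI)
      show "AE r in ?M. integrable ?M (\<lambda>u. q (r, u))" using AE_integrable_fst'[OF qi] .
      show "AE r in ?M. integrable ?M (\<lambda>u. q (u, r))" using AE_integrable_snd[of "\<lambda>x y. q (x, y)"] qi by simp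
    qed
    then show "AE r in ?M. a r * (LINT u|?M. a u) = (LINT u|?M. q (r, u)) + (LINT u|?M. q (u, r))"
    proof eventually_elim
      case (elim r)
      have "a r * (LINT u|?M. a u) = (LINT u|?M. a r * a u)" by simp
      also have "\<dots> = (LINT u|?M. q (r, u) + q (u, r))"
      proof (rule integral_cong_AE)
        show "(\<lambda>u. a r * a u) \<in> borel_measurable ?M" by (intro borel_measurable_times am borel_measurable_const)
        show "(\<lambda>u. q (r, u) + q (u, r)) \<in> borel_measurable ?M"
          by (rule borel_measurable_integrable) (use elim in \<open>intro Bochner_Integration.integrable_add; blast\<close>)
        \<comment> \<open>Off the diagonal exactly one of the two triangles contributes.\<close>
        have "AE u in ?M. u \<noteq> r"
          unfolding time_measure_def by (subst AE_restrict_space_iff) (use AE_lborel_singleton[of r] in auto)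
        then show "AE u in ?M. a r * a u = q (r, u) + q (u, r)"
          by eventually_elim (auto simp: q_def)
      qed
      also have "\<dots> = (LINT u|?M. q (r, u)) + (LINT u|?M. q (u, r))"
        using elim by simp
      finally show ?case .
    qed
  qed
  also have "\<dots> = 2 * (LINT r|?M. a r * (c r - c s))"
    using i1 i2 swap by (simp add: inner)
  finally have sq: "(c t - c s)\<^sup>2 = 2 * (LINT r|?M. a r * (c r - c s))"
    using inc[OF s st t] by (simp add: a_def)
  have "integrable ?M (\<lambda>r. a r * (c r - c s) + c s * a r)"
    using i1 ai by (simp add: inner)
  then have ii: "integrable ?M (\<lambda>r. a r * c r)" by (simp add: algebra_simps)
  then show "integrable ?M (\<lambda>r. indicator {s<..<t} r * (c r * A r))"
    by (simp add: a_def mult_ac)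
  have "(LINT r|?M. a r * (c r - c s)) = (LINT r|?M. a r * c r) - c s * (c t - c s)"
  proof -
    have "(LINT r|?M. a r) = c t - c s" using inc[OF s st t] by (simp add: a_def)
    then show ?thesis using ii ai by (simp add: right_diff_distrib mult.commute)
  qed
  with sq have "(c t - c s)\<^sup>2 + 2 * c s * (c t - c s) = 2 * (LINT r|?M. a r * c r)" by simp
  moreover have "(c t)\<^sup>2 - (c s)\<^sup>2 = (c t - c s)\<^sup>2 + 2 * c s * (c t - c s)"
    by (simp add: power2_eq_square algebra_simps)
  ultimately show "(c t)\<^sup>2 - (c s)\<^sup>2 = 2 * (LINT r|?M. indicator {s<..<t} r * (c r * A r))"
    by (simp add: a_def mult_ac)
qed

subsection \<open>Space-time integrability and the flux\<close>

abbreviation cyl :: "real \<Rightarrow> (real \<times> point) measure" where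
  "cyl T \<equiv> time_measure T \<Otimes>\<^sub>M cell"

lemma cyl_eq: "cyl T = restrict_space lborel ({0<..<T} \<times> Upsilon)"
  unfolding time_measure_def cell_def by (rule pair_restrict_space_lborel) auto

lemma cyl_borel: "{0<..<T::real} \<times> Upsilon \<in> sets borel"
  unfolding Upsilon_def Omega_def by (intro borel_open open_Times) auto

lemma integral_cyl: "(LINT z:{0<..<T} \<times> Upsilon|lborel. g z) = (LINT z|cyl T. g z)" for g :: "real \<times> point \<Rightarrow> real"
  unfolding cyl_eq set_lebesgue_integral_def by (subst integral_restrict_space) (auto simp: cyl_borel)

lemma finite_measure_cyl: "finite_measure (cyl T)"
  by (intro finite_measure_pair_measure finite_measure_time_measure finite_measure_cell)

interpretation cyl: finite_measure "cyl T" for T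
  by (rule finite_measure_cyl)

interpretation cylp: pair_sigma_finite "time_measure T" cell for T
  by (intro pair_sigma_finite.intro time.sigma_finite_measure_axioms cell.sigma_finite_measure_axioms)

lemma jointly_measurable_cyl:
  assumes "jointly_measurable T u"
  shows "(\<lambda>z. u (fst z) (snd z)) \<in> borel_measurable (cyl T)"
proof -
  have "(\<lambda>z. indicat_real ({0<..<T} \<times> UNIV) z *\<^sub>R (case z of (t, \<xi>) \<Rightarrow> u t \<xi>)) \<in> borel_measurable lborel"
    using assms by (simp add: jointly_measurable_def set_borel_measurable_def)
  from measurable_restrict_space1[OF this]
  have "(\<lambda>z. indicat_real ({0<..<T} \<times> UNIV) z *\<^sub>R (case z of (t, \<xi>) \<Rightarrow> u t \<xi>)) \<in> borel_measurable (cyl T)"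
    unfolding cyl_eq .
  then show ?thesis
    by (rule measurable_cong[THEN iffD1, rotated]) (auto simp: cyl_eq space_restrict_space)
qed

lemma AE_time: "(AE t in time_measure T. P t) \<longleftrightarrow> (AE t in lebesgue. t \<in> {0<..<T} \<longrightarrow> P t)"
  unfolding time_measure_def AE_completion_iff by (subst AE_restrict_space_iff) auto

lemma AE_pair_fstI:
  assumes "sigma_finite_measure N" "AE x in M. P x"
  shows "AE z in M \<Otimes>\<^sub>M N. P (fst z)"
proof -
  interpret sigma_finite_measure N by fact
  from assms(2) obtain X where X: "X \<in> null_sets M" "{x \<in> space M. \<not> P x} \<subseteq> X"
    by (auto simp: eventually_ae_filter)
  have "X \<times> space N \<in> null_sets (M \<Otimes>\<^sub>M N)"
    using X(1) by (auto simp: null_sets_def emeasure_pair_measure_Times)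
  then show ?thesis
    by (rule AE_I') (use X(2) in \<open>auto simp: space_pair_measure\<close>)
qed

lemma theta_marginal_circ: "theta_marginal g x = (LINT \<theta>|circ. g (x, \<theta>))"
  by (simp add: theta_marginal_def integral_circ)

text \<open>Df is carried along as data because it is jointly measurable; choosing
  \<open>wgrad (f t)\<close> separately at each time would guarantee no measurability in t.\<close>

locale energy_space =
  fixes T :: real and f :: "real \<Rightarrow> point \<Rightarrow> real" and Df :: "real \<Rightarrow> point \<Rightarrow> point"
  assumes f_H1: "f \<in> bochner_L2 H1_per H1_norm T" and f_meas: "jointly_measurable T f"
    and f_grad: "space_gradient T f Df"
begin

lemma weak_gradient_AE: "AE t in time_measure T. weak_gradient (f t) (Df t)"
  using f_grad by (simp add: space_gradient_def AE_time)

lemma H1_per_AE: "AE t in time_measure T. f t \<in> H1_per"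
  using f_H1 by (simp add: bochner_L2_def AE_time)

lemma nn_integral_H1_norm: "(\<integral>\<^sup>+t. ennreal ((H1_norm (f t))\<^sup>2) \<partial>time_measure T) < \<infinity>"
proof -
  have "(\<integral>\<^sup>+t\<in>{0<..<T}. ennreal ((H1_norm (f t))\<^sup>2) \<partial>lborel) < \<infinity>"
    using f_H1 by (simp add: bochner_L2_def nn_integral_completion)
  then show ?thesis
    unfolding time_measure_def by (subst nn_integral_restrict_space) auto
qed

text \<open>Tonelli: the squared L2 norm of each time slice of f and of Df is at most the squared
  \<open>H1_norm\<close>, whose time integral is finite by the Bochner condition.\<close>

lemma square_integrable_cyl:
  "square_integrable (cyl T) (\<lambda>z. f (fst z) (snd z))"
  "b \<in> Basis \<Longrightarrow> square_integrable (cyl T) (\<lambda>z. Df (fst z) (snd z) \<bullet> b)"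
proof -
  note fm = jointly_measurable_cyl[OF f_meas]
  have "jointly_measurable T Df" using f_grad by (simp add: space_gradient_def)
  note Dm = jointly_measurable_cyl[OF this]
  \<comment> \<open>Stated for a general u in order to serve f and Df alike.\<close>
  have bd: "integrable (cyl T) (\<lambda>z. (norm (u (fst z) (snd z)))\<^sup>2)"
    if u: "(\<lambda>z. u (fst z) (snd z)) \<in> borel_measurable (cyl T)"
      and AE: "AE t in time_measure T. u t \<in> L2_per \<and> (L2_norm (u t))\<^sup>2 \<le> (H1_norm (f t))\<^sup>2"
    for u :: "real \<Rightarrow> point \<Rightarrow> 'z::euclidean_space"
  proof (rule integrableI_bounded)
    show "(\<lambda>z. (norm (u (fst z) (snd z)))\<^sup>2) \<in> borel_measurable (cyl T)" using u by measurable
    have "(\<integral>\<^sup>+ z. ennreal (norm ((norm (u (fst z) (snd z)))\<^sup>2)) \<partial>cyl T)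
        = (\<integral>\<^sup>+ t. \<integral>\<^sup>+ \<xi>. ennreal ((norm (u t \<xi>))\<^sup>2) \<partial>cell \<partial>time_measure T)"
      using u by (subst cell.nn_integral_fst[symmetric]) auto
    also have "\<dots> \<le> (\<integral>\<^sup>+t. ennreal ((H1_norm (f t))\<^sup>2) \<partial>time_measure T)"
    proof (rule nn_integral_mono_AE)
      show "AE t in time_measure T. (\<integral>\<^sup>+ \<xi>. ennreal ((norm (u t \<xi>))\<^sup>2) \<partial>cell) \<le> ennreal ((H1_norm (f t))\<^sup>2)"
        using AE
      proof eventually_elim
        case (elim t)
        have "(\<integral>\<^sup>+ \<xi>. ennreal ((norm (u t \<xi>))\<^sup>2) \<partial>cell) = ennreal (LINT \<xi>|cell. (norm (u t \<xi>))\<^sup>2)"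
          using elim by (intro nn_integral_eq_integral L2_per_integrable_norm) auto
        also have "\<dots> \<le> ennreal ((H1_norm (f t))\<^sup>2)"
          using elim by (intro ennreal_leI) (simp add: L2_norm_power2)
        finally show ?case .
      qed
    qed
    also note nn_integral_H1_norm
    finally show "(\<integral>\<^sup>+ z. ennreal (norm ((norm (u (fst z) (snd z)))\<^sup>2)) \<partial>cyl T) < \<infinity>" .
  qed
  have AE: "AE t in time_measure T. (f t \<in> L2_per \<and> (L2_norm (f t))\<^sup>2 \<le> (H1_norm (f t))\<^sup>2) \<and>
    (Df t \<in> L2_per \<and> (L2_norm (Df t))\<^sup>2 \<le> (H1_norm (f t))\<^sup>2)"
    using H1_per_AE weak_gradient_AE
  proof eventually_elim
    case (elim t)
    have "(H1_norm (f t))\<^sup>2 = (L2_norm (f t))\<^sup>2 + (L2_norm (Df t))\<^sup>2"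
      using L2_norm_wgrad[OF elim(2)] by (simp add: H1_norm_def)
    then show ?case using elim by (auto simp: H1_per_def weak_gradient_def)
  qed
  have "integrable (cyl T) (\<lambda>z. (norm (f (fst z) (snd z)))\<^sup>2)"
    by (rule bd[OF fm]) (use AE in eventually_elim, blast)
  then show "square_integrable (cyl T) (\<lambda>z. f (fst z) (snd z))"
    using fm by (simp add: square_integrable_def)
  have D: "integrable (cyl T) (\<lambda>z. (norm (Df (fst z) (snd z)))\<^sup>2)"
    by (rule bd[OF Dm]) (use AE in eventually_elim, blast)
  show "square_integrable (cyl T) (\<lambda>z. Df (fst z) (snd z) \<bullet> b)" if "b \<in> Basis"
  proof (rule square_integrable_bound[OF _ D])
    show "(\<lambda>z. Df (fst z) (snd z) \<bullet> b) \<in> borel_measurable (cyl T)"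
      by (intro borel_measurable_inner Dm borel_measurable_const)
    show "AE z in cyl T. (Df (fst z) (snd z) \<bullet> b)\<^sup>2 \<le> (norm (Df (fst z) (snd z)))\<^sup>2"
      using that by (intro AE_I2 inner_power2_le_norm_power2) simp
  qed
qed

text \<open>Reassociating the product puts \<theta> last, where integration over a parameter
  preserves measurability; the result is pulled back to the cylinder as a function constant in
  \<theta>.\<close>

lemma marginal_measurable:
  "(\<lambda>z. theta_marginal (f (fst z)) (fst (snd z))) \<in> borel_measurable (cyl T)"
proof -
  let ?P = "time_measure T \<Otimes>\<^sub>M (circ \<Otimes>\<^sub>M circ)"
  have "(\<lambda>y. (fst (fst y), (snd (fst y), snd y))) \<in> ?P \<Otimes>\<^sub>M circ \<rightarrow>\<^sub>M cyl T"
    unfolding cell_eq by measurable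
  from measurable_compose[OF this jointly_measurable_cyl[OF f_meas]]
  have "(\<lambda>(y, \<theta>). f (fst y) (snd y, \<theta>)) \<in> borel_measurable (?P \<Otimes>\<^sub>M circ)"
    by (simp add: split_beta')
  then have "(\<lambda>y. LINT \<theta>|circ. f (fst y) (snd y, \<theta>)) \<in> borel_measurable ?P"
    by (rule circ.borel_measurable_lebesgue_integral)
  moreover have "(\<lambda>z. (fst z, fst (snd z))) \<in> cyl T \<rightarrow>\<^sub>M ?P"
    unfolding cell_eq by measurable
  ultimately have "(\<lambda>z. LINT \<theta>|circ. f (fst (fst z, fst (snd z))) (snd (fst z, fst (snd z)), \<theta>)) \<in> borel_measurable (cyl T)"
    by (rule measurable_compose[rotated])
  then show ?thesis by (simp only: theta_marginal_circ fst_conv snd_conv)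
qed

end

locale flux_space = energy_space +
  fixes Pe De :: real
  assumes marginal: "AE (t, x) in lborel. (t, x) \<in> {0<..<T} \<times> Omega \<longrightarrow>
        0 \<le> theta_marginal (f t) x \<and> theta_marginal (f t) x \<le> 1"
begin

definition flux :: "real \<Rightarrow> point \<Rightarrow> point" where
  "flux t \<xi> = ((Pe * (1 - theta_marginal (f t) (fst \<xi>)) * f t \<xi>) *\<^sub>R evec (snd \<xi>) - De *\<^sub>R fst (Df t \<xi>), - snd (Df t \<xi>))"

lemma marginal_AE_time:
  "AE t in time_measure T. AE \<xi> in cell. 0 \<le> theta_marginal (f t) (fst \<xi>) \<and> theta_marginal (f t) (fst \<xi>) \<le> 1"
proof -
  let ?P = "time_measure T \<Otimes>\<^sub>M (circ \<Otimes>\<^sub>M circ)"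
  interpret P: pair_sigma_finite "time_measure T" "circ \<Otimes>\<^sub>M circ"
    by (intro pair_sigma_finite.intro time.sigma_finite_measure_axioms plane.sigma_finite_measure_axioms)
  have eq: "?P = restrict_space lborel ({0<..<T} \<times> Omega)"
    unfolding circ_pair_eq time_measure_def by (rule pair_restrict_space_lborel) auto
  have "{0<..<T} \<times> Omega \<in> sets borel" unfolding Omega_def by (intro borel_open open_Times) auto
  then have "AE y in ?P. 0 \<le> theta_marginal (f (fst y)) (snd y) \<and> theta_marginal (f (fst y)) (snd y) \<le> 1"
    unfolding eq using marginal by (subst AE_restrict_space_iff) (auto simp: split_beta')
  from P.AE_pair[OF this] show ?thesis
  proof eventually_elim
    case (elim t)
    then show ?case
      unfolding cell_eq fst_conv snd_conv by (rule AE_pair_fstI[OF circ.sigma_finite_measure_axioms])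
  qed
qed

lemma marginal_AE_cyl:
  "AE z in cyl T. 0 \<le> theta_marginal (f (fst z)) (fst (snd z)) \<and> theta_marginal (f (fst z)) (fst (snd z)) \<le> 1"
proof (rule cylp.AE_pair_measure)
  note [measurable] = marginal_measurable
  show "{z \<in> space (cyl T). 0 \<le> theta_marginal (f (fst z)) (fst (snd z)) \<and> theta_marginal (f (fst z)) (fst (snd z)) \<le> 1} \<in> sets (cyl T)"
    by measurable
qed (use marginal_AE_time in simp)

text \<open>The bounds on the marginal are what makes the quadratic transport term an L2 function on
  the cylinder.\<close>

lemma crowded_square_integrable:
  "square_integrable (cyl T) (\<lambda>z. (1 - theta_marginal (f (fst z)) (fst (snd z))) * f (fst z) (snd z))"
proof (rule square_integrable_bounded_mult[OF square_integrable_cyl(1), where B = 1])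
  show "(\<lambda>z. 1 - theta_marginal (f (fst z)) (fst (snd z))) \<in> borel_measurable (cyl T)"
    by (intro borel_measurable_diff borel_measurable_const marginal_measurable)
  show "AE z in cyl T. \<bar>1 - theta_marginal (f (fst z)) (fst (snd z))\<bar> \<le> 1"
    using marginal_AE_cyl by eventually_elim linarith
qed

lemma evec_measurable: "(\<lambda>z. evec (snd (snd z)) \<bullet> v) \<in> borel_measurable (cyl T)"
proof -
  have "continuous_on UNIV (\<lambda>z::real \<times> point. evec (snd (snd z)) \<bullet> v)"
    unfolding evec_def by (intro continuous_intros)
  then have "(\<lambda>z::real \<times> point. evec (snd (snd z)) \<bullet> v) \<in> borel_measurable lborel"
    using borel_measurable_continuous_onI by simp
  then show ?thesis unfolding cyl_eq by (rule measurable_restrict_space1)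
qed

lemma evec_inner_Basis: "b \<in> (Basis :: point set) \<Longrightarrow> \<bar>evec \<theta> \<bullet> fst b\<bar> \<le> 1"
  by (auto simp: point_Basis evec_def)

text \<open>\<open>snd b = 0\<close> singles out the spatial directions, which carry De; in the
  angular direction \<open>fst b\<close> is 0 and the drift disappears.\<close>

lemma flux_inner:
  "b \<in> Basis \<Longrightarrow> flux t \<xi> \<bullet> b = (Pe * (evec (snd \<xi>) \<bullet> fst b)) * ((1 - theta_marginal (f t) (fst \<xi>)) * f t \<xi>)
     - (if snd b = 0 then De else 1) * (Df t \<xi> \<bullet> b)"
  by (auto simp: point_Basis flux_def evec_def inner_prod_def)

lemma flux_square_integrable:
  assumes b: "b \<in> Basis"
  shows "square_integrable (cyl T) (\<lambda>z. flux (fst z) (snd z) \<bullet> b)"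
  unfolding flux_inner[OF b]
proof (intro square_integrable_diff square_integrable_cmult square_integrable_cyl(2) b
    square_integrable_bounded_mult[OF crowded_square_integrable, where B = "\<bar>Pe\<bar>"])
  show "(\<lambda>z. Pe * (evec (snd (snd z)) \<bullet> fst b)) \<in> borel_measurable (cyl T)"
    using evec_measurable by (intro borel_measurable_times borel_measurable_const)
  show "AE z in cyl T. \<bar>Pe * (evec (snd (snd z)) \<bullet> fst b)\<bar> \<le> \<bar>Pe\<bar>"
    using evec_inner_Basis[OF b] by (intro AE_I2) (simp add: abs_mult mult_left_le)
qed

end

subsection \<open>The equation for a single mode\<close>

text \<open>As \<open>lebesgue\<close> is complete, g and h are measurable together; if neither is,
  both integrals are 0 by convention. This serves the dual pairing viewed as a function of
  time.\<close>

lemma integral_lebesgue_cong_AE: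
  fixes g h :: "real \<Rightarrow> real"
  assumes "AE x in lebesgue. g x = h x"
  shows "integral\<^sup>L lebesgue g = integral\<^sup>L lebesgue h"
proof (cases "g \<in> borel_measurable lebesgue")
  case True
  show ?thesis by (rule integral_cong_AE[OF True borel_measurable_AE[OF True assms] assms])
next
  case False
  moreover have "h \<notin> borel_measurable lebesgue"
  proof
    assume "h \<in> borel_measurable lebesgue"
    then have "g \<in> borel_measurable lebesgue"
      by (rule borel_measurable_AE) (use assms in \<open>auto elim: eventually_mono\<close>)
    with False show False ..
  qed
  ultimately show ?thesis by (metis borel_measurable_integrable not_integrable_integral_eq)
qed

lemma integral_lebesgue_time:
  fixes g :: "real \<Rightarrow> real"
  assumes "g \<in> borel_measurable (time_measure T)"
  shows "(LINT t:{0<..<T}|lebesgue. g t) = (LINT t|time_measure T. g t)"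
proof -
  have "(\<lambda>t. indicator {0<..<T} t *\<^sub>R g t) \<in> borel_measurable lborel"
    using assms unfolding time_measure_def by (subst (asm) borel_measurable_restrict_space_iff) auto
  then show ?thesis
    unfolding integral_time set_lebesgue_integral_def by (rule integral_completion)
qed

lemma smooth_real_derivative:
  fixes \<eta> :: "real \<Rightarrow> real"
  assumes "smooth \<eta>"
  shows "(\<eta> has_real_derivative deriv \<eta> x) (at x)" "continuous_on UNIV (deriv \<eta>)" "continuous_on UNIV \<eta>"
proof -
  have d: "(\<eta> has_real_derivative deriv \<eta> x) (at x)" for x
    using smooth_differentiable(1)[OF assms] by (simp add: DERIV_deriv_iff_real_differentiable)
  then show "(\<eta> has_real_derivative deriv \<eta> x) (at x)" .
  have "deriv \<eta> differentiable at x" for x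
    using smooth_differentiable(2)[OF assms, of 1 x] partial_deriv_real[OF d] by simp
  then show "continuous_on UNIV (deriv \<eta>)"
    by (intro continuous_at_imp_continuous_on) (auto intro: differentiable_imp_continuous_within)
  show "continuous_on UNIV \<eta>"
    by (intro continuous_at_imp_continuous_on ballI DERIV_isCont[OF d])
qed

lemma compactly_supported_bounded:
  assumes "continuous_on UNIV \<eta>" "compactly_supported_in T \<eta>"
  obtains B where "\<And>t. \<bar>\<eta> t\<bar> \<le> B"
proof -
  from assms(2) obtain a b where ab: "\<And>t. t \<notin> {a..b} \<Longrightarrow> \<eta> t = 0"
    by (auto simp: compactly_supported_in_def)
  have "compact (\<eta> ` {a..b})"
    by (intro compact_continuous_image continuous_on_subset[OF assms(1)]) auto
  from compact_imp_bounded[OF this] obtain B where B: "\<forall>y\<in>\<eta> ` {a..b}. norm y \<le> B"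
    unfolding bounded_iff ..
  have "\<bar>\<eta> t\<bar> \<le> \<bar>B\<bar>" for t
  proof (cases "t \<in> {a..b}")
    case True
    with B have "\<bar>\<eta> t\<bar> \<le> B" by simp
    then show ?thesis by linarith
  qed (simp add: ab)
  then show thesis by (rule that)
qed

lemma cyl_measurable_snd: "g \<in> borel_measurable borel \<Longrightarrow> (\<lambda>z. g (snd z)) \<in> borel_measurable (cyl T)"
  by (rule measurable_compose[OF measurable_snd measurable_cell])

lemma cyl_measurable_fst: "g \<in> borel_measurable borel \<Longrightarrow> (\<lambda>z. g (fst z)) \<in> borel_measurable (cyl T)"
  by (rule measurable_compose[OF measurable_fst measurable_time])

lemma mode_grad_inner_bound: "b \<in> Basis \<Longrightarrow> \<bar>mode_grad k \<xi> \<bullet> b\<bar> \<le> \<bar>freq b k\<bar>"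
  using mode_abs_le_1[of "flip b k" \<xi>] by (simp add: mode_grad_inner abs_mult mult_left_le)

lemma mode_grad_square_integrable:
  assumes "b \<in> Basis" "continuous_on UNIV \<eta>" "\<And>t. \<bar>\<eta> t\<bar> \<le> B"
  shows "square_integrable (cyl T) (\<lambda>z. \<eta> (fst z) * (mode_grad k (snd z) \<bullet> b))"
proof (rule cyl.square_integrable_bounded[where B = "B * \<bar>freq b k\<bar>"])
  have "(\<lambda>\<xi>. mode_grad k \<xi> \<bullet> b) \<in> borel_measurable borel"
    by (intro borel_measurable_continuous_onI continuous_intros continuous_mode_grad)
  from cyl_measurable_snd[OF this]
  show "(\<lambda>z. \<eta> (fst z) * (mode_grad k (snd z) \<bullet> b)) \<in> borel_measurable (cyl T)"
    by (intro borel_measurable_times cyl_measurable_fst borel_measurable_continuous_onI assms(2))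
  have "0 \<le> B" using assms(3)[of 0] by linarith
  then show "AE z in cyl T. \<bar>\<eta> (fst z) * (mode_grad k (snd z) \<bullet> b)\<bar> \<le> B * \<bar>freq b k\<bar>"
    unfolding abs_mult by (intro AE_I2 mult_mono assms(3) mode_grad_inner_bound[OF assms(1)]) auto
qed

context flux_space
begin

lemma flux_mode_integrable:
  assumes "continuous_on UNIV \<eta>" "\<And>t. \<bar>\<eta> t\<bar> \<le> B"
  shows "integrable (cyl T) (\<lambda>z. \<eta> (fst z) * (flux (fst z) (snd z) \<bullet> mode_grad k (snd z)))"
proof -
  have "integrable (cyl T) (\<lambda>z. \<Sum>b\<in>Basis. (flux (fst z) (snd z) \<bullet> b) * (\<eta> (fst z) * (mode_grad k (snd z) \<bullet> b)))"
    using assms by (intro Bochner_Integration.integrable_sum square_integrable_mult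
        flux_square_integrable mode_grad_square_integrable)
  moreover have "(\<Sum>b\<in>Basis. (flux (fst z) (snd z) \<bullet> b) * (\<eta> (fst z) * (mode_grad k (snd z) \<bullet> b)))
      = \<eta> (fst z) * (flux (fst z) (snd z) \<bullet> mode_grad k (snd z))" for z
    by (subst euclidean_inner) (simp add: sum_distrib_left mult_ac)
  ultimately show ?thesis by (simp only:)
qed

lemma mode_action_integrable:
  "integrable (time_measure T) (\<lambda>t. LINT \<xi>|cell. flux t \<xi> \<bullet> mode_grad k \<xi>)"
  using cylp.integrable_fst'[OF flux_mode_integrable[of "\<lambda>_. 1" 1 k]] by simp

text \<open>F is eliminated between two descriptions of the integral of \<eta>(t)
  \<open>F t (mode k)\<close>: the weak formulation tested with \<eta> times the mode, and the
  definition of the distributional time derivative.\<close>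

lemma mode_equation:
  assumes wtd: "weak_time_derivative T f F"
    and weak: "\<And>\<phi> D\<phi>. \<phi> \<in> bochner_L2 H1_per H1_norm T \<Longrightarrow> space_gradient T \<phi> D\<phi> \<Longrightarrow>
           (LINT t:{0<..<T}|lebesgue. F t (\<phi> t)) =
             Pe * (LINT (t, x, \<theta>):{0<..<T} \<times> Upsilon|lborel.
                     (1 - theta_marginal (f t) x) * f t (x, \<theta>) * (evec \<theta> \<bullet> fst (D\<phi> t (x, \<theta>))))
             - De * (LINT (t, \<xi>):{0<..<T} \<times> Upsilon|lborel. fst (Df t \<xi>) \<bullet> fst (D\<phi> t \<xi>))
             - (LINT (t, \<xi>):{0<..<T} \<times> Upsilon|lborel. snd (Df t \<xi>) * snd (D\<phi> t \<xi>))"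
    and \<eta>: "smooth \<eta>" "compactly_supported_in T \<eta>"
  shows "(LINT t|time_measure T. deriv \<eta> t * (LINT \<xi>|cell. f t \<xi> * mode k \<xi>)) =
    - (LINT t|time_measure T. \<eta> t * (LINT \<xi>|cell. flux t \<xi> \<bullet> mode_grad k \<xi>))"
proof -
  note \<eta>c = smooth_real_derivative(2,3)[OF \<eta>(1)]
  obtain B where B: "\<And>t. \<bar>\<eta> t\<bar> \<le> B" using compactly_supported_bounded[OF \<eta>c(2) \<eta>(2)] by metis
  define w where "w b z = \<eta> (fst z) * (mode_grad k (snd z) \<bullet> b)" for b :: point and z :: "real \<times> point"
  define cr where "cr z = (1 - theta_marginal (f (fst z)) (fst (snd z))) * f (fst z) (snd z)" for z
  have w: "square_integrable (cyl T) (w b)" if "b \<in> Basis" for b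
    unfolding w_def[abs_def] by (rule mode_grad_square_integrable[OF that \<eta>c(2) B])
  have cr: "square_integrable (cyl T) cr" using crowded_square_integrable by (simp add: cr_def[abs_def])
  let ?b1 = "((1, 0), 0) :: point" and ?b2 = "((0, 1), 0) :: point" and ?b3 = "((0, 0), 1) :: point"
  have bB: "?b1 \<in> Basis" "?b2 \<in> Basis" "?b3 \<in> Basis" by (auto simp: point_Basis)
  \<comment> \<open>The three integrands of the weak formulation in coordinates. Each must be
    integrable by itself before they can be merged into one integral of the flux.\<close>
  define i1 where "i1 z = cr z * ((evec (snd (snd z)) \<bullet> fst ?b1) * w ?b1 z) + cr z * ((evec (snd (snd z)) \<bullet> fst ?b2) * w ?b2 z)" for z
  define i2 where "i2 z = (Df (fst z) (snd z) \<bullet> ?b1) * w ?b1 z + (Df (fst z) (snd z) \<bullet> ?b2) * w ?b2 z" for z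
  define i3 where "i3 z = (Df (fst z) (snd z) \<bullet> ?b3) * w ?b3 z" for z
  have ew: "square_integrable (cyl T) (\<lambda>z. (evec (snd (snd z)) \<bullet> fst b) * w b z)" if "b \<in> Basis" for b
    by (rule square_integrable_bounded_mult[OF w[OF that] evec_measurable, where B = 1])
      (use evec_inner_Basis[OF that] in \<open>intro AE_I2\<close>)
  have ints: "integrable (cyl T) i1" "integrable (cyl T) i2" "integrable (cyl T) i3"
    unfolding i1_def[abs_def] i2_def[abs_def] i3_def[abs_def]
    by (intro Bochner_Integration.integrable_add square_integrable_mult cr ew w square_integrable_cyl(2) bB)+
  have "(LINT t:{0<..<T}|lebesgue. F t (\<lambda>\<xi>. \<eta> t * mode k \<xi>)) =
      Pe * (LINT z|cyl T. i1 z) - De * (LINT z|cyl T. i2 z) - (LINT z|cyl T. i3 z)"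
  proof -
    have 1: "(\<lambda>(t, x, \<theta>). (1 - theta_marginal (f t) x) * f t (x, \<theta>) * (evec \<theta> \<bullet> fst (\<eta> t *\<^sub>R mode_grad k (x, \<theta>)))) = i1"
      by (auto simp: fun_eq_iff i1_def cr_def w_def evec_def inner_prod_def algebra_simps)
    have 2: "(\<lambda>(t, \<xi>). fst (Df t \<xi>) \<bullet> fst (\<eta> t *\<^sub>R mode_grad k \<xi>)) = i2"
      by (auto simp: fun_eq_iff i2_def w_def inner_prod_def algebra_simps)
    have 3: "(\<lambda>(t, \<xi>). snd (Df t \<xi>) * snd (\<eta> t *\<^sub>R mode_grad k \<xi>)) = i3"
      by (auto simp: fun_eq_iff i3_def w_def inner_prod_def)
    show ?thesis
      using weak[OF mode_test_bochner_L2[OF \<eta>c(2) B] mode_test_space_gradient[OF \<eta>c(2)], of k]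
      by (simp only: 1 2 3 integral_cyl)
  qed
  also have "\<dots> = (LINT z|cyl T. Pe * i1 z - De * i2 z - i3 z)" using ints by simp
  also have "\<dots> = (LINT z|cyl T. \<eta> (fst z) * (flux (fst z) (snd z) \<bullet> mode_grad k (snd z)))"
    by (intro Bochner_Integration.integral_cong refl)
      (auto simp: i1_def i2_def i3_def cr_def w_def flux_def evec_def inner_prod_def algebra_simps)
  also have "\<dots> = (LINT t|time_measure T. \<eta> t * (LINT \<xi>|cell. flux t \<xi> \<bullet> mode_grad k \<xi>))"
    using cylp.integral_fst'[OF flux_mode_integrable[OF \<eta>c(2) B, of k]] by simp
  finally have rhs: "(LINT t:{0<..<T}|lebesgue. F t (\<lambda>\<xi>. \<eta> t * mode k \<xi>)) =
      (LINT t|time_measure T. \<eta> t * (LINT \<xi>|cell. flux t \<xi> \<bullet> mode_grad k \<xi>))" .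
  have "AE t in lebesgue. t \<in> {0<..<T} \<longrightarrow> F t \<in> H1_dual"
    using wtd by (simp add: weak_time_derivative_def bochner_L2_def)
  \<comment> \<open>\<eta>(t) is pulled out by linearity for almost every t, namely where
    \<open>F t\<close> lies in \<open>H1_dual\<close>.\<close>
  then have lin: "(LINT t:{0<..<T}|lebesgue. F t (\<lambda>\<xi>. \<eta> t * mode k \<xi>)) = (LINT t:{0<..<T}|lebesgue. \<eta> t * F t (mode k))"
    unfolding set_lebesgue_integral_def
  proof (intro integral_lebesgue_cong_AE, eventually_elim)
    case (elim t)
    then show ?case using mode_H1_per[of k] by (cases "t \<in> {0<..<T}") (simp_all add: H1_dual_def)
  qed
  have cm: "(\<lambda>t. LINT \<xi>|cell. f t \<xi> * mode k \<xi>) \<in> borel_measurable (time_measure T)"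
  proof (rule cell.borel_measurable_lebesgue_integral)
    have "(\<lambda>z. f (fst z) (snd z) * mode k (snd z)) \<in> borel_measurable (cyl T)"
      by (intro borel_measurable_times jointly_measurable_cyl f_meas cyl_measurable_snd) measurable
    then show "(\<lambda>(t, \<xi>). f t \<xi> * mode k \<xi>) \<in> borel_measurable (cyl T)" by (simp add: split_beta')
  qed
  have "(LINT t|time_measure T. deriv \<eta> t * (LINT \<xi>|cell. f t \<xi> * mode k \<xi>))
      = (LINT t:{0<..<T}|lebesgue. deriv \<eta> t * (LINT \<xi>:Upsilon|lborel. f t \<xi> * mode k \<xi>))"
    unfolding integral_cell
    by (intro integral_lebesgue_time[symmetric] borel_measurable_times cm measurable_time borel_measurable_continuous_onI \<eta>c)
  also have "\<dots> = - (LINT t:{0<..<T}|lebesgue. \<eta> t * F t (mode k))"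
    using wtd \<eta> mode_H1_per by (simp add: weak_time_derivative_def)
  finally show ?thesis using rhs lin by simp
qed

end

subsection \<open>The energy identity\<close>

text \<open>Symmetric in the sign of each frequency, so that every \<open>flip b\<close> permutes it
  and truncated sums can be reindexed exactly.\<close>

definition freq_box :: "nat \<Rightarrow> index set" where
  "freq_box N = ({- int N..int N} \<times> {- int N..int N}) \<times> {- int N..int N}"

lemma finite_freq_box: "finite (freq_box N)"
  by (simp add: freq_box_def)

lemma flip_bij_betw_freq_box: "bij_betw (flip b) (freq_box N) (freq_box N)"
  by (rule bij_betw_byWitness[where f' = "flip b"]) (auto simp: flip_flip, auto simp: flip_def freq_box_def split: if_splits)

text \<open>Every finite index set lies in some box. Passing from unordered sums to a sequence of
  boxes makes dominated convergence applicable.\<close>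

lemma has_sum_freq_box_limit:
  assumes "(g has_sum S) UNIV"
  shows "(\<lambda>N. sum g (freq_box N)) \<longlonglongrightarrow> S"
proof -
  have "filterlim freq_box (finite_subsets_at_top UNIV) sequentially"
    unfolding filterlim_iff eventually_finite_subsets_at_top
  proof (intro allI impI)
    fix P :: "index set \<Rightarrow> bool"
    assume "\<exists>X. finite X \<and> X \<subseteq> UNIV \<and> (\<forall>Y. finite Y \<and> X \<subseteq> Y \<and> Y \<subseteq> UNIV \<longrightarrow> P Y)"
    then obtain X where X: "finite X" "\<And>Y. finite Y \<Longrightarrow> X \<subseteq> Y \<Longrightarrow> P Y" by auto
    define h :: "index \<Rightarrow> nat" where "h k = max (nat \<bar>fst (fst k)\<bar>) (max (nat \<bar>snd (fst k)\<bar>) (nat \<bar>snd k\<bar>))" for k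
    have "X \<subseteq> freq_box N" if "N \<ge> Max (insert 0 (h ` X))" for N
    proof
      fix k assume "k \<in> X"
      then have "h k \<le> N" using X(1) that by (auto intro: order_trans[OF Max_ge])
      then show "k \<in> freq_box N" by (cases k) (auto simp: freq_box_def h_def)
    qed
    then show "\<forall>\<^sub>F N in sequentially. P (freq_box N)"
      unfolding eventually_sequentially using X(2)[OF finite_freq_box] by blast
  qed
  with assms show ?thesis unfolding has_sum_def by (rule filterlim_compose)
qed

context flux_space
begin

abbreviation coef :: "index \<Rightarrow> real \<Rightarrow> real" where
  "coef k t \<equiv> LINT \<xi>|cell. f t \<xi> * mode k \<xi>"

abbreviation action :: "index \<Rightarrow> real \<Rightarrow> real" where
  "action k t \<equiv> LINT \<xi>|cell. flux t \<xi> \<bullet> mode_grad k \<xi>"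

lemma slices_AE:
  "AE t in time_measure T. weak_gradient (f t) (Df t) \<and>
     (\<forall>b\<in>Basis. square_integrable cell (\<lambda>\<xi>. flux t \<xi> \<bullet> b) \<and> square_integrable cell (\<lambda>\<xi>. Df t \<xi> \<bullet> b))"
proof (rule AE_conjI[OF weak_gradient_AE], rule AE_finite_allI[OF finite_Basis], rule AE_conjI)
  fix b :: point assume b: "b \<in> Basis"
  note sf = time.sigma_finite_measure_axioms cell.sigma_finite_measure_axioms
  show "AE t in time_measure T. square_integrable cell (\<lambda>\<xi>. flux t \<xi> \<bullet> b)"
    using square_integrable_fst(1)[OF sf flux_square_integrable[OF b]] by simp
  show "AE t in time_measure T. square_integrable cell (\<lambda>\<xi>. Df t \<xi> \<bullet> b)"
    using square_integrable_fst(1)[OF sf square_integrable_cyl(2)[OF b]] by simp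
qed

text \<open>Integration by parts on the Fourier side, exact at every truncation:
  \<open>action k\<close> and the coefficients of Df carry the same factor - \<open>freq b k\<close>
  at the flipped index, so it moves from one to the other, and \<open>flip b\<close> is then undone
  by reindexing.\<close>

lemma sum_coef_action:
  assumes wg: "weak_gradient (f t) (Df t)"
    and sq: "\<And>b. b \<in> Basis \<Longrightarrow> square_integrable cell (\<lambda>\<xi>. flux t \<xi> \<bullet> b)"
  shows "(\<Sum>k\<in>freq_box N. coef k t * action k t) =
    (\<Sum>b\<in>Basis. \<Sum>k\<in>freq_box N. (LINT \<xi>|cell. (flux t \<xi> \<bullet> b) * mode k \<xi>) * (LINT \<xi>|cell. (Df t \<xi> \<bullet> b) * mode k \<xi>))"
proof -
  define J D where "J b k = (LINT \<xi>|cell. (flux t \<xi> \<bullet> b) * mode k \<xi>)"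
    and "D b k = (LINT \<xi>|cell. (Df t \<xi> \<bullet> b) * mode k \<xi>)" for b k
  have D: "D b (flip b k) = - freq b k * coef k t" if "b \<in> Basis" for b k
    using weak_gradient_mode[OF wg that, of "flip b k"] by (simp add: D_def freq_flip[OF that] flip_flip)
  have "action k t = (\<Sum>b\<in>Basis. - freq b k * J b (flip b k))" for k
  proof -
    have "action k t = (LINT \<xi>|cell. (\<Sum>b\<in>Basis. - freq b k * ((flux t \<xi> \<bullet> b) * mode (flip b k) \<xi>)))"
      by (intro Bochner_Integration.integral_cong refl, subst euclidean_inner, intro sum.cong refl)
        (simp add: mode_grad_inner mult_ac)
    also have "\<dots> = (\<Sum>b\<in>Basis. LINT \<xi>|cell. - freq b k * ((flux t \<xi> \<bullet> b) * mode (flip b k) \<xi>))"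
      by (intro Bochner_Integration.integral_sum integrable_mult_right square_integrable_mult sq mode_square_integrable)
    finally show ?thesis by (simp add: J_def)
  qed
  then have "(\<Sum>k\<in>freq_box N. coef k t * action k t) = (\<Sum>k\<in>freq_box N. \<Sum>b\<in>Basis. J b (flip b k) * D b (flip b k))"
    by (intro sum.cong refl) (simp add: sum_distrib_left D mult_ac)
  also have "\<dots> = (\<Sum>b\<in>Basis. \<Sum>k\<in>freq_box N. J b (flip b k) * D b (flip b k))" by (rule sum.swap)
  also have "\<dots> = (\<Sum>b\<in>Basis. \<Sum>k\<in>freq_box N. J b k * D b k)"
    by (intro sum.cong refl sum.reindex_bij_betw[OF flip_bij_betw_freq_box])
  finally show ?thesis by (simp add: J_def D_def)
qed

text \<open>The increments of the squared coefficients are summed over a box and N tends to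
  infinity. The left side is taken at the given s and t, hence \<open>sq\<close> at every time; the
  right side converges under the time integral.\<close>

lemma energy_identity:
  assumes cont: "\<And>k. continuous_on {0<..<T} (coef k)"
    and mode_eq: "\<And>\<eta> k. smooth \<eta> \<Longrightarrow> compactly_supported_in T \<eta> \<Longrightarrow>
      (LINT t|time_measure T. deriv \<eta> t * coef k t) = - (LINT t|time_measure T. \<eta> t * action k t)"
    and sq: "\<And>t. t \<in> {0<..<T} \<Longrightarrow> square_integrable cell (f t)"
    and s: "0 < s" and st: "s < t" and t: "t < T"
  shows "(LINT \<xi>|cell. (f t \<xi>)\<^sup>2) - (LINT \<xi>|cell. (f s \<xi>)\<^sup>2) =
      2 * (LINT r|time_measure T. indicator {s<..<t} r * (LINT \<xi>|cell. flux r \<xi> \<bullet> Df r \<xi>))"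
    and "integrable (time_measure T) (\<lambda>r. LINT \<xi>|cell. flux r \<xi> \<bullet> Df r \<xi>)"
proof -
  let ?M = "time_measure T"
  note sf = time.sigma_finite_measure_axioms cell.sigma_finite_measure_axioms
  have ind: "(indicator {s<..<t} :: real \<Rightarrow> real) \<in> borel_measurable ?M"
    by (intro measurable_time) simp
  have "integrable (cyl T) (\<lambda>z. \<Sum>b\<in>Basis. (flux (fst z) (snd z) \<bullet> b) * (Df (fst z) (snd z) \<bullet> b))"
    by (intro Bochner_Integration.integrable_sum square_integrable_mult flux_square_integrable square_integrable_cyl(2))
  then have "integrable (cyl T) (\<lambda>z. flux (fst z) (snd z) \<bullet> Df (fst z) (snd z))"
    by (subst euclidean_inner)
  from cylp.integrable_fst'[OF this]
  show FD: "integrable ?M (\<lambda>r. LINT \<xi>|cell. flux r \<xi> \<bullet> Df r \<xi>)" by simp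
  \<comment> \<open>An integrable majorant in time, independent of N, made from
    \<open>parseval_finite_sum_bound\<close> in each direction b.\<close>
  define W where "W r = (\<Sum>b\<in>Basis. (LINT \<xi>|cell. (flux r \<xi> \<bullet> b)\<^sup>2) + (LINT \<xi>|cell. (Df r \<xi> \<bullet> b)\<^sup>2))" for r
  have W: "integrable ?M W"
    unfolding W_def[abs_def]
    using square_integrable_fst(2)[OF sf flux_square_integrable] square_integrable_fst(2)[OF sf square_integrable_cyl(2)]
    by (intro Bochner_Integration.integrable_sum Bochner_Integration.integrable_add) simp_all
  note inc = weak_derivative_increment[OF cont mode_action_integrable mode_eq]
  note inc2 = increment_power2[OF mode_action_integrable inc s st t]
  have lhs: "(\<lambda>N. (\<Sum>k\<in>freq_box N. (coef k t)\<^sup>2) - (\<Sum>k\<in>freq_box N. (coef k s)\<^sup>2)) \<longlonglongrightarrow>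
     (LINT \<xi>|cell. (f t \<xi>)\<^sup>2) - (LINT \<xi>|cell. (f s \<xi>)\<^sup>2)"
    using s st t by (intro tendsto_diff has_sum_freq_box_limit parseval_has_sum_power2[OF parseval_system_mode] sq) auto
  have eq: "(\<Sum>k\<in>freq_box N. (coef k t)\<^sup>2) - (\<Sum>k\<in>freq_box N. (coef k s)\<^sup>2) =
      2 * (LINT r|?M. indicator {s<..<t} r * (\<Sum>k\<in>freq_box N. coef k r * action k r))" for N
  proof -
    have "(\<Sum>k\<in>freq_box N. (coef k t)\<^sup>2) - (\<Sum>k\<in>freq_box N. (coef k s)\<^sup>2) =
       (\<Sum>k\<in>freq_box N. 2 * (LINT r|?M. indicator {s<..<t} r * (coef k r * action k r)))"
      unfolding sum_subtractf[symmetric] by (intro sum.cong refl inc2(1))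
    also have "\<dots> = 2 * (LINT r|?M. (\<Sum>k\<in>freq_box N. indicator {s<..<t} r * (coef k r * action k r)))"
      by (subst Bochner_Integration.integral_sum) (simp_all add: inc2(2) sum_distrib_left)
    finally show ?thesis by (simp add: sum_distrib_left)
  qed
  have rhs: "(\<lambda>N. LINT r|?M. indicator {s<..<t} r * (\<Sum>k\<in>freq_box N. coef k r * action k r)) \<longlonglongrightarrow>
     (LINT r|?M. indicator {s<..<t} r * (LINT \<xi>|cell. flux r \<xi> \<bullet> Df r \<xi>))"
  proof (rule integral_dominated_convergence[OF _ _ W])
    show "(\<lambda>r. indicator {s<..<t} r * (LINT \<xi>|cell. flux r \<xi> \<bullet> Df r \<xi>)) \<in> borel_measurable ?M"
      by (intro borel_measurable_times ind borel_measurable_integrable FD)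
    have "integrable ?M (\<lambda>r. \<Sum>k\<in>freq_box N. indicator {s<..<t} r * (coef k r * action k r))" for N
      by (intro Bochner_Integration.integrable_sum inc2(2))
    then show "(\<lambda>r. indicator {s<..<t} r * (\<Sum>k\<in>freq_box N. coef k r * action k r)) \<in> borel_measurable ?M" for N
      by (simp add: sum_distrib_left)
    show "AE r in ?M. (\<lambda>N. indicator {s<..<t} r * (\<Sum>k\<in>freq_box N. coef k r * action k r)) \<longlonglongrightarrow>
        indicator {s<..<t} r * (LINT \<xi>|cell. flux r \<xi> \<bullet> Df r \<xi>)"
      using slices_AE
    proof eventually_elim
      case (elim r)
      have "(LINT \<xi>|cell. flux r \<xi> \<bullet> Df r \<xi>) = (\<Sum>b\<in>Basis. LINT \<xi>|cell. (flux r \<xi> \<bullet> b) * (Df r \<xi> \<bullet> b))"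
        by (subst euclidean_inner, intro Bochner_Integration.integral_sum square_integrable_mult) (use elim in auto)
      moreover have "(\<lambda>N. \<Sum>b\<in>Basis. \<Sum>k\<in>freq_box N. (LINT \<xi>|cell. (flux r \<xi> \<bullet> b) * mode k \<xi>) * (LINT \<xi>|cell. (Df r \<xi> \<bullet> b) * mode k \<xi>))
          \<longlonglongrightarrow> (\<Sum>b\<in>Basis. LINT \<xi>|cell. (flux r \<xi> \<bullet> b) * (Df r \<xi> \<bullet> b))"
        by (intro tendsto_sum has_sum_freq_box_limit parseval_has_sum parseval_system_mode) (use elim in auto)
      ultimately show ?case
        using elim by (intro tendsto_mult tendsto_const) (simp add: sum_coef_action)
    qed
    show "AE r in ?M. norm (indicator {s<..<t} r * (\<Sum>k\<in>freq_box N. coef k r * action k r)) \<le> W r" for N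
      using slices_AE
    proof eventually_elim
      case (elim r)
      have "norm (indicator {s<..<t} r * (\<Sum>k\<in>freq_box N. coef k r * action k r)) \<le> \<bar>\<Sum>k\<in>freq_box N. coef k r * action k r\<bar>"
        by (simp add: indicator_def)
      also have "\<dots> \<le> (\<Sum>b\<in>Basis. \<bar>\<Sum>k\<in>freq_box N. (LINT \<xi>|cell. (flux r \<xi> \<bullet> b) * mode k \<xi>) * (LINT \<xi>|cell. (Df r \<xi> \<bullet> b) * mode k \<xi>)\<bar>)"
        using elim by (simp add: sum_coef_action sum_abs)
      also have "\<dots> \<le> W r"
        unfolding W_def using elim by (intro sum_mono parseval_finite_sum_bound parseval_system_mode finite_freq_box) auto
      finally show ?case .
    qed
  qed
  have "(\<lambda>N. (\<Sum>k\<in>freq_box N. (coef k t)\<^sup>2) - (\<Sum>k\<in>freq_box N. (coef k s)\<^sup>2)) \<longlonglongrightarrow>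
     2 * (LINT r|?M. indicator {s<..<t} r * (LINT \<xi>|cell. flux r \<xi> \<bullet> Df r \<xi>))"
    unfolding eq by (intro tendsto_mult tendsto_const rhs)
  from LIMSEQ_unique[OF lhs this]
  show "(LINT \<xi>|cell. (f t \<xi>)\<^sup>2) - (LINT \<xi>|cell. (f s \<xi>)\<^sup>2) =
      2 * (LINT r|?M. indicator {s<..<t} r * (LINT \<xi>|cell. flux r \<xi> \<bullet> Df r \<xi>))" .
qed

end

subsection \<open>The dissipation estimate\<close>

text \<open>The hypothesis is an implicit Euler step for E' = - c E. Iterating it over n equal steps
  gives the factor (1 + c (t - s) / n)^n, whose limit is the exponential; no derivative of E is
  involved.\<close>

lemma gronwall_discrete:
  fixes E :: "real \<Rightarrow> real"
  assumes c: "0 \<le> c" and st: "s < t"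
    and step: "\<And>u v. s \<le> u \<Longrightarrow> u < v \<Longrightarrow> v \<le> t \<Longrightarrow> E v * (1 + c * (v - u)) \<le> E u"
  shows "E t * exp (c * (t - s)) \<le> E s"
proof (rule LIMSEQ_le_const2)
  show "(\<lambda>n. E t * (1 + (c * (t - s)) / real n) ^ n) \<longlonglongrightarrow> E t * exp (c * (t - s))"
    by (intro tendsto_mult tendsto_const tendsto_exp_limit_sequentially)
  have "E t * (1 + (c * (t - s)) / real n) ^ n \<le> E s" if n: "n \<ge> 1" for n
  proof -
    define h where "h = (t - s) / real n"
    have h: "h > 0" "s + real n * h = t" using n st by (simp_all add: h_def)
    have "E (s + real k * h) * (1 + c * h) ^ k \<le> E s" if "k \<le> n" for k
      using that
    proof (induction k)
      case (Suc k)
      have "real (Suc k) * h \<le> real n * h" using Suc.prems h by (intro mult_right_mono) auto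
      then have "s + real (Suc k) * h \<le> t" using h(2) by simp
      then have "E (s + real (Suc k) * h) * (1 + c * (s + real (Suc k) * h - (s + real k * h))) \<le> E (s + real k * h)"
        using h by (intro step) (auto simp: distrib_right)
      then have "E (s + real (Suc k) * h) * (1 + c * h) \<le> E (s + real k * h)" by (simp add: distrib_right)
      then have "E (s + real (Suc k) * h) * (1 + c * h) * (1 + c * h) ^ k \<le> E (s + real k * h) * (1 + c * h) ^ k"
        using c h by (intro mult_right_mono) auto
      with Suc show ?case by (simp add: mult.assoc)
    qed simp
    from this[of n] h(2) show ?thesis by (simp add: h_def)
  qed
  then show "\<exists>N. \<forall>n\<ge>N. E t * (1 + (c * (t - s)) / real n) ^ n \<le> E s" by blast
qed

section \<open>Norms, means and marginals on the cell\<close>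

lemma L2_norm_eq: "L2_norm v = sqrt (LINT \<xi>|cell. (v \<xi>)\<^sup>2)" for v :: "point \<Rightarrow> real"
  by (simp add: L2_norm_cell)

lemma L2_norm_triangle:
  fixes u v :: "point \<Rightarrow> real"
  assumes "square_integrable cell u" "square_integrable cell v"
  shows "L2_norm (\<lambda>\<xi>. u \<xi> + v \<xi>) \<le> L2_norm u + L2_norm v"
  unfolding L2_norm_eq by (rule integral_Minkowski[OF assms])

text \<open>Transfers L2 continuity in time to the coefficients. The sqrt 2 comes from the two equal
  terms of \<open>parseval_finite_sum_bound\<close>; any constant would do.\<close>

lemma coefficient_diff_le:
  assumes "u \<in> L2_per" "v \<in> L2_per"
  shows "\<bar>(LINT \<xi>|cell. u \<xi> * mode k \<xi>) - (LINT \<xi>|cell. v \<xi> * mode k \<xi>)\<bar> \<le> sqrt 2 * L2_norm (u - v)"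
proof -
  note sq = assms[THEN L2_per_square_integrable]
  define d where "d = (LINT \<xi>|cell. (u \<xi> - v \<xi>) * mode k \<xi>)"
  have "(LINT \<xi>|cell. u \<xi> * mode k \<xi>) - (LINT \<xi>|cell. v \<xi> * mode k \<xi>) = d"
    using sq[THEN square_integrable_mult[OF _ mode_square_integrable[of k]]] by (simp add: d_def left_diff_distrib)
  moreover have "d\<^sup>2 \<le> 2 * (L2_norm (u - v))\<^sup>2"
    using parseval_finite_sum_bound[OF parseval_system_mode square_integrable_diff[OF sq] square_integrable_diff[OF sq], of "{k}"]
    by (simp add: d_def L2_norm_power2 flip: power2_eq_square)
  then have "sqrt (d\<^sup>2) \<le> sqrt (2 * (L2_norm (u - v))\<^sup>2)" by (rule real_sqrt_le_mono)
  then have "\<bar>d\<bar> \<le> sqrt 2 * L2_norm (u - v)" using L2_norm_nonneg[of "u - v"] by (simp add: real_sqrt_mult)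
  ultimately show ?thesis by simp
qed

lemma mode_zero: "mode ((0, 0), 0) \<xi> = 1 / sqrt (2 * pi) ^ 3" "mode_grad ((0, 0), 0) \<xi> = 0"
  by (simp_all add: mode_def trig_basis_def power3_eq_cube mode_grad_def freq_def)

lemma integral_partial_deriv_eq_0:
  assumes "smooth \<psi>" "periodic \<psi>" "b \<in> Basis"
  shows "(LINT \<xi>|cell. partial_deriv b \<psi> \<xi>) = 0"
  using integral_by_parts_mode[OF assms, of "((0, 0), 0)"] by (simp add: mode_zero)

lemma measure_cell: "measure cell (space cell) = (2 * pi) ^ 3"
proof -
  have "measure cell (space cell) = measure lborel Upsilon"
    unfolding space_cell by (simp add: cell_def measure_restrict_space)
  then show ?thesis by (simp add: measure_Upsilon)
qed

lemma mean_eq: "mean g = (LINT \<xi>|cell. g \<xi>) / (2 * pi) ^ 3"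
  by (simp add: mean_def integral_cell measure_Upsilon)

lemma L2_per_diff_const:
  assumes "v \<in> L2_per" shows "(\<lambda>\<xi>. v \<xi> - c :: real) \<in> L2_per"
proof -
  have "square_integrable cell (\<lambda>\<xi>. v \<xi> - c)"
    by (intro square_integrable_diff L2_per_square_integrable assms cell.square_integrable_const)
  then show ?thesis
    using assms by (auto simp: L2_per_def periodic_def integrable_cell square_integrable_def)
qed

text \<open>The constant is paired with a partial derivative of a periodic function, whose integral
  is 0.\<close>

lemma weak_gradient_diff_const:
  assumes v: "v \<in> L2_per" and G: "weak_gradient v G"
  shows "weak_gradient (\<lambda>\<xi>. v \<xi> - c) G"
  unfolding weak_gradient_def
proof (intro conjI allI impI ballI)
  show "G \<in> L2_per" using G by (simp add: weak_gradient_def)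
  fix \<psi> :: "point \<Rightarrow> real" and b :: point assume \<psi>: "smooth \<psi>" "periodic \<psi>" and b: "b \<in> Basis"
  have c\<psi>: "continuous_on UNIV (partial_deriv b \<psi>)"
    using smooth_differentiable(2)[OF \<psi>(1) b] by (intro continuous_at_imp_continuous_on) (auto intro: differentiable_imp_continuous_within)
  then have "square_integrable cell (partial_deriv b \<psi>)"
    unfolding square_integrable_def
    by (intro conjI integrable_cell_continuous continuous_intros measurable_cell borel_measurable_continuous_onI)
  from square_integrable_mult[OF L2_per_square_integrable[OF v] this]
  have "(LINT \<xi>|cell. (v \<xi> - c) * partial_deriv b \<psi> \<xi>) = (LINT \<xi>|cell. v \<xi> * partial_deriv b \<psi> \<xi>)"
    using integrable_cell_continuous[OF c\<psi>] integral_partial_deriv_eq_0[OF \<psi> b] by (simp add: left_diff_distrib)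
  then show "(LINT \<xi>:Upsilon|lborel. (v \<xi> - c) * partial_deriv b \<psi> \<xi>) = - (LINT \<xi>:Upsilon|lborel. G \<xi> \<bullet> b * \<psi> \<xi>)"
    using G \<psi> b by (simp add: weak_gradient_def integral_cell)
qed

lemma poincare_diff_mean:
  assumes "poincare_constant C" "v \<in> L2_per" "weak_gradient v G"
  shows "(LINT \<xi>|cell. (v \<xi> - mean v)\<^sup>2) \<le> C\<^sup>2 * (LINT \<xi>|cell. (norm (G \<xi>))\<^sup>2)"
proof -
  define w where "w \<xi> = v \<xi> - mean v" for \<xi>
  have w: "w \<in> L2_per" "weak_gradient w G"
    unfolding w_def[abs_def] by (rule L2_per_diff_const weak_gradient_diff_const; fact)+
  have "integrable cell v" by (intro cell.square_integrable_finite_integrable L2_per_square_integrable assms)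
  then have "mean w = 0"
    using measure_cell by (simp add: w_def mean_eq)
  then have "L2_norm w \<le> C * L2_norm (wgrad w)"
    using assms(1) w by (auto simp: poincare_constant_def H1_per_def)
  then have "(L2_norm w)\<^sup>2 \<le> (C * L2_norm G)\<^sup>2"
    using L2_norm_wgrad[OF w(2)] L2_norm_nonneg[of w] by (intro power_mono) auto
  then show ?thesis by (simp add: power_mult_distrib L2_norm_power2 w_def)
qed

lemma measure_circ: "measure circ (space circ) = 2 * pi"
  by (simp add: circ_def space_restrict_space measure_restrict_space)

text \<open>One factor 2 pi is Cauchy-Schwarz in \<theta>; the other comes from integrating a
  function of x alone over \<theta>.\<close>

lemma marginal_bound:
  assumes v: "square_integrable cell v"
  shows "square_integrable cell (\<lambda>\<xi>. LINT \<theta>|circ. v (fst \<xi>, \<theta>))"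
    and "(LINT \<xi>|cell. (LINT \<theta>|circ. v (fst \<xi>, \<theta>))\<^sup>2) \<le> (2 * pi)\<^sup>2 * (LINT \<xi>|cell. (v \<xi>)\<^sup>2)"
proof -
  let ?P = "circ \<Otimes>\<^sub>M circ"
  interpret pair_sigma_finite ?P circ
    by (intro pair_sigma_finite.intro plane.sigma_finite_measure_axioms circ.sigma_finite_measure_axioms)
  note fst = square_integrable_fst[OF plane.sigma_finite_measure_axioms circ.sigma_finite_measure_axioms v[unfolded cell_eq]]
  define R where "R x = (LINT \<theta>|circ. v (x, \<theta>))" for x
  have vm[measurable]: "v \<in> borel_measurable (?P \<Otimes>\<^sub>M circ)" using v by (simp add: square_integrable_def cell_eq)
  have Rm[measurable]: "R \<in> borel_measurable ?P" unfolding R_def by measurable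
  have R: "AE x in ?P. (R x)\<^sup>2 \<le> 2 * pi * (LINT \<theta>|circ. (v (x, \<theta>))\<^sup>2)"
    using fst(1)
  proof eventually_elim
    case (elim x)
    from integral_Cauchy_Schwarz[OF elim circ.square_integrable_const[of 1]] show ?case
      by (simp add: R_def mult.commute measure_circ)
  qed
  have i: "integrable ?P (\<lambda>x. 2 * pi * (LINT \<theta>|circ. (v (x, \<theta>))\<^sup>2))" using fst(2) by simp
  have Rsq: "square_integrable ?P R" by (rule square_integrable_bound[OF Rm i R])
  from square_integrable_pair_mult[OF plane.sigma_finite_measure_axioms circ.sigma_finite_measure_axioms this circ.square_integrable_const[of 1]]
  have Rc: "square_integrable cell (\<lambda>\<xi>. R (fst \<xi>))" by (simp add: cell_eq split_beta')
  then show "square_integrable cell (\<lambda>\<xi>. LINT \<theta>|circ. v (fst \<xi>, \<theta>))" by (simp add: R_def)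
  have "(LINT \<xi>|cell. (R (fst \<xi>))\<^sup>2) = (LINT x|?P. LINT \<theta>|circ. (R x)\<^sup>2)"
    using Rc integral_fst'[of "\<lambda>\<xi>. (R (fst \<xi>))\<^sup>2"] by (simp add: square_integrable_def cell_eq)
  also have "\<dots> = 2 * pi * (LINT x|?P. (R x)\<^sup>2)" by (simp add: measure_circ)
  also have "(LINT x|?P. (R x)\<^sup>2) \<le> (LINT x|?P. 2 * pi * (LINT \<theta>|circ. (v (x, \<theta>))\<^sup>2))"
    using Rsq by (intro integral_mono_AE R i) (simp add: square_integrable_def)
  also have "\<dots> = 2 * pi * (LINT \<xi>|cell. (v \<xi>)\<^sup>2)" using fst(3) by (simp add: cell_eq)
  finally show "(LINT \<xi>|cell. (LINT \<theta>|circ. v (fst \<xi>, \<theta>))\<^sup>2) \<le> (2 * pi)\<^sup>2 * (LINT \<xi>|cell. (v \<xi>)\<^sup>2)"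
    by (simp add: R_def power2_eq_square)
qed

text \<open>Only almost everywhere: on a slice that is not integrable both integrals are 0 by
  convention and the difference is lost.\<close>

lemma marginal_diff_const:
  assumes v: "square_integrable cell v"
  shows "AE \<xi> in cell. (LINT \<theta>|circ. v (fst \<xi>, \<theta>) - c) = (LINT \<theta>|circ. v (fst \<xi>, \<theta>)) - 2 * pi * c"
proof -
  have "AE x in circ \<Otimes>\<^sub>M circ. (LINT \<theta>|circ. v (x, \<theta>) - c) = (LINT \<theta>|circ. v (x, \<theta>)) - 2 * pi * c"
    using square_integrable_fst(1)[OF plane.sigma_finite_measure_axioms circ.sigma_finite_measure_axioms v[unfolded cell_eq]]
  proof eventually_elim
    case (elim x)
    from circ.square_integrable_finite_integrable[OF elim] show ?case
      by (simp add: measure_circ)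
  qed
  then show ?thesis unfolding cell_eq by (rule AE_pair_fstI[OF circ.sigma_finite_measure_axioms])
qed

text \<open>The direction \<open>e(\<theta>)\<close> is itself a combination of modes of zero frequency in \<open>x\<close>.\<close>

lemma integral_evec_gradient:
  assumes G: "weak_gradient v G"
  shows "integrable cell (\<lambda>\<xi>. evec (snd \<xi>) \<bullet> fst (G \<xi>))" "(LINT \<xi>|cell. evec (snd \<xi>) \<bullet> fst (G \<xi>)) = 0"
proof -
  let ?b1 = "((1, 0), 0) :: point" and ?b2 = "((0, 1), 0) :: point"
  let ?k = "((0, 0), 1) :: index" and ?l = "((0, 0), -1) :: index"
  define c where "c = 2 * pi * sqrt pi"
  have b: "?b1 \<in> Basis" "?b2 \<in> Basis" by (auto simp: point_Basis)
  have "G \<in> L2_per" using G by (simp add: weak_gradient_def)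
  note sq = this[THEN L2_per_inner_square_integrable, OF b(1)] this[THEN L2_per_inner_square_integrable, OF b(2)]
  have cs: "cos \<theta> = c * mode ?k (x, \<theta>)" "sin \<theta> = c * mode ?l (x, \<theta>)" for x \<theta>
    by (simp_all add: mode_def trig_basis_def c_def)
  have e: "(\<lambda>\<xi>. evec (snd \<xi>) \<bullet> fst (G \<xi>)) = (\<lambda>\<xi>. c * ((G \<xi> \<bullet> ?b1) * mode ?k \<xi>) + c * ((G \<xi> \<bullet> ?b2) * mode ?l \<xi>))"
  proof
    fix \<xi> :: point
    show "evec (snd \<xi>) \<bullet> fst (G \<xi>) = c * ((G \<xi> \<bullet> ?b1) * mode ?k \<xi>) + c * ((G \<xi> \<bullet> ?b2) * mode ?l \<xi>)"
      using cs[of "snd \<xi>" "fst \<xi>"] by (simp add: evec_def inner_prod_def algebra_simps)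
  qed
  note i = square_integrable_mult[OF sq(1) mode_square_integrable[of ?k]] square_integrable_mult[OF sq(2) mode_square_integrable[of ?l]]
  show "integrable cell (\<lambda>\<xi>. evec (snd \<xi>) \<bullet> fst (G \<xi>))" unfolding e using i by simp
  have "(LINT \<xi>|cell. (G \<xi> \<bullet> ?b1) * mode ?k \<xi>) = 0" "(LINT \<xi>|cell. (G \<xi> \<bullet> ?b2) * mode ?l \<xi>) = 0"
    using weak_gradient_mode[OF G b(1), of ?k] weak_gradient_mode[OF G b(2), of ?l] by (simp_all add: freq_def)
  then show "(LINT \<xi>|cell. evec (snd \<xi>) \<bullet> fst (G \<xi>)) = 0" unfolding e using i by simp
qed

text \<open>Done before integration, with u, \<rho>, w the values of f, its marginal and its
  gradient. Young's inequality is (Pe q - \<mu> p)^2 \<ge> 0 divided by 2 \<mu>, which leaves \<mu>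
  / 2 of the dissipation.\<close>

lemma flux_pointwise_bound:
  fixes Pe De m \<mu> \<rho> u \<theta> :: real and w :: point
  assumes \<mu>: "0 < \<mu>" "\<mu> \<le> De" "\<mu> \<le> 1" and m: "0 \<le> m" and \<rho>: "0 \<le> \<rho>" "\<rho> \<le> 1"
  shows "((Pe * (1 - \<rho>) * u) *\<^sub>R evec \<theta> - De *\<^sub>R fst w, - snd w) \<bullet> w \<le>
    Pe * m * (1 - 2 * pi * m) * (evec \<theta> \<bullet> fst w)
    + Pe\<^sup>2 / (2 * \<mu>) * (1 + 2 * pi * m) * ((u - m)\<^sup>2 + m / (2 * pi) * (\<rho> - 2 * pi * m)\<^sup>2)
    - \<mu> / 2 * (norm w)\<^sup>2"
proof -
  define g r q p where "g = u - m" and "r = \<rho> - 2 * pi * m" and "q = (1 - \<rho>) * g - m * r" and "p = evec \<theta> \<bullet> fst w"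
  have ne: "norm (evec \<theta>) = 1" by (simp add: evec_def norm_Pair)
  have p2: "p\<^sup>2 \<le> (norm (fst w))\<^sup>2"
    using inner_power2_le_norm_power2[OF ne, of "fst w"] by (simp add: p_def inner_commute)
  have nw: "(norm w)\<^sup>2 = (norm (fst w))\<^sup>2 + (snd w)\<^sup>2" by (cases w) (simp add: norm_Pair)
  have young: "Pe * q * p \<le> Pe\<^sup>2 / (2 * \<mu>) * q\<^sup>2 + \<mu> / 2 * p\<^sup>2"
  proof -
    have "0 \<le> (Pe * q - \<mu> * p)\<^sup>2 / (2 * \<mu>)" using \<mu> by simp
    also have "\<dots> = Pe\<^sup>2 / (2 * \<mu>) * q\<^sup>2 + \<mu> / 2 * p\<^sup>2 - Pe * q * p"
      using \<mu> by (simp add: power2_eq_square field_simps)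
    finally show ?thesis by simp
  qed
  have q2: "q\<^sup>2 \<le> (1 + 2 * pi * m) * (g\<^sup>2 + m / (2 * pi) * r\<^sup>2)"
  proof -
    have "\<bar>q\<bar> \<le> \<bar>(1 - \<rho>) * g\<bar> + \<bar>m * r\<bar>" unfolding q_def by (rule abs_triangle_ineq4)
    also have "\<dots> \<le> \<bar>g\<bar> + m * \<bar>r\<bar>"
      using \<rho> m by (simp add: abs_mult mult_left_le_one_le)
    finally have "q\<^sup>2 \<le> (\<bar>g\<bar> + m * \<bar>r\<bar>)\<^sup>2" by (metis abs_ge_zero power2_abs power_mono)
    also have "\<dots> \<le> (1 + 2 * pi * m) * (g\<^sup>2 + m / (2 * pi) * r\<^sup>2)"
    proof -
      \<comment> \<open>The weight m / (2 pi) is balanced against \<open>marginal_bound\<close>: if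
        r^2 integrates to (2 pi)^2 times the integral of g^2, the bracket yields a second factor 1 +
        2 pi m.\<close>
      have "0 \<le> 2 * pi * m * (\<bar>g\<bar> - \<bar>r\<bar> / (2 * pi))\<^sup>2" using m by simp
      also have "\<dots> = (1 + 2 * pi * m) * (g\<^sup>2 + m / (2 * pi) * r\<^sup>2) - (\<bar>g\<bar> + m * \<bar>r\<bar>)\<^sup>2"
        by (simp add: power2_eq_square field_simps flip: power2_eq_square[of "\<bar>_\<bar>"])
      finally show ?thesis by simp
    qed
    finally show ?thesis .
  qed
  have "((Pe * (1 - \<rho>) * u) *\<^sub>R evec \<theta> - De *\<^sub>R fst w, - snd w) \<bullet> w
      = Pe * (1 - \<rho>) * u * p - De * (norm (fst w))\<^sup>2 - (snd w)\<^sup>2"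
  proof -
    obtain x y where w: "w = (x, y)" by fastforce
    show ?thesis
      by (simp add: w inner_diff_left p_def dot_square_norm power2_eq_square[of y])
  qed
  also have "Pe * (1 - \<rho>) * u * p = Pe * m * (1 - 2 * pi * m) * p + Pe * q * p"
    by (simp add: q_def g_def r_def algebra_simps)
  also have "Pe * m * (1 - 2 * pi * m) * p + Pe * q * p - De * (norm (fst w))\<^sup>2 - (snd w)\<^sup>2
     \<le> Pe * m * (1 - 2 * pi * m) * p + Pe\<^sup>2 / (2 * \<mu>) * ((1 + 2 * pi * m) * (g\<^sup>2 + m / (2 * pi) * r\<^sup>2)) - \<mu> / 2 * (norm w)\<^sup>2"
  proof -
    have "Pe\<^sup>2 / (2 * \<mu>) * q\<^sup>2 \<le> Pe\<^sup>2 / (2 * \<mu>) * ((1 + 2 * pi * m) * (g\<^sup>2 + m / (2 * pi) * r\<^sup>2))"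
      using \<mu> q2 by (intro mult_left_mono) auto
    moreover have "\<mu> / 2 * p\<^sup>2 \<le> \<mu> / 2 * (norm (fst w))\<^sup>2" using \<mu> p2 by (intro mult_left_mono) auto
    moreover have "\<mu> * (norm (fst w))\<^sup>2 \<le> De * (norm (fst w))\<^sup>2" using \<mu> by (intro mult_right_mono) auto
    moreover have "\<mu> / 2 * (snd w)\<^sup>2 \<le> 1 * (snd w)\<^sup>2" using \<mu> by (intro mult_right_mono) auto
    ultimately show ?thesis using young unfolding nw distrib_left by linarith
  qed
  finally show ?thesis by (simp add: p_def g_def r_def mult.assoc)
qed

context flux_space
begin

text \<open>The pointwise bound is integrated at a fixed time. The rate obtained has the full C^-2,
  not its half: one share \<mu> / 2 of the dissipation remains intact for Poincare's
  inequality.\<close>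

lemma dissipation:
  assumes De: "0 < De" and C: "0 < C" "poincare_constant C" and m: "0 \<le> m"
    and ft: "f t \<in> L2_per" "mean (f t) = m" and wg: "weak_gradient (f t) (Df t)"
    and \<rho>: "AE \<xi> in cell. 0 \<le> theta_marginal (f t) (fst \<xi>) \<and> theta_marginal (f t) (fst \<xi>) \<le> 1"
    and fl: "\<And>b. b \<in> Basis \<Longrightarrow> square_integrable cell (\<lambda>\<xi>. flux t \<xi> \<bullet> b)"
  shows "(LINT \<xi>|cell. flux t \<xi> \<bullet> Df t \<xi>) \<le>
    - (1/2 * (1 / C\<^sup>2 * min De 1 - (2 * pi)\<^sup>2 * Pe\<^sup>2 * (1 + m)\<^sup>2 / min De 1)) * (LINT \<xi>|cell. (f t \<xi> - m)\<^sup>2)"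
proof -
  define \<mu> where "\<mu> = min De 1"
  have \<mu>: "0 < \<mu>" "\<mu> \<le> De" "\<mu> \<le> 1" using De by (auto simp: \<mu>_def)
  define g where "g \<xi> = f t \<xi> - m" for \<xi>
  define p where "p \<xi> = evec (snd \<xi>) \<bullet> fst (Df t \<xi>)" for \<xi>
  define R where "R \<xi> = (LINT \<theta>|circ. g (fst \<xi>, \<theta>))" for \<xi> :: point
  define X Y where "X = (LINT \<xi>|cell. (g \<xi>)\<^sup>2)" and "Y = (LINT \<xi>|cell. (norm (Df t \<xi>))\<^sup>2)"
  note fsq = L2_per_square_integrable[OF ft(1)]
  have g: "square_integrable cell g"
    unfolding g_def[abs_def] by (intro square_integrable_diff fsq cell.square_integrable_const)
  have X0: "0 \<le> X" by (simp add: X_def)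
  note R = marginal_bound[OF g, folded R_def X_def]
  have p: "integrable cell p" "(LINT \<xi>|cell. p \<xi>) = 0"
    using integral_evec_gradient[OF wg] by (simp_all add: p_def[abs_def])
  have DL2: "Df t \<in> L2_per" using wg by (simp add: weak_gradient_def)
  note D = L2_per_integrable_norm[OF this]
  have fD: "integrable cell (\<lambda>\<xi>. flux t \<xi> \<bullet> Df t \<xi>)"
    by (subst euclidean_inner)
      (intro Bochner_Integration.integrable_sum square_integrable_mult fl L2_per_inner_square_integrable DL2)
  define a b where "a = Pe * m * (1 - 2 * pi * m)" and "b = Pe\<^sup>2 / (2 * \<mu>) * (1 + 2 * pi * m)"
  have b0: "0 \<le> b" using \<mu> m by (simp add: b_def)
  have g2: "integrable cell (\<lambda>\<xi>. (g \<xi>)\<^sup>2)" and R2: "integrable cell (\<lambda>\<xi>. (R \<xi>)\<^sup>2)"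
    using g R(1) by (simp_all add: square_integrable_def)
  have "(LINT \<xi>|cell. flux t \<xi> \<bullet> Df t \<xi>) \<le>
      (LINT \<xi>|cell. a * p \<xi> + b * ((g \<xi>)\<^sup>2 + m / (2 * pi) * (R \<xi>)\<^sup>2) - \<mu> / 2 * (norm (Df t \<xi>))\<^sup>2)"
  proof (rule integral_mono_AE[OF fD])
    show "integrable cell (\<lambda>\<xi>. a * p \<xi> + b * ((g \<xi>)\<^sup>2 + m / (2 * pi) * (R \<xi>)\<^sup>2) - \<mu> / 2 * (norm (Df t \<xi>))\<^sup>2)"
      using p(1) g2 R2 D by simp
    show "AE \<xi> in cell. flux t \<xi> \<bullet> Df t \<xi> \<le> a * p \<xi> + b * ((g \<xi>)\<^sup>2 + m / (2 * pi) * (R \<xi>)\<^sup>2) - \<mu> / 2 * (norm (Df t \<xi>))\<^sup>2"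
      using \<rho> marginal_diff_const[OF fsq, of m]
    proof eventually_elim
      case (elim \<xi>)
      then have "R \<xi> = theta_marginal (f t) (fst \<xi>) - 2 * pi * m"
        by (simp add: R_def g_def theta_marginal_circ)
      with flux_pointwise_bound[OF \<mu> m, of "theta_marginal (f t) (fst \<xi>)" Pe "f t \<xi>" "snd \<xi>" "Df t \<xi>"] elim(1)
      show ?case by (simp add: flux_def a_def b_def g_def p_def)
    qed
  qed
  also have "\<dots> = b * (X + m / (2 * pi) * (LINT \<xi>|cell. (R \<xi>)\<^sup>2)) - \<mu> / 2 * Y"
    using p g2 R2 D by (simp add: X_def Y_def)
  also have "\<dots> \<le> b * (X + m / (2 * pi) * ((2 * pi)\<^sup>2 * X)) - \<mu> / 2 * (X / C\<^sup>2)"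
  proof -
    have "b * (X + m / (2 * pi) * (LINT \<xi>|cell. (R \<xi>)\<^sup>2)) \<le> b * (X + m / (2 * pi) * ((2 * pi)\<^sup>2 * X))"
      using R(2) m b0 by (intro mult_left_mono add_left_mono) auto
    moreover have "X \<le> C\<^sup>2 * Y"
      using poincare_diff_mean[OF C(2) ft(1) wg] by (simp add: X_def Y_def g_def ft(2))
    then have "X / C\<^sup>2 \<le> Y" using C(1) by (simp add: pos_divide_le_eq mult.commute)
    then have "\<mu> / 2 * (X / C\<^sup>2) \<le> \<mu> / 2 * Y" using \<mu> by (intro mult_left_mono) auto
    ultimately show ?thesis by linarith
  qed
  also have "X + m / (2 * pi) * ((2 * pi)\<^sup>2 * X) = (1 + 2 * pi * m) * X"
    by (simp add: power2_eq_square field_simps)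
  also have "b * ((1 + 2 * pi * m) * X) - \<mu> / 2 * (X / C\<^sup>2) \<le> Pe\<^sup>2 / (2 * \<mu>) * ((2 * pi)\<^sup>2 * (1 + m)\<^sup>2 * X) - \<mu> / 2 * (X / C\<^sup>2)"
  proof -
    \<comment> \<open>This uses 1 \<le> 2 pi and only brings the constant into the form of the
      statement.\<close>
    have "1 + 2 * pi * m \<le> 2 * pi * (1 + m)" using pi_gt3 by (simp add: distrib_left)
    then have "(1 + 2 * pi * m)\<^sup>2 \<le> (2 * pi * (1 + m))\<^sup>2" using m by (intro power_mono) auto
    then have "Pe\<^sup>2 / (2 * \<mu>) * ((1 + 2 * pi * m)\<^sup>2 * X) \<le> Pe\<^sup>2 / (2 * \<mu>) * ((2 * pi * (1 + m))\<^sup>2 * X)"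
      using \<mu> X0 by (intro mult_left_mono mult_right_mono) auto
    moreover have "b * ((1 + 2 * pi * m) * X) = Pe\<^sup>2 / (2 * \<mu>) * ((1 + 2 * pi * m)\<^sup>2 * X)"
      by (simp add: b_def power2_eq_square[of "1 + _"] mult.assoc)
    ultimately show ?thesis by (simp only: power_mult_distrib diff_right_mono)
  qed
  also have "\<dots> = - (1/2 * (1 / C\<^sup>2 * \<mu> - (2 * pi)\<^sup>2 * Pe\<^sup>2 * (1 + m)\<^sup>2 / \<mu>)) * X"
    using \<mu> C(1) by (simp add: field_simps)
  finally show ?thesis by (simp add: \<mu>_def X_def g_def)
qed

end

subsection \<open>Exponential decay\<close>

text \<open>Decay between interior times; T > t is arbitrary for a global solution, and s -> 0 is
  left to the caller. \<kappa> may be any nonnegative number below the dissipation rate.\<close>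

lemma energy_decay:
  assumes ws: "weak_solution Pe De T f0 f" and De: "0 < De" and f0: "f0 \<in> L2_per"
    and C: "0 < C" "poincare_constant C" and m: "m = mean f0" "0 \<le> m"
    and \<kappa>: "0 \<le> \<kappa>" "\<kappa> \<le> 1/2 * (1 / C\<^sup>2 * min De 1 - (2 * pi)\<^sup>2 * Pe\<^sup>2 * (1 + m)\<^sup>2 / min De 1)"
    and st: "0 < s" "s < t" "t < T"
  shows "L2_norm (\<lambda>\<xi>. f t \<xi> - m) * exp (\<kappa> * (t - s)) \<le> L2_norm (\<lambda>\<xi>. f s \<xi> - m)"
proof -
  from ws have CL2: "f \<in> C_L2 T" and bo: "f \<in> bochner_L2 H1_per H1_norm T" and jm: "jointly_measurable T f"
    and init: "((\<lambda>t. L2_norm (f t - f0)) \<longlongrightarrow> 0) (at_right 0)"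
    and marg: "AE (t, x) in lborel. (t, x) \<in> {0<..<T} \<times> Omega \<longrightarrow>
        0 \<le> theta_marginal (f t) x \<and> theta_marginal (f t) x \<le> 1"
    unfolding weak_solution_def by blast+
  from ws obtain Df F where Df: "space_gradient T f Df" and wtd: "weak_time_derivative T f F"
    and weak: "\<And>\<phi> D\<phi>. \<phi> \<in> bochner_L2 H1_per H1_norm T \<Longrightarrow> space_gradient T \<phi> D\<phi> \<Longrightarrow>
           (LINT t:{0<..<T}|lebesgue. F t (\<phi> t)) =
             Pe * (LINT (t, x, \<theta>):{0<..<T} \<times> Upsilon|lborel.
                     (1 - theta_marginal (f t) x) * f t (x, \<theta>) * (evec \<theta> \<bullet> fst (D\<phi> t (x, \<theta>))))
             - De * (LINT (t, \<xi>):{0<..<T} \<times> Upsilon|lborel. fst (Df t \<xi>) \<bullet> fst (D\<phi> t \<xi>))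
             - (LINT (t, \<xi>):{0<..<T} \<times> Upsilon|lborel. snd (Df t \<xi>) * snd (D\<phi> t \<xi>))"
    unfolding weak_solution_def by blast
  interpret flux_space T f Df Pe De
    by unfold_locales fact+
  let ?M = "time_measure T"
  have fL2: "f r \<in> L2_per" if "r \<in> {0..T}" for r using CL2 that by (simp add: C_L2_def)
  have fsq: "square_integrable cell (f r)" if "r \<in> {0<..<T}" for r
    using that by (intro L2_per_square_integrable fL2) auto
  have cont: "continuous_on {0<..<T} (coef k)" for k
    unfolding continuous_on_def
  proof
    fix r assume r: "r \<in> {0<..<T}"
    then have "((\<lambda>u. L2_norm (f u - f r)) \<longlongrightarrow> 0) (at r within {0..T})" using CL2 by (simp add: C_L2_def)
    then have "((\<lambda>u. L2_norm (f u - f r)) \<longlongrightarrow> 0) (at r within {0<..<T})"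
      by (rule tendsto_within_subset) auto
    from tendsto_mult_right_zero[OF this, of "sqrt 2"]
    have "((\<lambda>u. coef k u - coef k r) \<longlongrightarrow> 0) (at r within {0<..<T})"
      by (rule Lim_null_comparison[rotated])
        (use r in \<open>auto simp: eventually_at_filter intro!: always_eventually coefficient_diff_le fL2\<close>)
    then show "(coef k \<longlongrightarrow> coef k r) (at r within {0<..<T})" by (simp add: LIM_zero_iff)
  qed
  have meq: "(LINT t|?M. deriv \<eta> t * coef k t) = - (LINT t|?M. \<eta> t * action k t)"
    if "smooth \<eta>" "compactly_supported_in T \<eta>" for \<eta> k
    by (rule mode_equation[OF wtd weak that])
  have inc: "coef k v - coef k u = (LINT r|?M. indicator {u<..<v} r * action k r)"
    if "0 < u" "u < v" "v < T" for k u v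
    by (rule weak_derivative_increment[OF cont mode_action_integrable meq]; (assumption | rule that))
  have mean: "mean (f r) = m" if r: "r \<in> {0<..<T}" for r
  proof -
    let ?k = "((0, 0), 0) :: index"
    \<comment> \<open>Conservation of mass: the constant mode has zero gradient, hence zero action.
      Letting u -> 0 then identifies the constant with that of \<open>f0\<close>.\<close>
    have const: "coef ?k r = coef ?k u" if u: "0 < u" "u < r" for u
      using inc[OF u, of ?k] r
      by (simp add: mode_zero)
    have "((\<lambda>u. sqrt 2 * L2_norm (f u - f0)) \<longlongrightarrow> 0) (at_right 0)"
      using tendsto_mult_right_zero[OF init, of "sqrt 2"] .
    moreover have "\<forall>\<^sub>F u in at_right 0. norm (coef ?k u - (LINT \<xi>|cell. f0 \<xi> * mode ?k \<xi>)) \<le> sqrt 2 * L2_norm (f u - f0)"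
      using eventually_at_right_real[of 0 T]  r
      by (auto elim!: eventually_mono intro!: coefficient_diff_le fL2 f0)
    ultimately have "((\<lambda>u. coef ?k u - (LINT \<xi>|cell. f0 \<xi> * mode ?k \<xi>)) \<longlongrightarrow> 0) (at_right 0)"
      by (rule Lim_null_comparison[rotated])
    moreover have "\<forall>\<^sub>F u in at_right 0. coef ?k u - (LINT \<xi>|cell. f0 \<xi> * mode ?k \<xi>) = coef ?k r - (LINT \<xi>|cell. f0 \<xi> * mode ?k \<xi>)"
      using eventually_at_right_real[of 0 r] r const by (auto elim!: eventually_mono)
    ultimately have "((\<lambda>u. coef ?k r - (LINT \<xi>|cell. f0 \<xi> * mode ?k \<xi>)) \<longlongrightarrow> 0) (at_right (0::real))"
      by (rule Lim_transform_eventually)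
    then have "coef ?k r = (LINT \<xi>|cell. f0 \<xi> * mode ?k \<xi>)"
      by (simp add: tendsto_const_iff)
    then show ?thesis by (simp add: m(1) mean_eq mode_zero)
  qed
  define a where "a r = (LINT \<xi>|cell. flux r \<xi> \<bullet> Df r \<xi>)" for r
  define E where "E r = (LINT \<xi>|cell. (f r \<xi> - m)\<^sup>2)" for r
  have E0: "0 \<le> E r" for r by (simp add: E_def)
  \<comment> \<open>With the mean fixed, E differs from the full energy by a constant, so the energy
    identity for f is one for E.\<close>
  have Eeq: "E r = (LINT \<xi>|cell. (f r \<xi>)\<^sup>2) - m\<^sup>2 * (2 * pi) ^ 3" if r: "r \<in> {0<..<T}" for r
  proof -
    have "(LINT \<xi>|cell. f r \<xi>) = m * (2 * pi) ^ 3" using mean[OF r] by (simp add: mean_eq field_simps)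
    then show ?thesis
      using integral_power2_add[OF fsq[OF r] cell.square_integrable_const[of "- m"]]
      by (simp add: E_def measure_cell power2_eq_square)
  qed
  have diff: "E v - E u = 2 * (LINT r|?M. indicator {u<..<v} r * a r)" if "0 < u" "u < v" "v < T" for u v
  proof -
    have "(LINT \<xi>|cell. (f v \<xi>)\<^sup>2) - (LINT \<xi>|cell. (f u \<xi>)\<^sup>2) = 2 * (LINT r|?M. indicator {u<..<v} r * a r)"
      unfolding a_def by (rule energy_identity(1)[OF cont meq fsq]; (assumption | rule that))
    then show ?thesis using Eeq[of u] Eeq[of v] that by simp
  qed
  have ai: "integrable ?M a"
    unfolding a_def[abs_def] by (rule energy_identity(2)[OF cont meq fsq st])
  have diss: "AE r in ?M. a r \<le> - \<kappa> * E r"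
    using slices_AE marginal_AE_time AE_space[of ?M]
  proof eventually_elim
    case (elim r)
    then have r: "r \<in> {0<..<T}" by (simp add: space_time_measure)
    have "a r \<le> - (1/2 * (1 / C\<^sup>2 * min De 1 - (2 * pi)\<^sup>2 * Pe\<^sup>2 * (1 + m)\<^sup>2 / min De 1)) * E r"
      unfolding a_def E_def
      by (rule dissipation[OF De C m(2) _ mean[OF r]]) (use elim r fL2 in auto)
    also have "\<dots> \<le> - \<kappa> * E r" using \<kappa>(2) E0[of r] by (intro mult_right_mono) auto
    finally show ?case .
  qed
  have ind: "integrable ?M (\<lambda>r. indicator {u<..<v} r * a r)" for u v
  proof (rule Bochner_Integration.integrable_bound[OF ai])
    have "(indicator {u<..<v} :: real \<Rightarrow> real) \<in> borel_measurable ?M" by (intro measurable_time) simp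
    then show "(\<lambda>r. indicator {u<..<v} r * a r) \<in> borel_measurable ?M"
      by (intro borel_measurable_times borel_measurable_integrable[OF ai])
  qed (auto simp: indicator_def)
  \<comment> \<open>Monotonicity comes first: on (u, v) it allows E r to be replaced by its lower
    bound E v, which produces the implicit Euler step without integrating E.\<close>
  have mono: "E v \<le> E u" if "0 < u" "u < v" "v < T" for u v
  proof -
    have "(LINT r|?M. indicator {u<..<v} r * a r) \<le> (LINT r|?M. 0)"
    proof (rule integral_mono_AE[OF ind])
      show "AE r in ?M. indicator {u<..<v} r * a r \<le> 0"
        using diss
      proof eventually_elim
        case (elim r)
        have "0 \<le> \<kappa> * E r" using \<kappa>(1) E0 by simp
        with elim show ?case by (simp add: indicator_def)
      qed
    qed simp
    then show ?thesis using diff[OF that] by simp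
  qed
  have step: "E v * (1 + 2 * \<kappa> * (v - u)) \<le> E u" if uv: "0 < u" "u < v" "v < T" for u v
  proof -
    have iI: "(LINT r|?M. indicator {u<..<v} r) = v - u"
    proof -
      have "(LINT r|?M. indicator {u<..<v} r) = (LINT r|lborel. indicat_real {u<..<v} r)"
        unfolding integral_time set_lebesgue_integral_def
        using uv by (intro Bochner_Integration.integral_cong) (auto simp: indicator_def)
      then show ?thesis using uv by simp
    qed
    have "(LINT r|?M. indicator {u<..<v} r * a r) \<le> (LINT r|?M. indicator {u<..<v} r * (- \<kappa> * E v))"
    proof (rule integral_mono_AE[OF ind])
      have "integrable ?M (indicat_real {u<..<v})"
        by (intro time.integrable_const_bound[where B = 1] measurable_time) auto
      then show "integrable ?M (\<lambda>r. indicator {u<..<v} r * (- \<kappa> * E v))" by simp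
      show "AE r in ?M. indicator {u<..<v} r * a r \<le> indicator {u<..<v} r * (- \<kappa> * E v)"
        using diss
      proof eventually_elim
        case (elim r)
        show ?case
        proof (cases "r \<in> {u<..<v}")
          case True
          then have "\<kappa> * E v \<le> \<kappa> * E r" using uv \<kappa>(1) by (intro mult_left_mono mono) auto
          with elim True show ?thesis by simp
        qed simp
      qed
    qed
    also have "\<dots> = (v - u) * (- \<kappa> * E v)" using iI by simp
    finally show ?thesis using diff[OF uv] by (simp add: algebra_simps)
  qed
  have "E t * exp (2 * \<kappa> * (t - s)) \<le> E s"
    using gronwall_discrete[of "2 * \<kappa>" s t E] \<kappa>(1) st step by simp
  then have "sqrt (E t * exp (2 * \<kappa> * (t - s))) \<le> sqrt (E s)" by (rule real_sqrt_le_mono)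
  moreover have "exp (2 * \<kappa> * (t - s)) = (exp (\<kappa> * (t - s)))\<^sup>2"
    by (simp add: power2_eq_square flip: exp_add)
  ultimately show ?thesis by (simp add: L2_norm_eq E_def real_sqrt_mult)
qed

theorem theorem6:
  fixes Pe De C\<^sub>P \<kappa> :: real
    and f0 :: "point \<Rightarrow> real" and f :: "real \<Rightarrow> point \<Rightarrow> real"
  assumes "De > 0"
    and "f0 \<in> L2_per"
    and "AE \<xi> in lborel. 0 \<le> f0 \<xi>"
    and "AE x in lborel. x \<in> Omega \<longrightarrow> 0 \<le> theta_marginal f0 x \<and> theta_marginal f0 x \<le> 1"
    and "global_weak_solution Pe De f0 f"
    and "poincare_constant C\<^sub>P"
    and "\<bar>Pe\<bar> < min De 1 / (2 * sqrt 2 * pi * C\<^sub>P * (1 + mean f0))"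
    and "\<kappa> = 1/2 * (1/2 * (1 / C\<^sub>P\<^sup>2) * min De 1
                     - (2 * pi)\<^sup>2 * Pe\<^sup>2 * (1 + mean f0)\<^sup>2 / min De 1)"
  shows "\<kappa> > 0 \<and>
    (\<forall>t\<ge>0. L2_norm (\<lambda>\<xi>. f t \<xi> - mean f0) \<le> exp (- \<kappa> * t) * L2_norm (\<lambda>\<xi>. f0 \<xi> - mean f0))"
proof -
  define m \<mu> where "m = mean f0" and "\<mu> = min De 1"
  have \<mu>: "0 < \<mu>" using assms(1) by (simp add: \<mu>_def)
  have "AE \<xi> in cell. 0 \<le> f0 \<xi>" using assms(3) unfolding AE_cell by eventually_elim simp
  then have m: "0 \<le> m" by (simp add: m_def mean_eq integral_nonneg_AE)
  \<comment> \<open>Otherwise the bound on |Pe| would be nonpositive, also for a zero denominator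
    since division by 0 gives 0.\<close>
  have C: "0 < C\<^sub>P"
  proof (rule ccontr)
    assume "\<not> 0 < C\<^sub>P"
    then have "min De 1 / (2 * sqrt 2 * pi * C\<^sub>P * (1 + mean f0)) \<le> 0"
      using \<mu> m by (intro divide_nonneg_nonpos mult_nonpos_nonneg mult_nonneg_nonpos) (auto simp: \<mu>_def m_def)
    then show False using assms(7) by linarith
  qed
  \<comment> \<open>As (2 sqrt 2 pi)^2 = 8 pi^2, squaring the smallness condition gives (2 pi)^2
    Pe^2 (1 + m)^2 / \<mu> < \<mu> / (2 C_P^2).\<close>
  have \<kappa>_pos: "\<kappa> > 0"
  proof -
    define d where "d = 2 * sqrt 2 * pi * C\<^sub>P * (1 + m)"
    have d: "0 < d" using C m by (simp add: d_def)
    have "\<bar>Pe\<bar> * d < \<mu>" using assms(7) d by (simp add: pos_less_divide_eq d_def \<mu>_def m_def)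
    then have "(\<bar>Pe\<bar> * d)\<^sup>2 < \<mu>\<^sup>2" using d by (intro power_strict_mono) auto
    then have "8 * pi\<^sup>2 * Pe\<^sup>2 * C\<^sub>P\<^sup>2 * (1 + m)\<^sup>2 < \<mu>\<^sup>2" by (simp add: d_def power_mult_distrib mult_ac)
    then have "(2 * pi)\<^sup>2 * Pe\<^sup>2 * (1 + m)\<^sup>2 / \<mu> < 1/2 * (1 / C\<^sub>P\<^sup>2) * \<mu>"
      using \<mu> C by (simp add: field_simps power2_eq_square)
    then show ?thesis by (simp add: assms(8) \<mu>_def m_def)
  qed
  \<comment> \<open>The statement has C_P^-2 / 2 where the dissipation estimate provides
    C_P^-2.\<close>
  have \<kappa>_le: "\<kappa> \<le> 1/2 * (1 / C\<^sub>P\<^sup>2 * min De 1 - (2 * pi)\<^sup>2 * Pe\<^sup>2 * (1 + m)\<^sup>2 / min De 1)"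
  proof -
    have "0 \<le> 1 / C\<^sub>P\<^sup>2 * min De 1" using \<mu> by (simp add: \<mu>_def)
    moreover have "1/2 * (1/2 * y - z) \<le> 1/2 * (y - z)" if "0 \<le> y" for y z :: real
      by (intro mult_left_mono diff_right_mono) (use that in auto)
    ultimately show ?thesis unfolding assms(8) m_def mult.assoc[of "1/2" "1 / C\<^sub>P\<^sup>2"] by blast
  qed
  have ws: "weak_solution Pe De T f0 f" if "T > 0" for T using assms(5) that by (simp add: global_weak_solution_def)
  have init: "((\<lambda>t. L2_norm (f t - f0)) \<longlongrightarrow> 0) (at_right 0)" using ws[of 1] by (simp add: weak_solution_def)
  have L2: "f t \<in> L2_per" if "t \<ge> 0" for t
    using ws[of "t + 1"] that by (simp add: weak_solution_def C_L2_def)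
  have sq: "square_integrable cell (\<lambda>\<xi>. u \<xi> - v \<xi>)" if "u \<in> L2_per" "v \<in> L2_per" for u v :: "point \<Rightarrow> real"
    using that by (intro square_integrable_diff L2_per_square_integrable)
  have sqm: "square_integrable cell (\<lambda>\<xi>. u \<xi> - m)" if "u \<in> L2_per" for u
    using that by (intro square_integrable_diff L2_per_square_integrable cell.square_integrable_const)
  have sqd: "square_integrable cell (u - v)" if "u \<in> L2_per" "v \<in> L2_per" for u v :: "point \<Rightarrow> real"
    using sq[OF that] by (simp add: fun_diff_def)
  let ?N = "L2_norm (\<lambda>\<xi>. f0 \<xi> - m)"
  have tri: "L2_norm (\<lambda>\<xi>. f s \<xi> - m) \<le> L2_norm (f s - f0) + ?N" if "s > 0" for s
    using L2_norm_triangle[OF sqd[OF L2[of s] assms(2)] sqm[OF assms(2)]] that by simp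
  have "L2_norm (\<lambda>\<xi>. f t \<xi> - m) \<le> exp (- \<kappa> * t) * ?N" if t: "t \<ge> 0" for t
  proof (cases "t = 0")
    case True
    \<comment> \<open>\<open>f 0\<close> and \<open>f0\<close> are linked only through limits from
      the right: continuity of f at 0 and the initial condition.\<close>
    have "f \<in> C_L2 1" using ws[of 1] by (simp add: weak_solution_def)
    then have "((\<lambda>s. L2_norm (f s - f 0)) \<longlongrightarrow> 0) (at 0 within {0..1})" by (simp add: C_L2_def)
    then have "((\<lambda>s. L2_norm (f s - f 0)) \<longlongrightarrow> 0) (at_right 0)" by (simp add: at_within_Icc_at_right)
    from tendsto_add[OF this tendsto_add[OF init tendsto_const]]
    have lim: "((\<lambda>s. L2_norm (f s - f 0) + (L2_norm (f s - f0) + ?N)) \<longlongrightarrow> ?N) (at_right 0)" by simp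
    have "L2_norm (\<lambda>\<xi>. f 0 \<xi> - m) \<le> L2_norm (f s - f 0) + (L2_norm (f s - f0) + ?N)" if "s > 0" for s
    proof -
      have "L2_norm (\<lambda>\<xi>. (f 0 - f s) \<xi> + (f s \<xi> - m)) \<le> L2_norm (f 0 - f s) + L2_norm (\<lambda>\<xi>. f s \<xi> - m)"
        using that by (intro L2_norm_triangle sqd sqm L2) auto
      moreover have "L2_norm (f 0 - f s) = L2_norm (f s - f 0)"
        by (simp add: L2_norm_eq power2_commute)
      ultimately show ?thesis using tri[OF that] by simp
    qed
    then have "\<forall>\<^sub>F s in at_right 0. L2_norm (\<lambda>\<xi>. f 0 \<xi> - m) \<le> L2_norm (f s - f 0) + (L2_norm (f s - f0) + ?N)"
      by (simp add: eventually_at_filter)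
    then have "L2_norm (\<lambda>\<xi>. f 0 \<xi> - m) \<le> ?N"
      by (intro tendsto_lowerbound[OF lim]) simp_all
    then show ?thesis using True by simp
  next
    case False
    with t have t0: "0 < t" by simp
    have dec: "L2_norm (\<lambda>\<xi>. f t \<xi> - m) * exp (\<kappa> * (t - s)) \<le> L2_norm (f s - f0) + ?N" if s: "0 < s" "s < t" for s
    proof -
      have "L2_norm (\<lambda>\<xi>. f t \<xi> - m) * exp (\<kappa> * (t - s)) \<le> L2_norm (\<lambda>\<xi>. f s \<xi> - m)"
        by (rule energy_decay[where T = "t + 1", OF _ assms(1,2) C assms(6) m_def m _ \<kappa>_le])
          (use ws[of "t + 1"] t0 s \<kappa>_pos in auto)
      then show ?thesis using tri[OF s(1)] by linarith
    qed
    \<comment> \<open>Now s tends to 0 with t fixed: the initial condition controls the right side,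
      and the exponential on the left is continuous in s.\<close>
    have r: "((\<lambda>s. L2_norm (f s - f0) + ?N) \<longlongrightarrow> 0 + ?N) (at_right 0)" by (intro tendsto_add init tendsto_const)
    have l: "((\<lambda>s. L2_norm (\<lambda>\<xi>. f t \<xi> - m) * exp (\<kappa> * (t - s))) \<longlongrightarrow> L2_norm (\<lambda>\<xi>. f t \<xi> - m) * exp (\<kappa> * (t - 0))) (at_right 0)"
      by (intro tendsto_intros)
    have "\<forall>\<^sub>F s in at_right 0. L2_norm (\<lambda>\<xi>. f t \<xi> - m) * exp (\<kappa> * (t - s)) \<le> L2_norm (f s - f0) + ?N"
      using eventually_at_right_real[OF t0] by eventually_elim (simp add: dec)
    from tendsto_le[OF _ r l this] have "L2_norm (\<lambda>\<xi>. f t \<xi> - m) * exp (\<kappa> * t) \<le> ?N" by simp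
    then show ?thesis by (simp add: exp_minus field_simps)
  qed
  with \<kappa>_pos show ?thesis by (simp add: m_def)
qed

end
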